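(* Let $T=(T_1,\ldots,T_k)$ be a $k$-tuple in the regular $\Lambda$-polyball $\mathbf B_\Lambda(\mathcal H)$. Then there is a Hilbert space $\mathcal K\supset\mathcal H$ and a $k$-tuple $V=(V_1,\ldots,V_k)$ of doubly $\Lambda$-commuting row isometries on $\mathcal K$ such that $$T_{i,s}^*=V_{i,s}^*|_{\mathcal H},\qquad i\in\{1,\ldots,k\},\ s\in\{1,\ldots,n_i\},$$ and such that the dilation is minimal, i.e. $$\mathcal K=\overline{\operatorname{span}}\{V_{1,\alpha_1}\cdots V_{k,\alpha_k}\mathcal H:\ \alpha_1\in\mathbb F_{n_1}^+,\ldots,\alpha_k\in\mathbb F_{n_k}^+\}.$$ Moreover, the minimal dilation is unique up to an isomorphism.
   Context: Fix integers $k\ge1$, $n_1,\ldots,n_k\ge 1$ and, for $i\ne j$ in $\{1,\ldots,k\}$, an $n_i\times n_j$ matrix $\Lambda_{i,j}=[\lambda_{i,j}(s,t)]$ with entries in $\mathbb T=\{z\in\mathbb C:|z|=1\}$, such that $\lambda_{j,i}(t,s)=\overline{\lambda_{i,j}(s,t)}$. For $T=(T_1,\ldots,T_k)$ with $T_i=[T_{i,1}\cdots T_{i,n_i}]$, $T_{i,s}\in B(\mathcal H)$, let $\Phi_{rT_i}(X):=\sum_{s=1}^{n_i}r^2T_{i,s}XT_{i,s}^*$. The regular $\Lambda$-polyball $\mathbf B_\Lambda(\mathcal H)$ is the set of $T$ with $\sum_sT_{i,s}T_{i,s}^*\le I$ for each $i$, $T_{i,s}T_{j,t}=\lambda_{i,j}(s,t)T_{j,t}T_{i,s}$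 for all $i\ne j$, $s,t$, and $(id-\Phi_{rT_1})\circ\cdots\circ(id-\Phi_{rT_k})(I)\ge0$ for all $r\in[0,1)$. A row isometry $V_i=[V_{i,1}\cdots V_{i,n_i}]$ on $\mathcal K$ consists of $V_{i,s}\in B(\mathcal K)$ with $V_{i,s}^*V_{i,t}=\delta_{st}I$. Row isometries $V_1,\ldots,V_k$ are doubly $\Lambda$-commuting if $V_{i,s}^*V_{j,t}=\overline{\lambda_{i,j}(s,t)}\,V_{j,t}V_{i,s}^*$ for all $i\neq j$ and all $s,t$. $\mathbb F_{n_i}^+$ is the unital free semigroup with generators $g_1^i,\ldots,g_{n_i}^i$ and neutral element $g_0^i$; $V_{i,\alpha}:=V_{i,p_1}\cdots V_{i,p_m}$ for $\alpha=g^i_{p_1}\cdots g^i_{p_m}$, $V_{i,g_0^i}:=I$. A minimal dilation of $T$ is a $k$-tuple $V=(V_1,\ldots,V_k)$ of doubly $\Lambda$-commuting row isometries on a Hilbert space $\mathcal K\supset\mathcal H$ such that $T_{i,s}^*=V_{i,s}^*|_{\mathcal H}$ for all $i\in\{1,\ldots,k\}$, $s\in\{1,\ldots,n_i\}$, and $\mathcal K=\overline{\operatorname{span}}\{V_{1,\alpha_1}\cdots V_{k,\alpha_k}\mathcal H:\ \alpha_1\in\mathbb F_{n_1}^+,\ldots,\alpha_k\in\mathbb F_{n_k}^+\}$. Two minimal dilations $V$ on $\mathcal K\supset\mathcal H$ and $V'$ on $\mathcal K'\supset\mathcal H$ of $T$ are isomorphic if there is a unitary $U:\mathcal K\to\mathcal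 K'$ with $UV_{i,s}=V'_{i,s}U$ for all $i,s$ and $Uh=h$ for $h\in\mathcal H$. *)

theory Defs
  imports
    "HOL-Analysis.Analysis"
    "HOL-Library.Complex_Order"
    "HOL-Library.Function_Algebras"
begin

section \<open>Complex Hilbert spaces\<close>

text \<open>A Hilbert space is a set \<open>hcarrier H\<close> of vectors, given as a linear subspace of an ambient
  complex vector space (the whole type, which carries no norm). The carrier is explicit because a
  dilation space has to be asserted to exist inside a fixed type. Operators are functions on the
  type, of which only the values on the carrier matter; equality of operators is always stated
  pointwise on the carrier.\<close>

record 'a hspace =
  hcarrier :: "'a set"
  hscale :: "complex \<Rightarrow> 'a \<Rightarrow> 'a"
  hinner :: "'a \<Rightarrow> 'a \<Rightarrow> complex"

definition hnorm :: "('a, 'm) hspace_scheme \<Rightarrow> 'a \<Rightarrow> real" where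
  "hnorm H x = sqrt (Re (hinner H x x))"

text \<open>The inner product is unspecified off the carrier, whereas \<^locale>\<open>Metric_space\<close> requires
  symmetry and nonnegativity on the whole type; hence the value \<open>0\<close> there.\<close>

definition hdist :: "('a::ab_group_add, 'm) hspace_scheme \<Rightarrow> 'a \<Rightarrow> 'a \<Rightarrow> real" where
  "hdist H x y = (if x \<in> hcarrier H \<and> y \<in> hcarrier H then hnorm H (x - y) else 0)"

locale hilbert_space = vector_space "hscale H" for H :: "'a::ab_group_add hspace" +
  assumes subspace_hcarrier: "subspace (hcarrier H)"
    and hinner_add: "\<And>x y z. \<lbrakk>x \<in> hcarrier H; y \<in> hcarrier H; z \<in> hcarrier H\<rbrakk>
          \<Longrightarrow> hinner H (x + y) z = hinner H x z + hinner H y z"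
    and hinner_scale: "\<And>c x y. \<lbrakk>x \<in> hcarrier H; y \<in> hcarrier H\<rbrakk>
          \<Longrightarrow> hinner H (hscale H c x) y = c * hinner H x y"
    and hinner_commute: "\<And>x y. \<lbrakk>x \<in> hcarrier H; y \<in> hcarrier H\<rbrakk>
          \<Longrightarrow> hinner H y x = cnj (hinner H x y)"
    and hinner_pos: "\<And>x. \<lbrakk>x \<in> hcarrier H; x \<noteq> 0\<rbrakk> \<Longrightarrow> 0 < hinner H x x"
    and complete: "Metric_space.mcomplete (hcarrier H) (hdist H)"

definition hclosed_span :: "'a::ab_group_add hspace \<Rightarrow> 'a set \<Rightarrow> 'a set" where
  "hclosed_span H S =
     Metric_space.mtopology (hcarrier H) (hdist H) closure_of (module.span (hscale H) S)"

section \<open>Operators\<close>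

definition linear_map ::
  "'a::ab_group_add hspace \<Rightarrow> 'b::ab_group_add hspace \<Rightarrow> ('a \<Rightarrow> 'b) \<Rightarrow> bool" where
  "linear_map H K A \<longleftrightarrow>
     A \<in> hcarrier H \<rightarrow> hcarrier K \<and>
     (\<forall>x\<in>hcarrier H. \<forall>y\<in>hcarrier H. A (x + y) = A x + A y) \<and>
     (\<forall>c. \<forall>x\<in>hcarrier H. A (hscale H c x) = hscale K c (A x))"

definition bounded_operator :: "'a::ab_group_add hspace \<Rightarrow> ('a \<Rightarrow> 'a) \<Rightarrow> bool" where
  "bounded_operator H A \<longleftrightarrow>
     linear_map H H A \<and> (\<exists>C. \<forall>x\<in>hcarrier H. hnorm H (A x) \<le> C * hnorm H x)"

definition isometric_map ::
  "'a::ab_group_add hspace \<Rightarrow> 'b::ab_group_add hspace \<Rightarrow> ('a \<Rightarrow> 'b) \<Rightarrow> bool" where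
  "isometric_map H K U \<longleftrightarrow>
     linear_map H K U \<and>
     (\<forall>x\<in>hcarrier H. \<forall>y\<in>hcarrier H. hinner K (U x) (U y) = hinner H x y)"

definition unitary_map ::
  "'a::ab_group_add hspace \<Rightarrow> 'b::ab_group_add hspace \<Rightarrow> ('a \<Rightarrow> 'b) \<Rightarrow> bool" where
  "unitary_map H K U \<longleftrightarrow> isometric_map H K U \<and> U ` hcarrier H = hcarrier K"

text \<open>For bounded \<open>A\<close> on a Hilbert space, such a \<open>B\<close> exists by the Riesz representation theorem, is
  determined on the carrier, and is automatically linear and bounded.\<close>

definition adj :: "'a::ab_group_add hspace \<Rightarrow> ('a \<Rightarrow> 'a) \<Rightarrow> 'a \<Rightarrow> 'a" where
  "adj H A = (SOME B. B \<in> hcarrier H \<rightarrow> hcarrier H \<and>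
     (\<forall>x\<in>hcarrier H. \<forall>y\<in>hcarrier H. hinner H (A x) y = hinner H x (B y)))"

text \<open>The inequality between complex numbers includes that the right-hand side is real.\<close>

definition op_le :: "'a::ab_group_add hspace \<Rightarrow> ('a \<Rightarrow> 'a) \<Rightarrow> ('a \<Rightarrow> 'a) \<Rightarrow> bool" where
  "op_le H A B \<longleftrightarrow> (\<forall>x\<in>hcarrier H. 0 \<le> hinner H (B x - A x) x)"

section \<open>The regular \<open>\<Lambda>\<close>-polyball\<close>

text \<open>\<open>\<lambda>\<^sub>i\<^sub>,\<^sub>j(s,t)\<close> is \<open>lam i j s t\<close>, and \<open>T\<^sub>i\<^sub>,\<^sub>s\<close> is \<open>T i s\<close>, with \<open>1 \<le> i \<le> k\<close> and \<open>1 \<le> s \<le> n i\<close>.\<close>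

definition Phi ::
  "'a::ab_group_add hspace \<Rightarrow> nat \<Rightarrow> real \<Rightarrow> (nat \<Rightarrow> 'a \<Rightarrow> 'a) \<Rightarrow> ('a \<Rightarrow> 'a) \<Rightarrow> 'a \<Rightarrow> 'a" where
  "Phi H m r A X = (\<lambda>x. \<Sum>s\<in>{1..m}. hscale H (of_real (r\<^sup>2)) (A s (X (adj H (A s) x))))"

definition defect_op ::
  "'a::ab_group_add hspace \<Rightarrow> nat \<Rightarrow> (nat \<Rightarrow> nat) \<Rightarrow> real \<Rightarrow> (nat \<Rightarrow> nat \<Rightarrow> 'a \<Rightarrow> 'a) \<Rightarrow> 'a \<Rightarrow> 'a" where
  "defect_op H k n r T =
     foldr (\<lambda>i X. (\<lambda>x. X x - Phi H (n i) r (T i) X x)) [1..<Suc k] (\<lambda>x. x)"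

definition polyball ::
  "nat \<Rightarrow> (nat \<Rightarrow> nat) \<Rightarrow> (nat \<Rightarrow> nat \<Rightarrow> nat \<Rightarrow> nat \<Rightarrow> complex) \<Rightarrow> 'a::ab_group_add hspace \<Rightarrow>
     (nat \<Rightarrow> nat \<Rightarrow> 'a \<Rightarrow> 'a) set" where
  "polyball k n lam H = {T.
     (\<forall>i\<in>{1..k}. \<forall>s\<in>{1..n i}. bounded_operator H (T i s)) \<and>
     (\<forall>i\<in>{1..k}. op_le H (\<lambda>x. \<Sum>s\<in>{1..n i}. T i s (adj H (T i s) x)) (\<lambda>x. x)) \<and>
     (\<forall>i\<in>{1..k}. \<forall>j\<in>{1..k}. i \<noteq> j \<longrightarrow> (\<forall>s\<in>{1..n i}. \<forall>t\<in>{1..n j}. \<forall>x\<in>hcarrier H.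
        T i s (T j t x) = hscale H (lam i j s t) (T j t (T i s x)))) \<and>
     (\<forall>r\<in>{0..<1}. op_le H (\<lambda>x. 0) (defect_op H k n r T))}"

section \<open>Doubly \<open>\<Lambda>\<close>-commuting row isometries and dilations\<close>

definition row_isometry :: "'a::ab_group_add hspace \<Rightarrow> nat \<Rightarrow> (nat \<Rightarrow> 'a \<Rightarrow> 'a) \<Rightarrow> bool" where
  "row_isometry K m W \<longleftrightarrow>
     (\<forall>s\<in>{1..m}. bounded_operator K (W s)) \<and>
     (\<forall>s\<in>{1..m}. \<forall>t\<in>{1..m}. \<forall>x\<in>hcarrier K. adj K (W s) (W t x) = (if s = t then x else 0))"

definition doubly_commuting ::
  "nat \<Rightarrow> (nat \<Rightarrow> nat) \<Rightarrow> (nat \<Rightarrow> nat \<Rightarrow> nat \<Rightarrow> nat \<Rightarrow> complex) \<Rightarrow> 'a::ab_group_add hspace \<Rightarrow>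
     (nat \<Rightarrow> nat \<Rightarrow> 'a \<Rightarrow> 'a) \<Rightarrow> bool" where
  "doubly_commuting k n lam K V \<longleftrightarrow>
     (\<forall>i\<in>{1..k}. \<forall>j\<in>{1..k}. i \<noteq> j \<longrightarrow> (\<forall>s\<in>{1..n i}. \<forall>t\<in>{1..n j}. \<forall>x\<in>hcarrier K.
        adj K (V i s) (V j t x) = hscale K (cnj (lam i j s t)) (V j t (adj K (V i s) x))))"

text \<open>The free semigroup on \<open>m\<close> generators is \<open>lists {1..m}\<close>; the word \<open>[p\<^sub>1, \<dots>, p\<^sub>l]\<close> acts as
  \<open>W\<^sub>p\<^sub>1 \<cdots> W\<^sub>p\<^sub>l\<close>.\<close>

definition word_op :: "(nat \<Rightarrow> 'a \<Rightarrow> 'a) \<Rightarrow> nat list \<Rightarrow> 'a \<Rightarrow> 'a" where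
  "word_op W \<alpha> = foldr W \<alpha>"

definition multiword_op ::
  "nat \<Rightarrow> (nat \<Rightarrow> nat \<Rightarrow> 'a \<Rightarrow> 'a) \<Rightarrow> (nat \<Rightarrow> nat list) \<Rightarrow> 'a \<Rightarrow> 'a" where
  "multiword_op k V \<alpha> = foldr (\<lambda>i. word_op (V i) (\<alpha> i)) [1..<Suc k]"

text \<open>The inclusion of \<open>H\<close> in the dilation space \<open>K\<close> is a linear isometry \<open>J\<close>, since the two spaces
  may live in different types.\<close>

definition minimal_dilation ::
  "nat \<Rightarrow> (nat \<Rightarrow> nat) \<Rightarrow> (nat \<Rightarrow> nat \<Rightarrow> nat \<Rightarrow> nat \<Rightarrow> complex) \<Rightarrow> 'a::ab_group_add hspace \<Rightarrow>
     (nat \<Rightarrow> nat \<Rightarrow> 'a \<Rightarrow> 'a) \<Rightarrow> 'b::ab_group_add hspace \<Rightarrow> ('a \<Rightarrow> 'b) \<Rightarrow>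
     (nat \<Rightarrow> nat \<Rightarrow> 'b \<Rightarrow> 'b) \<Rightarrow> bool" where
  "minimal_dilation k n lam H T K J V \<longleftrightarrow>
     hilbert_space K \<and> isometric_map H K J \<and>
     (\<forall>i\<in>{1..k}. row_isometry K (n i) (V i)) \<and>
     doubly_commuting k n lam K V \<and>
     (\<forall>i\<in>{1..k}. \<forall>s\<in>{1..n i}. \<forall>h\<in>hcarrier H. adj K (V i s) (J h) = J (adj H (T i s) h)) \<and>
     hcarrier K = hclosed_span K
       (\<Union>\<alpha>\<in>{\<alpha>. \<forall>i\<in>{1..k}. \<alpha> i \<in> lists {1..n i}}. multiword_op k V \<alpha> ` J ` hcarrier H)"

definition isomorphic_dilations ::
  "nat \<Rightarrow> (nat \<Rightarrow> nat) \<Rightarrow> 'a::ab_group_add hspace \<Rightarrow>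
     'b::ab_group_add hspace \<Rightarrow> ('a \<Rightarrow> 'b) \<Rightarrow> (nat \<Rightarrow> nat \<Rightarrow> 'b \<Rightarrow> 'b) \<Rightarrow>
     'c::ab_group_add hspace \<Rightarrow> ('a \<Rightarrow> 'c) \<Rightarrow> (nat \<Rightarrow> nat \<Rightarrow> 'c \<Rightarrow> 'c) \<Rightarrow> bool" where
  "isomorphic_dilations k n H K J V K' J' V' \<longleftrightarrow>
     (\<exists>U. unitary_map K K' U \<and>
       (\<forall>i\<in>{1..k}. \<forall>s\<in>{1..n i}. \<forall>x\<in>hcarrier K. U (V i s x) = V' i s (U x)) \<and>
       (\<forall>h\<in>hcarrier H. U (J h) = J' h))"

text \<open>A type large enough for every minimal dilation: a vector \<open>x\<close> of the dilation space is determined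
  by the compressions to \<open>H\<close> of \<open>(V\<^sub>1\<^sub>,\<^sub>\<alpha>\<^sub>1 \<cdots> V\<^sub>k\<^sub>,\<^sub>\<alpha>\<^sub>k)\<^sup>* x\<close>, as the words \<open>\<alpha>\<^sub>1, \<dots>, \<alpha>\<^sub>k\<close> vary.\<close>

type_synonym 'a dilation_vec = "(nat \<Rightarrow> nat list) \<Rightarrow> 'a"

end

theory Submission
  imports Defs
begin

text \<open>In a dilation, \<open>V\<^sub>i\<^sub>,\<^sub>s\<^sup>*\<close> can be moved through \<open>V\<^sub>1\<^sub>,\<^sub>\<alpha>\<^sub>1 \<cdots> V\<^sub>k\<^sub>,\<^sub>\<alpha>\<^sub>k h\<close>: it removes a letter, kills the
  vector, or reaches \<open>h\<close> and becomes \<open>T\<^sub>i\<^sub>,\<^sub>s\<^sup>*\<close>. Hence the Gram matrix of the generating vectors is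
  determined by \<open>T\<close> and \<open>\<Lambda>\<close>, and uniqueness follows.

  For existence, \<open>h\<close> is represented by the function \<open>\<beta> \<mapsto> T\<^sub>\<beta>\<^sup>* h\<close> on multi-words and \<open>V\<^sub>i\<^sub>,\<^sub>s\<close> by a
  weighted shift. Outside a large box of multi-words the functions involved continue by applying the
  \<open>T\<^sub>i\<^sub>,\<^sub>s\<^sup>*\<close>, so the semi-inner product is the finite sum over the box of the forms of
  \<open>\<Prod>\<^sub>i\<^sub>\<in>\<^sub>S (id - \<Phi>\<^sub>T\<^sub>i)(I)\<close>, where \<open>S\<close> is the set of coordinates in which the word is not of maximal
  length; the sum does not change when the box grows. These partial defects are nonnegative: for
  \<open>r < 1\<close> the maps \<open>id - \<Phi>\<^sub>r\<^sub>T\<^sub>i\<close> have positive inverses, so factors can be dropped from the full defect,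
  and then \<open>r\<close> tends to \<open>1\<close>.\<close>

section \<open>Semi-inner products\<close>

text \<open>The function attached to \<open>h\<close> is the noncommutative Poisson kernel, h -> sum
  over \<beta> of e_\<beta> (x) D^(1/2) T_\<beta>^* h, with the root of the defect D moved from the
  vectors into the form. The obstacle is that this kernel is isometric only if no mass escapes to
  long words. The box form keeps that mass on the words of maximal length, which carry no defect in
  that coordinate; hence neither operator roots nor a separate Cuntz-type summand has to be built.
  All scalars come from fixing the order 1, ..., k of the blocks. A new letter at the front of block
  i has to cross the blocks before i (\<open>shift_coeff\<close>); an adjoint at the end of block i
  has to cross the blocks after i (\<open>tail_coeff\<close>). The form on these functions may be
  degenerate, so the dilation space is a completion. It consists of functions on multi-words again,
  but of different ones: a vector x is stored there by the compressions to H of V_\<alpha>^* x. The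
  two encodings differ: at the empty multi-word the shift of the function of \<open>h\<close>
  vanishes, whereas the compression of V_(i,s) h is T_(i,s) h.\<close>

lemma eventually_less_inverse:
  fixes f :: "nat \<Rightarrow> real"
  assumes f: "\<And>m. f m < inverse (real (Suc m))" and e: "e > 0"
  shows "\<exists>M. \<forall>m\<ge>M. f m < e"
proof -
  obtain M where M: "inverse (real (Suc M)) < e" using reals_Archimedean[OF e] by blast
  have "f m < e" if "m \<ge> M" for m
  proof -
    have "inverse (real (Suc m)) \<le> inverse (real (Suc M))"
      using that by (intro le_imp_inverse_le) auto
    then show ?thesis using f[of m] M by linarith
  qed
  then show ?thesis by blast
qed

text \<open>Kept outside the locale, with the form as an argument, so that the interpretation for a
  Hilbert space can rewrite it to \<open>hnorm H\<close> and one set of lemmas serves both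
  norms.\<close>

definition qnorm :: "('a \<Rightarrow> 'a \<Rightarrow> complex) \<Rightarrow> 'a \<Rightarrow> real" where
  "qnorm q x = sqrt (Re (q x x))"

text \<open>Positivity is only semidefinite, because the form on the model functions may have
  nonzero null vectors; they disappear in the completion.\<close>

locale semi_inner = vector_space scale
  for scale :: "complex \<Rightarrow> 'a::ab_group_add \<Rightarrow> 'a" +
  fixes S :: "'a set" and q :: "'a \<Rightarrow> 'a \<Rightarrow> complex"
  assumes subspace_S: "subspace S"
    and q_add: "\<lbrakk>x \<in> S; y \<in> S; z \<in> S\<rbrakk> \<Longrightarrow> q (x + y) z = q x z + q y z"
    and q_scale: "\<lbrakk>x \<in> S; y \<in> S\<rbrakk> \<Longrightarrow> q (scale c x) y = c * q x y"
    and q_commute: "\<lbrakk>x \<in> S; y \<in> S\<rbrakk> \<Longrightarrow> q y x = cnj (q x y)"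
    and q_nonneg: "x \<in> S \<Longrightarrow> 0 \<le> Re (q x x)"
begin

abbreviation nrm :: "'a \<Rightarrow> real" where "nrm \<equiv> qnorm q"

lemmas S_zero = subspace_0[OF subspace_S]
  and S_add = subspace_add[OF subspace_S]
  and S_scale = subspace_scale[OF subspace_S]
  and S_diff = subspace_diff[OF subspace_S]
  and S_sum = subspace_sum[OF subspace_S]

lemma q_zero_left: "y \<in> S \<Longrightarrow> q 0 y = 0"
  using q_add[of 0 0 y] S_zero by simp

lemma q_zero_right: "y \<in> S \<Longrightarrow> q y 0 = 0"
  using q_commute[of 0 y] q_zero_left[of y] S_zero by simp

lemma q_add_right: "\<lbrakk>x \<in> S; y \<in> S; z \<in> S\<rbrakk> \<Longrightarrow> q z (x + y) = q z x + q z y"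
  using q_commute[of "x + y" z] q_commute[of x z] q_commute[of y z] q_add[of x y z] S_add[of x y]
  by simp

lemma q_scale_right: "\<lbrakk>x \<in> S; y \<in> S\<rbrakk> \<Longrightarrow> q x (scale c y) = cnj c * q x y"
  using q_commute[of "scale c y" x] q_commute[of y x] q_scale[of y x c] S_scale[of y c] by simp

lemma q_diff: "\<lbrakk>x \<in> S; y \<in> S; z \<in> S\<rbrakk> \<Longrightarrow> q (x - y) z = q x z - q y z"
  using q_add[of "x - y" y z] S_diff[of x y] by simp

lemma q_diff_right: "\<lbrakk>x \<in> S; y \<in> S; z \<in> S\<rbrakk> \<Longrightarrow> q z (x - y) = q z x - q z y"
  using q_add_right[of "x - y" y z] S_diff[of x y] by simp

lemma q_sum: "\<lbrakk>\<And>i. i \<in> A \<Longrightarrow> f i \<in> S; z \<in> S\<rbrakk> \<Longrightarrow> q (\<Sum>i\<in>A. f i) z = (\<Sum>i\<in>A. q (f i) z)"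
  by (induction A rule: infinite_finite_induct) (auto simp: q_zero_left q_add S_sum)

lemma q_self_real: "x \<in> S \<Longrightarrow> q x x = of_real (Re (q x x))"
  using q_commute[of x x] by (simp add: complex_eq_iff)

lemma nrm_nonneg: "x \<in> S \<Longrightarrow> 0 \<le> nrm x"
  by (simp add: qnorm_def q_nonneg)

lemma nrm_sq: "x \<in> S \<Longrightarrow> (nrm x)\<^sup>2 = Re (q x x)"
  by (simp add: qnorm_def q_nonneg)

lemma nrm_zero: "nrm 0 = 0"
  by (simp add: qnorm_def q_zero_left S_zero)

lemma q_self: "x \<in> S \<Longrightarrow> q x x = of_real ((nrm x)\<^sup>2)"
  using q_self_real nrm_sq by metis

lemma nrm_sq_add:
  assumes "x \<in> S" "y \<in> S"
  shows "(nrm (x + y))\<^sup>2 = (nrm x)\<^sup>2 + (nrm y)\<^sup>2 + 2 * Re (q x y)"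
  using assms q_commute[of x y] by (simp add: nrm_sq S_add q_add q_add_right)

lemma nrm_scale: "x \<in> S \<Longrightarrow> nrm (scale c x) = cmod c * nrm x"
proof -
  assume x: "x \<in> S"
  have "q (scale c x) (scale c x) = of_real ((cmod c)\<^sup>2) * q x x"
    using x by (simp add: q_scale q_scale_right S_scale complex_norm_square del: of_real_power)
  then have "(nrm (scale c x))\<^sup>2 = (cmod c * nrm x)\<^sup>2"
    using x by (simp add: nrm_sq S_scale power_mult_distrib)
  then show ?thesis using x by (simp add: nrm_nonneg S_scale)
qed

lemma nrm_minus: "x \<in> S \<Longrightarrow> nrm (- x) = nrm x"
  using nrm_scale[of x "-1"] by simp

lemma nrm_commute: "\<lbrakk>x \<in> S; y \<in> S\<rbrakk> \<Longrightarrow> nrm (x - y) = nrm (y - x)"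
  using nrm_minus[of "x - y"] S_diff by simp

lemma nrm_sq_diff:
  assumes "x \<in> S" "y \<in> S"
  shows "(nrm (x - y))\<^sup>2 = (nrm x)\<^sup>2 + (nrm y)\<^sup>2 - 2 * Re (q x y)"
  using assms q_commute[of x y] by (simp add: nrm_sq S_diff q_diff q_diff_right)

lemma parallelogram:
  assumes "x \<in> S" "y \<in> S"
  shows "(nrm (x - y))\<^sup>2 + (nrm (x + y))\<^sup>2 = 2 * (nrm x)\<^sup>2 + 2 * (nrm y)\<^sup>2"
  using assms by (simp add: nrm_sq_add nrm_sq_diff)

lemma cauchy_schwarz:
  assumes x: "x \<in> S" and y: "y \<in> S"
  shows "cmod (q x y) \<le> nrm x * nrm y"
proof -
  define z where "z = q x y"
  have key: "0 \<le> (nrm x)\<^sup>2 + t\<^sup>2 * (cmod z)\<^sup>2 * (nrm y)\<^sup>2 - 2 * t * (cmod z)\<^sup>2" for t :: real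
  proof -
    have "0 \<le> (nrm (x - scale (of_real t * z) y))\<^sup>2" by simp
    also have "\<dots> = (nrm x)\<^sup>2 + (cmod (of_real t * z) * nrm y)\<^sup>2 - 2 * Re (cnj (of_real t * z) * z)"
      using x y by (simp add: nrm_sq_diff S_scale nrm_scale q_scale_right z_def)
    also have "Re (cnj (of_real t * z) * z) = t * (cmod z)\<^sup>2"
      unfolding cmod_power2 by (simp add: power2_eq_square algebra_simps)
    finally show ?thesis by (simp add: norm_mult power_mult_distrib)
  qed
  show ?thesis
  proof (cases "nrm y = 0")
    case True
    have "cmod z = 0"
    proof (rule ccontr)
      assume "cmod z \<noteq> 0"
      then have p: "(cmod z)\<^sup>2 > 0" by simp
      \<comment> \<open>When \<open>nrm y\<close> vanishes, the right side of \<open>key\<close> is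
        affine in \<open>t\<close>; this value makes it equal to -1.\<close>
      define t where "t = ((nrm x)\<^sup>2 + 1) / (2 * (cmod z)\<^sup>2)"
      have "2 * t * (cmod z)\<^sup>2 = (nrm x)\<^sup>2 + 1" using p by (simp add: t_def)
      then show False using key[of t] True by simp
    qed
    then show ?thesis using True by (simp add: z_def)
  next
    case False
    then have p: "(nrm y)\<^sup>2 > 0" by simp
    have "0 \<le> (nrm x)\<^sup>2 - (cmod z)\<^sup>2 / (nrm y)\<^sup>2"
    proof -
      have "(1 / Y)\<^sup>2 * Z * Y - 2 * (1 / Y) * Z = - (Z / Y)" if "Y \<noteq> 0" for Y Z :: real
        using that by (simp add: power2_eq_square)
      from this[of "(nrm y)\<^sup>2" "(cmod z)\<^sup>2"] p show ?thesis
        using key[of "1 / (nrm y)\<^sup>2"] by linarith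
    qed
    then have "(cmod z)\<^sup>2 \<le> (nrm x * nrm y)\<^sup>2"
      using p by (simp add: field_simps power_mult_distrib)
    then show ?thesis unfolding z_def
      using x y nrm_nonneg by (meson mult_nonneg_nonneg power2_le_imp_le)
  qed
qed

lemma nrm_triangle:
  assumes "x \<in> S" "y \<in> S"
  shows "nrm (x + y) \<le> nrm x + nrm y"
proof -
  have "Re (q x y) \<le> nrm x * nrm y"
    using cauchy_schwarz[OF assms] complex_Re_le_cmod order_trans by blast
  then have "(nrm (x + y))\<^sup>2 \<le> (nrm x + nrm y)\<^sup>2"
    using assms by (simp add: nrm_sq_add power2_sum)
  then show ?thesis using assms nrm_nonneg by (meson add_nonneg_nonneg power2_le_imp_le)
qed

lemma nrm_triangle3:
  assumes "x \<in> S" "y \<in> S" "z \<in> S"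
  shows "nrm (x - z) \<le> nrm (x - y) + nrm (y - z)"
  using nrm_triangle[of "x - y" "y - z"] assms S_diff by simp

lemma nrm_diff_abs:
  assumes "x \<in> S" "y \<in> S"
  shows "\<bar>nrm x - nrm y\<bar> \<le> nrm (x - y)"
  using nrm_triangle[of "x - y" y] nrm_triangle[of "y - x" x] nrm_commute[of x y] assms S_diff
  by auto

section \<open>Cauchy sequences for a seminorm\<close>

definition cauchy :: "(nat \<Rightarrow> 'a) \<Rightarrow> bool" where
  "cauchy x \<longleftrightarrow> range x \<subseteq> S \<and> (\<forall>e>0. \<exists>M. \<forall>m\<ge>M. \<forall>n\<ge>M. nrm (x m - x n) < e)"

lemma cauchy_mem: "cauchy x \<Longrightarrow> x n \<in> S"
  by (auto simp: cauchy_def)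

lemma cauchyD: "\<lbrakk>cauchy x; e > 0\<rbrakk> \<Longrightarrow> \<exists>M. \<forall>m\<ge>M. \<forall>n\<ge>M. nrm (x m - x n) < e"
  by (auto simp: cauchy_def)

lemma cauchy_const: "x \<in> S \<Longrightarrow> cauchy (\<lambda>_. x)"
  by (auto simp: cauchy_def nrm_zero)

lemma cauchy_bounded_map:
  assumes x: "cauchy x" and A: "\<And>v. v \<in> S \<Longrightarrow> A v \<in> S"
    and Ad: "\<And>u v. \<lbrakk>u \<in> S; v \<in> S\<rbrakk> \<Longrightarrow> A (u - v) = A u - A v"
    and Ab: "\<And>v. v \<in> S \<Longrightarrow> nrm (A v) \<le> C * nrm v"
  shows "cauchy (\<lambda>n. A (x n))"
  unfolding cauchy_def
proof (intro conjI allI impI)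
  show "range (\<lambda>n. A (x n)) \<subseteq> S" using cauchy_mem[OF x] A by auto
next
  fix e :: real assume e: "e > 0"
  \<comment> \<open>\<open>C\<close> may be zero or negative, so it is replaced by a strictly
    positive bound before dividing.\<close>
  define D where "D = \<bar>C\<bar> + 1"
  have D: "D > 0" "C \<le> D" by (auto simp: D_def)
  obtain M where M: "\<forall>m\<ge>M. \<forall>n\<ge>M. nrm (x m - x n) < e / D"
    using cauchyD[OF x, of "e / D"] e D by auto
  have "nrm (A (x m) - A (x n)) < e" if "m \<ge> M" "n \<ge> M" for m n
  proof -
    have mem: "x m \<in> S" "x n \<in> S" "x m - x n \<in> S" using cauchy_mem[OF x] S_diff by auto
    have "nrm (A (x m) - A (x n)) \<le> C * nrm (x m - x n)"
      using Ab[OF mem(3)] Ad[OF mem(1,2)] by simp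
    also have "\<dots> \<le> D * nrm (x m - x n)"
      using D nrm_nonneg[OF mem(3)] by (simp add: mult_right_mono)
    also have "\<dots> < e" using M that D by (simp add: field_simps)
    finally show ?thesis .
  qed
  then show "\<exists>M. \<forall>m\<ge>M. \<forall>n\<ge>M. nrm (A (x m) - A (x n)) < e" by blast
qed

lemma cauchy_add:
  assumes x: "cauchy x" and y: "cauchy y"
  shows "cauchy (\<lambda>n. x n + y n)"
  unfolding cauchy_def
proof (intro conjI allI impI)
  show "range (\<lambda>n. x n + y n) \<subseteq> S" using cauchy_mem[OF x] cauchy_mem[OF y] S_add by auto
next
  fix e :: real assume e: "e > 0"
  obtain M where M: "\<forall>m\<ge>M. \<forall>n\<ge>M. nrm (x m - x n) < e / 2"
    using cauchyD[OF x, of "e / 2"] e by auto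
  obtain M' where M': "\<forall>m\<ge>M'. \<forall>n\<ge>M'. nrm (y m - y n) < e / 2"
    using cauchyD[OF y, of "e / 2"] e by auto
  have "nrm ((x m + y m) - (x n + y n)) < e" if "m \<ge> max M M'" "n \<ge> max M M'" for m n
  proof -
    have "(x m + y m) - (x n + y n) = (x m - x n) + (y m - y n)" by simp
    then have "nrm ((x m + y m) - (x n + y n)) \<le> nrm (x m - x n) + nrm (y m - y n)"
      using nrm_triangle[of "x m - x n" "y m - y n"] cauchy_mem[OF x] cauchy_mem[OF y] S_diff by metis
    moreover have "nrm (x m - x n) < e / 2" "nrm (y m - y n) < e / 2" using M M' that by auto
    ultimately show ?thesis by linarith
  qed
  then show "\<exists>M. \<forall>m\<ge>M. \<forall>n\<ge>M. nrm ((x m + y m) - (x n + y n)) < e" by blast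
qed

lemma cauchy_scale: "cauchy x \<Longrightarrow> cauchy (\<lambda>n. scale c (x n))"
  by (rule cauchy_bounded_map[of x "scale c" "cmod c"])
    (auto simp: S_scale scale_right_diff_distrib nrm_scale)

lemma cauchy_bounded:
  assumes x: "cauchy x"
  shows "\<exists>B. \<forall>n. nrm (x n) \<le> B"
proof -
  have "Cauchy (\<lambda>n. nrm (x n))"
  proof (rule metric_CauchyI)
    fix e :: real assume "e > 0"
    then obtain M where M: "\<forall>m\<ge>M. \<forall>n\<ge>M. nrm (x m - x n) < e" using cauchyD[OF x] by blast
    have "dist (nrm (x m)) (nrm (x n)) < e" if "m \<ge> M" "n \<ge> M" for m n
      using nrm_diff_abs[OF cauchy_mem[OF x] cauchy_mem[OF x], of m n] M that
      by (smt (verit) dist_real_def)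
    then show "\<exists>M. \<forall>m\<ge>M. \<forall>n\<ge>M. dist (nrm (x m)) (nrm (x n)) < e" by blast
  qed
  then have "Bseq (\<lambda>n. nrm (x n))" by (rule Cauchy_Bseq)
  then show ?thesis by (auto simp: Bseq_def abs_le_iff)
qed

lemma q_convergent:
  assumes x: "cauchy x" and y: "cauchy y"
  shows "convergent (\<lambda>n. q (x n) (y n))"
proof -
  obtain B where B: "\<And>n. nrm (x n) \<le> B" using cauchy_bounded[OF x] by blast
  obtain D where D: "\<And>n. nrm (y n) \<le> D" using cauchy_bounded[OF y] by blast
  have B0: "B \<ge> 0" using B[of 0] nrm_nonneg[OF cauchy_mem[OF x, of 0]] by linarith
  have D0: "D \<ge> 0" using D[of 0] nrm_nonneg[OF cauchy_mem[OF y, of 0]] by linarith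
  have "Cauchy (\<lambda>n. q (x n) (y n))"
  proof (rule metric_CauchyI)
    fix e :: real assume e: "e > 0"
    define d where "d = e / (B + D + 1)"
    have d: "d > 0" using e B0 D0 by (simp add: d_def)
    obtain M where M: "\<forall>m\<ge>M. \<forall>n\<ge>M. nrm (x m - x n) < d" using cauchyD[OF x d] by blast
    obtain M' where M': "\<forall>m\<ge>M'. \<forall>n\<ge>M'. nrm (y m - y n) < d" using cauchyD[OF y d] by blast
    have "dist (q (x m) (y m)) (q (x n) (y n)) < e" if "m \<ge> max M M'" "n \<ge> max M M'" for m n
    proof -
      have xs: "x m \<in> S" "x n \<in> S" "y m \<in> S" "y n \<in> S" "x m - x n \<in> S" "y m - y n \<in> S"
        using cauchy_mem[OF x] cauchy_mem[OF y] S_diff by auto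
      have "q (x m) (y m) - q (x n) (y n) = q (x m - x n) (y m) + q (x n) (y m - y n)"
        using xs by (simp add: q_diff q_diff_right)
      then have "cmod (q (x m) (y m) - q (x n) (y n))
          \<le> nrm (x m - x n) * nrm (y m) + nrm (x n) * nrm (y m - y n)"
        using cauchy_schwarz[OF xs(5,3)] cauchy_schwarz[OF xs(2,6)] norm_triangle_ineq order_trans
        by (smt (verit, best))
      also have "\<dots> \<le> d * D + B * d"
        using M M' that B D B0 D0 d xs nrm_nonneg
        by (intro add_mono mult_mono) (auto simp: less_imp_le)
      also have "\<dots> < d * (B + D + 1)" using d by (simp add: algebra_simps)
      also have "\<dots> = e" using B0 D0 by (simp add: d_def)
      finally show ?thesis by (simp add: dist_norm)
    qed
    then show "\<exists>M. \<forall>m\<ge>M. \<forall>n\<ge>M. dist (q (x m) (y m)) (q (x n) (y n)) < e" by blast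
  qed
  then show ?thesis by (simp add: Cauchy_convergent)
qed

lemma q_tendsto_zero:
  assumes z: "\<And>n. z n \<in> S" "(\<lambda>n. nrm (z n)) \<longlonglongrightarrow> 0" and y: "\<And>n. y n \<in> S" "\<And>n. nrm (y n) \<le> B"
  shows "(\<lambda>n. q (z n) (y n)) \<longlonglongrightarrow> 0"
proof (rule tendsto_norm_zero_cancel, rule tendsto_sandwich[of "\<lambda>_. 0" _ _ "\<lambda>n. nrm (z n) * B"])
  show "\<forall>\<^sub>F n in sequentially. cmod (q (z n) (y n)) \<le> nrm (z n) * B"
    using cauchy_schwarz[OF z(1) y(1)] y(2) nrm_nonneg[OF z(1)]
    by (intro always_eventually allI) (meson mult_left_mono order_trans)
  show "(\<lambda>n. nrm (z n) * B) \<longlonglongrightarrow> 0" using tendsto_mult_left_zero[OF z(2)] by simp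
qed auto

lemma q_tendsto:
  assumes x: "\<And>n. x n \<in> S" "x0 \<in> S" "(\<lambda>n. nrm (x n - x0)) \<longlonglongrightarrow> 0" and y: "y \<in> S"
  shows "(\<lambda>n. q (x n) y) \<longlonglongrightarrow> q x0 y"
proof -
  have "(\<lambda>n. q (x n - x0) y) \<longlonglongrightarrow> 0"
    using x y S_diff by (intro q_tendsto_zero[where B="nrm y"]) auto
  then have "(\<lambda>n. q (x n - x0) y + q x0 y) \<longlonglongrightarrow> 0 + q x0 y" by (intro tendsto_add) auto
  then show ?thesis using x y by (simp add: q_diff)
qed

text \<open>A Cauchy sequence that converges weakly to zero converges to zero in norm, as
  \<open>q(z\<^sub>n, z\<^sub>n) = q(z\<^sub>n, z\<^sub>M) + q(z\<^sub>n, z\<^sub>n - z\<^sub>M)\<close>.\<close>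

lemma cauchy_weak_zero:
  assumes z: "cauchy z" and w: "\<And>g. g \<in> S \<Longrightarrow> (\<lambda>n. q (z n) g) \<longlonglongrightarrow> 0"
  shows "(\<lambda>n. nrm (z n)) \<longlonglongrightarrow> 0"
proof -
  obtain B where B: "\<And>n. nrm (z n) \<le> B" using cauchy_bounded[OF z] by blast
  have B0: "B \<ge> 0" using B[of 0] nrm_nonneg[OF cauchy_mem[OF z, of 0]] by linarith
  have "(\<lambda>n. (nrm (z n))\<^sup>2) \<longlonglongrightarrow> 0"
  proof (rule LIMSEQ_I)
    fix e :: real assume e: "e > 0"
    define d where "d = e / (2 * (B + 1))"
    have d: "d > 0" using e B0 by (simp add: d_def)
    obtain M where M: "\<forall>m\<ge>M. \<forall>n\<ge>M. nrm (z m - z n) < d" using cauchyD[OF z d] by blast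
    obtain M' where M': "\<forall>n\<ge>M'. norm (q (z n) (z M) - 0) < e / 2"
      using LIMSEQ_D[OF w[OF cauchy_mem[OF z, of M]], of "e / 2"] e by auto
    have "norm ((nrm (z n))\<^sup>2 - 0) < e" if "n \<ge> max M M'" for n
    proof -
      have zs: "z n \<in> S" "z M \<in> S" "z n - z M \<in> S" using cauchy_mem[OF z] S_diff by auto
      have "q (z n) (z n) = q (z n) (z M) + q (z n) (z n - z M)" using zs by (simp add: q_diff_right)
      then have "cmod (q (z n) (z n)) \<le> cmod (q (z n) (z M)) + nrm (z n) * nrm (z n - z M)"
        using cauchy_schwarz[OF zs(1,3)] norm_triangle_ineq by (smt (verit, best))
      also have "\<dots> \<le> cmod (q (z n) (z M)) + B * d"
        using M that B[of n] B0 d zs nrm_nonneg by (intro add_left_mono mult_mono) (auto simp: less_imp_le)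
      also have "\<dots> < e / 2 + e / 2"
        using M' that e B0 unfolding d_def
        by (intro add_less_le_mono) (auto simp: field_simps)
      finally show ?thesis using q_self[OF zs(1)] by (simp add: norm_power)
    qed
    then show "\<exists>N. \<forall>n\<ge>N. norm ((nrm (z n))\<^sup>2 - 0) < e" by blast
  qed
  then have "(\<lambda>n. sqrt ((nrm (z n))\<^sup>2)) \<longlonglongrightarrow> sqrt 0" by (rule tendsto_real_sqrt)
  then show ?thesis using nrm_nonneg[OF cauchy_mem[OF z]] by simp
qed

end

section \<open>Hilbert spaces and adjoints\<close>

lemma hdist_metric:
  assumes "semi_inner (hscale H) (hcarrier H) (hinner H)"
    and pos: "\<And>x. \<lbrakk>x \<in> hcarrier H; hnorm H x = 0\<rbrakk> \<Longrightarrow> x = 0"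
  shows "Metric_space (hcarrier H) (hdist H)"
proof -
  interpret semi_inner "hscale H" "hcarrier H" "hinner H" by fact
  have nh: "qnorm (hinner H) = hnorm H" by (simp add: fun_eq_iff qnorm_def hnorm_def)
  show ?thesis
  proof
    fix x y z
    show "0 \<le> hdist H x y" using nrm_nonneg[of "x - y"] S_diff by (simp add: hdist_def nh)
    show "hdist H x y = hdist H y x" using nrm_commute by (simp add: hdist_def nh)
    show "x \<in> hcarrier H \<Longrightarrow> y \<in> hcarrier H \<Longrightarrow> (hdist H x y = 0) = (x = y)"
      using pos[of "x - y"] S_diff nrm_zero by (auto simp: hdist_def nh)
    show "x \<in> hcarrier H \<Longrightarrow> y \<in> hcarrier H \<Longrightarrow> z \<in> hcarrier H \<Longrightarrow>
        hdist H x z \<le> hdist H x y + hdist H y z"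
      using nrm_triangle3[of x y z] by (simp add: hdist_def nh)
  qed
qed

context hilbert_space
begin

sublocale ip: semi_inner "hscale H" "hcarrier H" "hinner H"
  rewrites "qnorm (hinner H) = hnorm H"
proof -
  show "semi_inner (hscale H) (hcarrier H) (hinner H)"
  proof
    show "0 \<le> Re (hinner H x x)" if "x \<in> hcarrier H" for x
    proof (cases "x = 0")
      case True
      have "hinner H 0 0 = 0"
        using hinner_scale[of 0 0 0] subspace_0[OF subspace_hcarrier] by simp
      then show ?thesis using True by simp
    next
      case False
      then show ?thesis using hinner_pos[OF that] by (simp add: less_complex_def)
    qed
  qed (rule subspace_hcarrier | erule (2) hinner_add | erule (1) hinner_scale | erule (1) hinner_commute)+
  show "qnorm (hinner H) = hnorm H" by (simp add: fun_eq_iff qnorm_def hnorm_def)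
qed

lemma hnorm_eq_0: "x \<in> hcarrier H \<Longrightarrow> hnorm H x = 0 \<longleftrightarrow> x = 0"
  using hinner_pos[of x] ip.nrm_zero by (cases "x = 0") (auto simp: hnorm_def less_complex_def)

lemma hinner_eqI:
  assumes "x \<in> hcarrier H" "y \<in> hcarrier H" "\<And>z. z \<in> hcarrier H \<Longrightarrow> hinner H z x = hinner H z y"
  shows "x = y"
proof -
  have "hinner H (x - y) (x - y) = 0"
    using assms ip.S_diff by (simp add: ip.q_diff_right)
  then show ?thesis using hinner_pos[of "x - y"] assms ip.S_diff by force
qed

lemma hinner_eqI':
  assumes "x \<in> hcarrier H" "y \<in> hcarrier H" "\<And>z. z \<in> hcarrier H \<Longrightarrow> hinner H x z = hinner H y z"
  shows "x = y"
  using assms by (intro hinner_eqI) (metis hinner_commute)+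

sublocale ms: Metric_space "hcarrier H" "hdist H"
  by (rule hdist_metric) (simp_all add: ip.semi_inner_axioms hnorm_eq_0)

lemma cauchy_iff_MCauchy: "ip.cauchy x \<longleftrightarrow> ms.MCauchy x"
proof -
  have "hdist H (x m) (x n) = hnorm H (x m - x n)" if "range x \<subseteq> hcarrier H" for m n
    using that by (auto simp: hdist_def)
  then show ?thesis unfolding ip.cauchy_def ms.MCauchy_def by (intro conj_cong refl) auto
qed

lemma cauchy_limit:
  assumes "ip.cauchy x"
  obtains l where "l \<in> hcarrier H" "(\<lambda>n. hnorm H (x n - l)) \<longlonglongrightarrow> 0"
proof -
  obtain l where l: "limitin ms.mtopology x l sequentially"
    using assms complete unfolding cauchy_iff_MCauchy ms.mcomplete_def by blast
  then have lH: "l \<in> hcarrier H" by (simp add: ms.limit_metric_sequentially)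
  have "(\<lambda>n. hnorm H (x n - l)) \<longlonglongrightarrow> 0"
  proof (rule LIMSEQ_I)
    fix e :: real assume "e > 0"
    then obtain N where "\<forall>n\<ge>N. x n \<in> hcarrier H \<and> hdist H (x n) l < e"
      using l unfolding ms.limit_metric_sequentially by blast
    then show "\<exists>N. \<forall>n\<ge>N. norm (hnorm H (x n - l) - 0) < e"
      using lH ip.nrm_nonneg ip.S_diff by (auto simp: hdist_def intro!: exI[of _ N])
  qed
  then show ?thesis using that lH by blast
qed

lemma hclosed_span_iff:
  assumes "A \<subseteq> hcarrier H"
  shows "x \<in> hclosed_span H A \<longleftrightarrow>
    x \<in> hcarrier H \<and> (\<forall>e>0. \<exists>y \<in> span A. hnorm H (x - y) < e)"
proof -
  have "span A \<subseteq> hcarrier H" using assms span_minimal subspace_hcarrier by blast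
  then show ?thesis
    unfolding hclosed_span_def ms.metric_closure_of by (auto simp: hdist_def subset_iff)
qed

text \<open>If \<open>f\<close> is the inner product with y, then \<open>E x\<close> equals ||x -
  y||^2 - ||y||^2, so y has to be the minimiser of \<open>E\<close>. The parallelogram law makes a
  minimising sequence Cauchy, and its limit represents \<open>f\<close> because near a minimum no
  direction \<open>h\<close> can lower \<open>E\<close> appreciably.\<close>

lemma riesz:
  assumes add: "\<And>x y. \<lbrakk>x \<in> hcarrier H; y \<in> hcarrier H\<rbrakk> \<Longrightarrow> f (x + y) = f x + f y"
    and scale: "\<And>c x. x \<in> hcarrier H \<Longrightarrow> f (hscale H c x) = c * f x"
    and bound: "\<And>x. x \<in> hcarrier H \<Longrightarrow> cmod (f x) \<le> C * hnorm H x"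
  obtains y where "y \<in> hcarrier H" "\<And>x. x \<in> hcarrier H \<Longrightarrow> f x = hinner H x y"
proof -
  define E where "E x = (hnorm H x)\<^sup>2 - 2 * Re (f x)" for x
  define d where "d = Inf (E ` hcarrier H)"
  have low: "E x \<ge> - C\<^sup>2" if "x \<in> hcarrier H" for x
  proof -
    have "Re (f x) \<le> C * hnorm H x"
      using bound[OF that] complex_Re_le_cmod order_trans by blast
    moreover have "0 \<le> (hnorm H x - C)\<^sup>2" by simp
    ultimately show ?thesis unfolding E_def power2_diff by (simp add: algebra_simps)
  qed
  have bdd: "bdd_below (E ` hcarrier H)" using low by (intro bdd_belowI2[of _ "- C\<^sup>2"]) auto
  have dle: "d \<le> E x" if "x \<in> hcarrier H" for x
    unfolding d_def using bdd that by (intro cInf_lower) auto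
  have "\<exists>x \<in> hcarrier H. E x < d + 1 / Suc n" for n
  proof -
    have "E ` hcarrier H \<noteq> {}" using ip.S_zero by auto
    moreover have "Inf (E ` hcarrier H) < d + 1 / Suc n" unfolding d_def[symmetric] by simp
    ultimately obtain e where "e \<in> E ` hcarrier H" "e < d + 1 / Suc n" by (rule cInf_lessD[THEN bexE])
    then show ?thesis by auto
  qed
  then obtain x where x: "\<And>n. x n \<in> hcarrier H" "\<And>n. E (x n) < d + 1 / Suc n" by metis
  \<comment> \<open>The midpoint \<open>w\<close> of \<open>u\<close> and \<open>v\<close> has
    energy at least \<open>d\<close>; the parallelogram law converts this into a bound on the
    distance of \<open>u\<close> and \<open>v\<close>.\<close>
  have sq: "(hnorm H (u - v))\<^sup>2 \<le> 2 * (E u - d) + 2 * (E v - d)"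
    if uv: "u \<in> hcarrier H" "v \<in> hcarrier H" for u v
  proof -
    define w where "w = hscale H (1/2) (u + v)"
    have w: "w \<in> hcarrier H" using uv ip.S_add ip.S_scale by (simp add: w_def)
    have "hnorm H w = hnorm H (u + v) / 2" using ip.nrm_scale[OF ip.S_add[OF uv], of "1/2"]
      by (simp add: w_def)
    then have "hnorm H (u + v) = 2 * hnorm H w" by simp
    then have "4 * (hnorm H w)\<^sup>2 = (hnorm H (u + v))\<^sup>2" by (simp only: power_mult_distrib) simp
    moreover have "2 * f w = f u + f v"
      using uv ip.S_add by (simp add: w_def scale add)
    then have "2 * Re (f w) = Re (f u) + Re (f v)"
      by (metis mult_2 plus_complex.sel(1))
    moreover note dle[OF w] ip.parallelogram[OF uv]
    ultimately show ?thesis unfolding E_def right_diff_distrib by linarith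
  qed
  have "ip.cauchy x"
    unfolding ip.cauchy_def
  proof (intro conjI allI impI)
    show "range x \<subseteq> hcarrier H" using x by auto
    fix e :: real assume e: "e > 0"
    obtain M where M: "4 / e\<^sup>2 < real M" using reals_Archimedean2 by blast
    have "hnorm H (x m - x n) < e" if "m \<ge> M" "n \<ge> M" for m n
    proof -
      have "1 / Suc m \<le> 1 / Suc M" "1 / Suc n \<le> 1 / Suc M"
        using that by (auto simp: frac_le)
      then have "(hnorm H (x m - x n))\<^sup>2 \<le> 4 * (1 / Suc M)"
        using sq[OF x(1) x(1), of m n] x(2)[of m] x(2)[of n] unfolding right_diff_distrib by linarith
      also have "\<dots> < e\<^sup>2" using M e by (simp add: field_simps add_strict_increasing)
      finally show ?thesis using e power_less_imp_less_base by (metis less_imp_le)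
    qed
    then show "\<exists>M. \<forall>m\<ge>M. \<forall>n\<ge>M. hnorm H (x m - x n) < e" by blast
  qed
  then obtain y where y: "y \<in> hcarrier H" "(\<lambda>n. hnorm H (x n - y)) \<longlonglongrightarrow> 0"
    using cauchy_limit by blast
  have close: "(cmod (f h - hinner H h (x n)))\<^sup>2 \<le> 1 / Suc n * ((hnorm H h)\<^sup>2 + 1)"
    if h: "h \<in> hcarrier H" for h n
  proof -
    define u where "u = f h - hinner H h (x n)"
    define N where "N = (hnorm H h)\<^sup>2"
    \<comment> \<open>The best step would be 1/N; adding 1 covers N = 0 and still gives t * N \<le>
      1, which leaves the factor 2 - t * N at least 1.\<close>
    define t where "t = 1 / (N + 1)"
    have N: "N \<ge> 0" by (simp add: N_def)
    have t: "t > 0" "t * N \<le> 1" using N by (auto simp: t_def)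
    define c where "c = of_real t * cnj u"
    have ch: "hscale H c h \<in> hcarrier H" using h ip.S_scale by blast
    have "E (x n + hscale H c h) - E (x n)
        = (cmod c)\<^sup>2 * N + 2 * Re (cnj c * hinner H (x n) h) - 2 * Re (c * f h)"
      using h x(1)[of n] ch
      by (simp add: E_def ip.nrm_sq_add ip.nrm_scale add scale ip.q_scale_right N_def power_mult_distrib)
    also have "Re (cnj c * hinner H (x n) h) = Re (c * hinner H h (x n))"
      using hinner_commute[OF h x(1)[of n]] by simp
    also have "(cmod c)\<^sup>2 * N + 2 * Re (c * hinner H h (x n)) - 2 * Re (c * f h)
        = (cmod c)\<^sup>2 * N - 2 * Re (c * u)"
      by (simp add: u_def algebra_simps)
    also have "Re (c * u) = t * (cmod u)\<^sup>2"
      unfolding cmod_power2 by (simp add: c_def power2_eq_square algebra_simps)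
    also have "(cmod c)\<^sup>2 = t\<^sup>2 * (cmod u)\<^sup>2"
      by (simp add: c_def norm_mult power_mult_distrib)
    finally have "E (x n + hscale H c h) - E (x n) = t * (cmod u)\<^sup>2 * (t * N - 2)"
      by (simp add: algebra_simps power2_eq_square)
    moreover have "E (x n + hscale H c h) - E (x n) > - (1 / Suc n)"
      using dle[OF ip.S_add[OF x(1) ch, of n]] x(2)[of n] by simp
    ultimately have 1: "t * (cmod u)\<^sup>2 * (2 - t * N) < 1 / Suc n" by (simp add: algebra_simps)
    have "t * (cmod u)\<^sup>2 * 1 \<le> t * (cmod u)\<^sup>2 * (2 - t * N)" using t
      by (intro mult_left_mono) auto
    with 1 have "t * (cmod u)\<^sup>2 \<le> 1 / Suc n" by simp
    then show ?thesis using N unfolding u_def[symmetric] N_def[symmetric] t_def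
      by (simp add: divide_simps)
  qed
  have "f h = hinner H h y" if h: "h \<in> hcarrier H" for h
  proof -
    have "(\<lambda>n. (cmod (f h - hinner H h (x n)))\<^sup>2) \<longlonglongrightarrow> 0"
    proof (rule tendsto_sandwich[of "\<lambda>_. 0" _ _ "\<lambda>n. 1 / Suc n * ((hnorm H h)\<^sup>2 + 1)"])
      show "(\<lambda>n. 1 / Suc n * ((hnorm H h)\<^sup>2 + 1)) \<longlonglongrightarrow> 0"
        using tendsto_mult_left_zero[OF LIMSEQ_inverse_real_of_nat] by (simp add: inverse_eq_divide)
    qed (use close[OF h] in auto)
    then have "(\<lambda>n. sqrt ((cmod (f h - hinner H h (x n)))\<^sup>2)) \<longlonglongrightarrow> sqrt 0"
      by (rule tendsto_real_sqrt)
    then have "(\<lambda>n. f h - hinner H h (x n)) \<longlonglongrightarrow> 0"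
      by (simp add: tendsto_norm_zero_iff)
    moreover have "(\<lambda>n. f h - hinner H h (x n)) \<longlonglongrightarrow> f h - hinner H h y"
    proof -
      have "(\<lambda>n. cnj (hinner H (x n) h)) \<longlonglongrightarrow> cnj (hinner H y h)"
        using ip.q_tendsto[OF x(1) y h] by (rule tendsto_cnj)
      moreover have "cnj (hinner H z h) = hinner H h z" if "z \<in> hcarrier H" for z
        using hinner_commute[OF that h] by simp
      ultimately have "(\<lambda>n. hinner H h (x n)) \<longlonglongrightarrow> hinner H h y" using x(1) y(1) by simp
      then show ?thesis by (intro tendsto_diff) auto
    qed
    ultimately show ?thesis using LIMSEQ_unique by fastforce
  qed
  then show ?thesis using that y(1) by blast
qed

section \<open>Adjoints of bounded operators\<close>

lemma linear_map_mem: "\<lbrakk>linear_map H H A; x \<in> hcarrier H\<rbrakk> \<Longrightarrow> A x \<in> hcarrier H"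
  by (auto simp: linear_map_def)

text \<open>\<open>adj\<close> is a choice, so nothing is known about it until a witness is
  exhibited; nondegeneracy of the inner product then determines its values on the carrier.\<close>

lemma adj_eqI:
  assumes "\<And>x. x \<in> hcarrier H \<Longrightarrow> A x \<in> hcarrier H" "\<And>x. x \<in> hcarrier H \<Longrightarrow> B x \<in> hcarrier H"
    and "\<And>x y. \<lbrakk>x \<in> hcarrier H; y \<in> hcarrier H\<rbrakk> \<Longrightarrow> hinner H (A x) y = hinner H x (B y)"
    and y: "y \<in> hcarrier H"
  shows "adj H A y = B y"
proof -
  have "adj H A \<in> hcarrier H \<rightarrow> hcarrier H \<and>
     (\<forall>x\<in>hcarrier H. \<forall>y\<in>hcarrier H. hinner H (A x) y = hinner H x (adj H A y))"
    unfolding adj_def by (rule someI[of _ B]) (use assms in auto)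
  then have "adj H A y \<in> hcarrier H" "\<And>x. x \<in> hcarrier H \<Longrightarrow> hinner H x (adj H A y) = hinner H x (B y)"
    using assms(3) y by auto
  then show ?thesis using assms(2) y by (intro hinner_eqI) auto
qed

text \<open>For fixed \<open>y\<close> the functional x -> <A x, y> is bounded by Cauchy-Schwarz, so
  \<open>riesz\<close> supplies the witness that the choice in \<open>adj\<close> asks for.\<close>

lemma adj_props:
  assumes A: "bounded_operator H A"
  shows adj_mem: "y \<in> hcarrier H \<Longrightarrow> adj H A y \<in> hcarrier H"
    and adj_inner: "\<lbrakk>x \<in> hcarrier H; y \<in> hcarrier H\<rbrakk> \<Longrightarrow> hinner H (A x) y = hinner H x (adj H A y)"
proof -
  obtain C where C: "\<And>x. x \<in> hcarrier H \<Longrightarrow> hnorm H (A x) \<le> C * hnorm H x"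
    and lin: "linear_map H H A" using A by (auto simp: bounded_operator_def)
  have "\<exists>z \<in> hcarrier H. \<forall>x \<in> hcarrier H. hinner H (A x) y = hinner H x z" if y: "y \<in> hcarrier H" for y
  proof -
    have "cmod (hinner H (A x) y) \<le> (C * hnorm H y) * hnorm H x" if "x \<in> hcarrier H" for x
    proof -
      have "cmod (hinner H (A x) y) \<le> hnorm H (A x) * hnorm H y"
        using ip.cauchy_schwarz linear_map_mem[OF lin that] y by blast
      also have "\<dots> \<le> (C * hnorm H x) * hnorm H y"
        using C[OF that] ip.nrm_nonneg[OF y] by (rule mult_right_mono)
      finally show ?thesis by (simp add: mult_ac)
    qed
    then obtain z where "z \<in> hcarrier H" "\<And>x. x \<in> hcarrier H \<Longrightarrow> hinner H (A x) y = hinner H x z"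
      using riesz[of "\<lambda>x. hinner H (A x) y" "C * hnorm H y"] lin y
      by (auto simp: linear_map_def hinner_add hinner_scale Pi_iff)
    then show ?thesis by blast
  qed
  then obtain B where B: "\<And>y. y \<in> hcarrier H \<Longrightarrow> B y \<in> hcarrier H"
    "\<And>x y. \<lbrakk>x \<in> hcarrier H; y \<in> hcarrier H\<rbrakk> \<Longrightarrow> hinner H (A x) y = hinner H x (B y)" by metis
  have "adj H A y = B y" if "y \<in> hcarrier H" for y
    using adj_eqI[of A B y] B that linear_map_mem[OF lin] by blast
  then show "y \<in> hcarrier H \<Longrightarrow> adj H A y \<in> hcarrier H"
    "\<lbrakk>x \<in> hcarrier H; y \<in> hcarrier H\<rbrakk> \<Longrightarrow> hinner H (A x) y = hinner H x (adj H A y)"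
    using B by auto
qed

lemma adj_linear:
  assumes A: "bounded_operator H A"
  shows adj_add: "\<lbrakk>x \<in> hcarrier H; y \<in> hcarrier H\<rbrakk> \<Longrightarrow> adj H A (x + y) = adj H A x + adj H A y"
    and adj_scale: "x \<in> hcarrier H \<Longrightarrow> adj H A (hscale H c x) = hscale H c (adj H A x)"
proof -
  have AH: "A z \<in> hcarrier H" if "z \<in> hcarrier H" for z
    using A that by (auto simp: bounded_operator_def linear_map_def)
  note m = adj_mem[OF A] and i = adj_inner[OF A, symmetric]
  show "adj H A (x + y) = adj H A x + adj H A y" if "x \<in> hcarrier H" "y \<in> hcarrier H"
    using that m AH ip.S_add
    by (intro hinner_eqI) (auto simp: ip.q_add_right i)
  show "adj H A (hscale H c x) = hscale H c (adj H A x)" if "x \<in> hcarrier H"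
    using that m AH ip.S_scale
    by (intro hinner_eqI) (auto simp: ip.q_scale_right i)
qed

end

lemma hilbert_spaceI:
  assumes "semi_inner (hscale H) (hcarrier H) (hinner H)"
    and pos: "\<And>x. \<lbrakk>x \<in> hcarrier H; hnorm H x = 0\<rbrakk> \<Longrightarrow> x = 0"
    and lim: "\<And>x. semi_inner.cauchy (hcarrier H) (hinner H) x \<Longrightarrow>
      \<exists>l \<in> hcarrier H. (\<lambda>n. hnorm H (x n - l)) \<longlonglongrightarrow> 0"
  shows "hilbert_space H"
proof -
  interpret semi_inner "hscale H" "hcarrier H" "hinner H" by fact
  have nh: "qnorm (hinner H) = hnorm H" by (simp add: fun_eq_iff qnorm_def hnorm_def)
  have p: "0 < hinner H x x" if "x \<in> hcarrier H" "x \<noteq> 0" for x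
  proof -
    have "hnorm H x \<noteq> 0" using pos that by blast
    then show ?thesis using q_self[OF that(1)] nh by (simp add: less_complex_def)
  qed
  interpret ms: Metric_space "hcarrier H" "hdist H"
    by (rule hdist_metric[OF assms(1) pos])
  have "ms.mcomplete"
    unfolding ms.mcomplete_def
  proof (intro allI impI)
    fix x assume x: "ms.MCauchy x"
    then have xH: "x n \<in> hcarrier H" for n by (auto simp: ms.MCauchy_def)
    have "hdist H (x m) (x n) = hnorm H (x m - x n)" for m n using xH by (simp add: hdist_def)
    then have "cauchy x" using x unfolding cauchy_def ms.MCauchy_def nh by auto
    then obtain l where l: "l \<in> hcarrier H" "(\<lambda>n. hnorm H (x n - l)) \<longlonglongrightarrow> 0" using lim by blast
    have "\<exists>N. \<forall>n\<ge>N. x n \<in> hcarrier H \<and> hdist H (x n) l < e" if "e > 0" for e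
    proof -
      obtain N where "\<forall>n\<ge>N. norm (hnorm H (x n - l) - 0) < e" using LIMSEQ_D[OF l(2) \<open>e > 0\<close>] by blast
      then have "\<forall>n\<ge>N. x n \<in> hcarrier H \<and> hdist H (x n) l < e"
        using l xH by (auto simp: hdist_def)
      then show ?thesis by blast
    qed
    then show "\<exists>l. limitin ms.mtopology x l sequentially"
      unfolding ms.limit_metric_sequentially using l(1) by blast
  qed
  then show ?thesis
    using p subspace_S q_add q_scale q_commute
    by (intro hilbert_space.intro hilbert_space_axioms.intro vector_space_axioms) blast+
qed

section \<open>Completion of a semi-inner product space inside a function space\<close>

text \<open>The completion is realised without classes of sequences: the limit of a Cauchy sequence \<open>x\<close>
  is recorded as the function \<open>F\<close> with \<open>\<langle>F a, h\<rangle> = lim q(x\<^sub>n, e a h)\<close>, supplied by Riesz. As the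
  vectors \<open>e a h\<close> span, sequences with the same \<open>F\<close> differ by a null sequence.\<close>

locale completion = semi_inner scale S q + hs: hilbert_space H
  for scale :: "complex \<Rightarrow> 'e::ab_group_add \<Rightarrow> 'e" and S q
    and H :: "'h::ab_group_add hspace" +
  fixes e :: "'g \<Rightarrow> 'h \<Rightarrow> 'e"
  assumes e_mem: "h \<in> hcarrier H \<Longrightarrow> e a h \<in> S"
    and e_add: "\<lbrakk>h \<in> hcarrier H; h' \<in> hcarrier H\<rbrakk> \<Longrightarrow> e a (h + h') = e a h + e a h'"
    and e_scale: "h \<in> hcarrier H \<Longrightarrow> e a (hscale H c h) = scale c (e a h)"
    and e_bound: "\<exists>C. \<forall>h \<in> hcarrier H. nrm (e a h) \<le> C * hnorm H h"
    and S_span: "S \<subseteq> span (\<Union>a. e a ` hcarrier H)"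
begin

text \<open>The sequence \<open>x\<close> stands for the vector encoded by \<open>F\<close>. In the
  application \<open>e a h\<close> is V_a h, so \<open>F a\<close> is the compression to H of V_a^*
  applied to the limit of \<open>x\<close>.\<close>

definition approx :: "('g \<Rightarrow> 'h) \<Rightarrow> (nat \<Rightarrow> 'e) \<Rightarrow> bool" where
  "approx F x \<longleftrightarrow> cauchy x \<and> (\<forall>a. F a \<in> hcarrier H \<and>
     (\<forall>h \<in> hcarrier H. (\<lambda>n. q (x n) (e a h)) \<longlonglongrightarrow> hinner H (F a) h))"

lemma approx_cauchy: "approx F x \<Longrightarrow> cauchy x"
  by (simp add: approx_def)

lemma approx_mem: "approx F x \<Longrightarrow> x n \<in> S"
  using approx_cauchy cauchy_mem by blast

lemma approx_fun_mem: "approx F x \<Longrightarrow> F a \<in> hcarrier H"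
  by (simp add: approx_def)

lemma approx_lim: "\<lbrakk>approx F x; h \<in> hcarrier H\<rbrakk> \<Longrightarrow> (\<lambda>n. q (x n) (e a h)) \<longlonglongrightarrow> hinner H (F a) h"
  by (simp add: approx_def)

lemma approx_exists:
  assumes x: "cauchy x"
  shows "\<exists>F. approx F x"
proof -
  have "\<exists>y \<in> hcarrier H. \<forall>h \<in> hcarrier H. (\<lambda>n. q (x n) (e a h)) \<longlonglongrightarrow> hinner H y h" for a
  proof -
    \<comment> \<open>The arguments of \<open>q\<close> are exchanged because \<open>riesz\<close>
      needs a functional that is linear, not conjugate linear, in \<open>h\<close>; a conjugation at
      the end restores the order.\<close>
    define f where "f h = lim (\<lambda>n. q (e a h) (x n))" for h
    have f: "(\<lambda>n. q (e a h) (x n)) \<longlonglongrightarrow> f h" if "h \<in> hcarrier H" for h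
      unfolding f_def using q_convergent[OF cauchy_const[OF e_mem[OF that]] x]
      by (simp add: convergent_LIMSEQ_iff)
    obtain B where B: "\<And>n. nrm (x n) \<le> B" using cauchy_bounded[OF x] by blast
    have B0: "B \<ge> 0" using B[of 0] nrm_nonneg[OF cauchy_mem[OF x, of 0]] by linarith
    obtain C where C: "\<And>h. h \<in> hcarrier H \<Longrightarrow> nrm (e a h) \<le> C * hnorm H h" using e_bound by blast
    obtain y where y: "y \<in> hcarrier H" "\<And>h. h \<in> hcarrier H \<Longrightarrow> f h = hinner H h y"
    proof (rule hs.riesz[of f "C * B"])
      fix h h' assume h: "h \<in> hcarrier H" "h' \<in> hcarrier H"
      have "(\<lambda>n. q (e a (h + h')) (x n)) \<longlonglongrightarrow> f h + f h'"
        using tendsto_add[OF f[OF h(1)] f[OF h(2)]] h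
        by (simp add: e_add q_add e_mem cauchy_mem[OF x])
      then show "f (h + h') = f h + f h'"
        using f[OF hs.ip.S_add[OF h]] LIMSEQ_unique by blast
    next
      fix c h assume h: "h \<in> hcarrier H"
      have "(\<lambda>n. q (e a (hscale H c h)) (x n)) \<longlonglongrightarrow> c * f h"
        using tendsto_mult_left[OF f[OF h], of c] h
        by (simp add: e_scale q_scale e_mem cauchy_mem[OF x])
      then show "f (hscale H c h) = c * f h"
        using f[OF hs.ip.S_scale[OF h]] LIMSEQ_unique by blast
    next
      fix h assume h: "h \<in> hcarrier H"
      have "cmod (q (e a h) (x n)) \<le> C * B * hnorm H h" for n
      proof -
        have "cmod (q (e a h) (x n)) \<le> nrm (e a h) * nrm (x n)"
          using cauchy_schwarz e_mem h cauchy_mem[OF x] by blast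
        also have "\<dots> \<le> nrm (e a h) * B"
          using B nrm_nonneg[OF e_mem[OF h]] by (simp add: mult_left_mono)
        also have "\<dots> \<le> (C * hnorm H h) * B" using C[OF h] B0 by (rule mult_right_mono)
        finally show ?thesis by (simp add: mult_ac)
      qed
      then show "cmod (f h) \<le> C * B * hnorm H h"
        using tendsto_norm[OF f[OF h]] by (intro LIMSEQ_le_const2) auto
    qed blast
    have "(\<lambda>n. q (x n) (e a h)) \<longlonglongrightarrow> hinner H y h" if h: "h \<in> hcarrier H" for h
    proof -
      have "(\<lambda>n. cnj (q (e a h) (x n))) \<longlonglongrightarrow> cnj (hinner H h y)"
        using f[OF h] y(2)[OF h] by (auto intro: tendsto_cnj)
      then show ?thesis
        using q_commute[OF e_mem[OF h] cauchy_mem[OF x]] hs.hinner_commute[OF h y(1)] by simp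
    qed
    then show ?thesis using y(1) by blast
  qed
  then show ?thesis unfolding approx_def using x by metis
qed

lemma approx_unique:
  assumes "approx F x" "approx G x"
  shows "F = G"
proof
  fix a
  show "F a = G a"
    using LIMSEQ_unique[OF approx_lim[OF assms(1)] approx_lim[OF assms(2)]]
    by (intro hs.hinner_eqI') (auto simp: approx_fun_mem[OF assms(1)] approx_fun_mem[OF assms(2)])
qed

lemma weak_zero:
  assumes z: "\<And>n. z n \<in> S" "\<And>a h. h \<in> hcarrier H \<Longrightarrow> (\<lambda>n. q (z n) (e a h)) \<longlonglongrightarrow> 0" and g: "g \<in> S"
  shows "(\<lambda>n. q (z n) g) \<longlonglongrightarrow> 0"
proof -
  have "g \<in> span (\<Union>a. e a ` hcarrier H)" using g S_span by blast
  then have "g \<in> S \<and> (\<lambda>n. q (z n) g) \<longlonglongrightarrow> 0"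
  proof (induction rule: span_induct_alt)
    case base
    show ?case using S_zero z by (simp add: q_zero_right)
  next
    case (step c v y)
    then obtain a h where v: "v = e a h" "h \<in> hcarrier H" by blast
    then have vS: "v \<in> S" using e_mem by blast
    have "(\<lambda>n. cnj c * q (z n) v + q (z n) y) \<longlonglongrightarrow> cnj c * 0 + 0"
      using step.IH z(2) v by (intro tendsto_intros) auto
    then show ?case using step.IH vS z(1) S_add S_scale by (simp add: q_add_right q_scale_right)
  qed
  then show ?thesis by blast
qed

lemma cauchy_diff: "\<lbrakk>cauchy x; cauchy y\<rbrakk> \<Longrightarrow> cauchy (\<lambda>n. x n - y n)"
  using cauchy_add[of x "\<lambda>n. scale (-1) (y n)"] cauchy_scale[of y "-1"] by simp

text \<open>The difference tends to zero against every \<open>e a h\<close>, hence against every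
  vector of their span. It is also Cauchy, and for such sequences weak convergence to zero is norm
  convergence.\<close>

lemma approx_same:
  assumes x: "approx F x" and y: "approx F y"
  shows "(\<lambda>n. nrm (x n - y n)) \<longlonglongrightarrow> 0"
proof (rule cauchy_weak_zero)
  show "cauchy (\<lambda>n. x n - y n)" using x y approx_cauchy cauchy_diff by blast
  show "(\<lambda>n. q (x n - y n) g) \<longlonglongrightarrow> 0" if "g \<in> S" for g
  proof (rule weak_zero[OF _ _ that])
    show "x n - y n \<in> S" for n using x y approx_mem S_diff by blast
    show "(\<lambda>n. q (x n - y n) (e a h)) \<longlonglongrightarrow> 0" if h: "h \<in> hcarrier H" for a h
      using tendsto_diff[OF approx_lim[OF x h, of a] approx_lim[OF y h, of a]]
      by (simp add: q_diff e_mem[OF h] approx_mem[OF x] approx_mem[OF y])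
  qed
qed

lemma approx_perturb:
  assumes x: "approx F x" and y: "cauchy y" and xy: "(\<lambda>n. nrm (x n - y n)) \<longlonglongrightarrow> 0"
  shows "approx F y"
  unfolding approx_def
proof (intro conjI allI ballI)
  fix a h assume h: "h \<in> hcarrier H"
  have "(\<lambda>n. q (x n - y n) (e a h)) \<longlonglongrightarrow> 0"
    using approx_mem[OF x] cauchy_mem[OF y] S_diff xy e_mem[OF h]
    by (intro q_tendsto_zero[where B="nrm (e a h)"]) auto
  from tendsto_diff[OF approx_lim[OF x h, of a] this]
  show "(\<lambda>n. q (y n) (e a h)) \<longlonglongrightarrow> hinner H (F a) h"
    by (simp add: q_diff e_mem[OF h] approx_mem[OF x] cauchy_mem[OF y])
qed (use y approx_fun_mem[OF x] in auto)

section \<open>The completed space and its inner product\<close>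

definition rep :: "('g \<Rightarrow> 'h) \<Rightarrow> nat \<Rightarrow> 'e" where
  "rep F = (SOME x. approx F x)"

definition K :: "('g \<Rightarrow> 'h) hspace" where
  "K = \<lparr>hcarrier = {F. \<exists>x. approx F x}, hscale = (\<lambda>c F a. hscale H c (F a)),
        hinner = (\<lambda>F G. lim (\<lambda>n. q (rep F n) (rep G n)))\<rparr>"

lemma K_mem_iff: "F \<in> hcarrier K \<longleftrightarrow> (\<exists>x. approx F x)"
  by (simp add: K_def)

lemma K_memI: "approx F x \<Longrightarrow> F \<in> hcarrier K"
  by (auto simp: K_mem_iff)

lemma rep_approx: "F \<in> hcarrier K \<Longrightarrow> approx F (rep F)"
  unfolding rep_def K_mem_iff by (rule someI_ex[of "approx F"])

text \<open>The inner product of \<open>K\<close> is defined through chosen representatives. Other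
  representatives differ from them by null sequences and all sequences are bounded, so any
  approximating sequences compute it.\<close>

lemma K_inner_lim:
  assumes x: "approx F x" and y: "approx G y"
  shows "(\<lambda>n. q (x n) (y n)) \<longlonglongrightarrow> hinner K F G"
proof -
  have F: "approx F (rep F)" and G: "approx G (rep G)"
    using x y K_memI rep_approx by blast+
  note mem = approx_mem[OF x] approx_mem[OF y] approx_mem[OF F] approx_mem[OF G]
  obtain B where B: "\<And>n. nrm (y n) \<le> B" using cauchy_bounded[OF approx_cauchy[OF y]] by blast
  obtain D where D: "\<And>n. nrm (rep F n) \<le> D" using cauchy_bounded[OF approx_cauchy[OF F]] by blast
  have "(\<lambda>n. q (x n - rep F n) (y n)) \<longlonglongrightarrow> 0"
    using mem S_diff approx_same[OF x F] B by (intro q_tendsto_zero) auto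
  moreover have "(\<lambda>n. q (y n - rep G n) (rep F n)) \<longlonglongrightarrow> 0"
    using mem S_diff approx_same[OF y G] D by (intro q_tendsto_zero) auto
  then have "(\<lambda>n. cnj (q (y n - rep G n) (rep F n))) \<longlonglongrightarrow> 0"
    using tendsto_cnj by fastforce
  then have "(\<lambda>n. q (rep F n) (y n - rep G n)) \<longlonglongrightarrow> 0"
    using q_commute[OF S_diff[OF mem(2,4)] mem(3)] by simp
  moreover have "(\<lambda>n. q (rep F n) (rep G n)) \<longlonglongrightarrow> hinner K F G"
    using q_convergent[OF approx_cauchy[OF F] approx_cauchy[OF G]]
    by (simp add: K_def convergent_LIMSEQ_iff)
  ultimately have "(\<lambda>n. q (x n - rep F n) (y n) + q (rep F n) (y n - rep G n)
      + q (rep F n) (rep G n)) \<longlonglongrightarrow> 0 + 0 + hinner K F G"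
    by (intro tendsto_add)
  then show ?thesis using mem by (simp add: q_diff q_diff_right)
qed

lemma approx_add:
  assumes x: "approx F x" and y: "approx G y"
  shows "approx (F + G) (\<lambda>n. x n + y n)"
  unfolding approx_def
proof (intro conjI allI ballI)
  fix a h assume h: "h \<in> hcarrier H"
  from tendsto_add[OF approx_lim[OF x h, of a] approx_lim[OF y h, of a]]
  show "(\<lambda>n. q (x n + y n) (e a h)) \<longlonglongrightarrow> hinner H ((F + G) a) h"
    by (simp add: q_add e_mem[OF h] approx_mem[OF x] approx_mem[OF y] hs.hinner_add h
      approx_fun_mem[OF x] approx_fun_mem[OF y])
qed (use approx_cauchy[OF x] approx_cauchy[OF y] cauchy_add approx_fun_mem[OF x]
      approx_fun_mem[OF y] hs.ip.S_add in auto)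

lemma approx_scale:
  assumes x: "approx F x"
  shows "approx (hscale K c F) (\<lambda>n. scale c (x n))"
  unfolding approx_def
proof (intro conjI allI ballI)
  fix a h assume h: "h \<in> hcarrier H"
  from tendsto_mult_left[OF approx_lim[OF x h, of a], of c]
  show "(\<lambda>n. q (scale c (x n)) (e a h)) \<longlonglongrightarrow> hinner H (hscale K c F a) h"
    by (simp add: K_def q_scale e_mem[OF h] approx_mem[OF x] hs.hinner_scale h approx_fun_mem[OF x])
qed (use approx_cauchy[OF x] cauchy_scale approx_fun_mem[OF x] hs.ip.S_scale in \<open>auto simp: K_def\<close>)

lemma approx_diff:
  assumes x: "approx F x" and y: "approx G y"
  shows "approx (F - G) (\<lambda>n. x n - y n)"
proof -
  have "F + hscale K (-1) G = F - G" by (auto simp: K_def fun_eq_iff)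
  then show ?thesis using approx_add[OF x approx_scale[OF y, of "-1"]] by simp
qed

lemma K_norm_lim:
  assumes x: "approx F x"
  shows "(\<lambda>n. nrm (x n)) \<longlonglongrightarrow> hnorm K F"
  unfolding qnorm_def hnorm_def
  by (intro tendsto_real_sqrt tendsto_Re K_inner_lim x)

lemma K_semi_inner: "semi_inner (hscale K) (hcarrier K) (hinner K)"
proof -
  interpret vk: vector_space "hscale K"
    by unfold_locales (auto simp: K_def fun_eq_iff hs.scale_right_distrib hs.scale_left_distrib)
  show ?thesis
  proof
    show "vk.subspace (hcarrier K)"
    proof (rule vk.subspaceI)
      show "0 \<in> hcarrier K"
      proof (rule K_memI)
        show "approx 0 (\<lambda>_. 0)" unfolding approx_def
          using cauchy_const[OF S_zero] hs.ip.S_zero hs.ip.q_zero_left q_zero_left e_mem by simp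
      qed
    qed (auto intro: approx_add approx_scale simp: K_mem_iff)
    fix F G assume "F \<in> hcarrier K" "G \<in> hcarrier K"
    then have F: "approx F (rep F)" and G: "approx G (rep G)" by (auto intro: rep_approx)
    show "hinner K (hscale K c F) G = c * hinner K F G" for c
      using tendsto_mult_left[OF K_inner_lim[OF F G], of c] K_inner_lim[OF approx_scale[OF F, of c] G]
      by (intro LIMSEQ_unique) (auto simp: q_scale approx_mem[OF F] approx_mem[OF G])
    show "hinner K G F = cnj (hinner K F G)"
      using tendsto_cnj[OF K_inner_lim[OF F G]] K_inner_lim[OF G F]
        q_commute[OF approx_mem[OF F] approx_mem[OF G]]
      by (intro LIMSEQ_unique[of "\<lambda>n. q (rep G n) (rep F n)"]) simp_all
    show "hinner K (F + G) M = hinner K F M + hinner K G M" if "M \<in> hcarrier K" for M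
    proof -
      have M: "approx M (rep M)" using that rep_approx by blast
      show ?thesis
        using tendsto_add[OF K_inner_lim[OF F M] K_inner_lim[OF G M]] K_inner_lim[OF approx_add[OF F G] M]
        by (intro LIMSEQ_unique) (auto simp: q_add approx_mem[OF F] approx_mem[OF G] approx_mem[OF M])
    qed
    show "0 \<le> Re (hinner K F F)"
      by (rule LIMSEQ_le_const[OF tendsto_Re[OF K_inner_lim[OF F F]]])
        (use q_nonneg approx_mem[OF F] in auto)
  qed
qed

definition emb :: "'e \<Rightarrow> 'g \<Rightarrow> 'h" where
  "emb f = (SOME F. approx F (\<lambda>_. f))"

lemma emb_approx: "f \<in> S \<Longrightarrow> approx (emb f) (\<lambda>_. f)"
  unfolding emb_def using approx_exists[OF cauchy_const] by (rule someI_ex)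

lemma emb_mem: "f \<in> S \<Longrightarrow> emb f \<in> hcarrier K"
  using emb_approx K_memI by blast

lemma emb_add: "\<lbrakk>f \<in> S; g \<in> S\<rbrakk> \<Longrightarrow> emb (f + g) = emb f + emb g"
  using approx_unique[OF emb_approx approx_add[OF emb_approx emb_approx]] S_add by blast

lemma emb_scale: "f \<in> S \<Longrightarrow> emb (scale c f) = hscale K c (emb f)"
  using approx_unique[OF emb_approx approx_scale[OF emb_approx]] S_scale by blast

lemma emb_zero: "emb 0 = 0"
  using emb_scale[OF S_zero, of 0] by (simp add: K_def fun_eq_iff)

lemma emb_inner: "\<lbrakk>f \<in> S; g \<in> S\<rbrakk> \<Longrightarrow> hinner K (emb f) (emb g) = q f g"
  using LIMSEQ_unique[OF K_inner_lim[OF emb_approx emb_approx]] by fastforce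

lemma emb_dense:
  assumes F: "F \<in> hcarrier K" and eps: "\<epsilon> > 0"
  shows "\<exists>f \<in> S. hnorm K (F - emb f) < \<epsilon>"
proof -
  have x: "approx F (rep F)" using F rep_approx by blast
  obtain M where M: "\<forall>m\<ge>M. \<forall>n\<ge>M. nrm (rep F m - rep F n) < \<epsilon> / 2"
    using cauchyD[OF approx_cauchy[OF x], of "\<epsilon> / 2"] eps by auto
  have "(\<lambda>n. nrm (rep F n - rep F M)) \<longlonglongrightarrow> hnorm K (F - emb (rep F M))"
    using K_norm_lim[OF approx_diff[OF x emb_approx[OF approx_mem[OF x]]]] by blast
  then have "hnorm K (F - emb (rep F M)) \<le> \<epsilon> / 2"
    using M by (intro LIMSEQ_le_const2[of _ _ "\<epsilon> / 2"]) (auto intro!: exI[of _ M] less_imp_le)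
  then show ?thesis using approx_mem[OF x, of M] eps by (intro bexI[of _ "rep F M"]) auto
qed

lemma emb_norm: "f \<in> S \<Longrightarrow> hnorm K (emb f) = nrm f"
  by (simp add: hnorm_def qnorm_def emb_inner)

lemma emb_diff: "\<lbrakk>f \<in> S; g \<in> S\<rbrakk> \<Longrightarrow> emb (f - g) = emb f - emb g"
  using emb_add[of "f - g" g] S_diff by simp

text \<open>A Cauchy sequence of \<open>K\<close> is shadowed by vectors \<open>emb (f n)\<close>
  with error below 1/(n+1). Then \<open>f\<close> is a Cauchy sequence of the original space, and
  the function it represents is the limit.\<close>

lemma K_hilbert: "hilbert_space K"
proof (rule hilbert_spaceI)
  show "semi_inner (hscale K) (hcarrier K) (hinner K)" by (rule K_semi_inner)
  interpret k: semi_inner "hscale K" "hcarrier K" "hinner K" by (rule K_semi_inner)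
  have nk: "qnorm (hinner K) = hnorm K" by (simp add: fun_eq_iff qnorm_def hnorm_def)
  show "F = 0" if F: "F \<in> hcarrier K" and 0: "hnorm K F = 0" for F
  proof -
    have x: "approx F (rep F)" using F rep_approx by blast
    \<comment> \<open>A vector of norm zero is also represented by the constant sequence 0, hence is
      the zero function: this is where the null vectors are divided out.\<close>
    have "(\<lambda>n. nrm (rep F n - 0)) \<longlonglongrightarrow> 0" using K_norm_lim[OF x] 0 by simp
    then have "approx F (\<lambda>_. 0)" using approx_perturb[OF x cauchy_const[OF S_zero]] by blast
    moreover have "approx 0 (\<lambda>_. 0)" using emb_approx[OF S_zero] emb_zero by simp
    ultimately show ?thesis by (rule approx_unique)
  qed
  fix F assume c: "k.cauchy F"
  have FK: "F n \<in> hcarrier K" for n using c by (rule k.cauchy_mem)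
  have "\<exists>f \<in> S. hnorm K (F n - emb f) < inverse (real (Suc n))" for n
    using emb_dense[OF FK, of "inverse (real (Suc n))"] by simp
  then obtain f where f: "\<And>n. f n \<in> S" "\<And>n. hnorm K (F n - emb (f n)) < inverse (real (Suc n))" by metis
  note near = eventually_less_inverse[of "\<lambda>n. hnorm K (F n - emb (f n))", OF f(2)]
  have "cauchy f"
    unfolding cauchy_def
  proof (intro conjI allI impI)
    fix \<epsilon> :: real assume eps: "\<epsilon> > 0"
    obtain M where M: "\<forall>m\<ge>M. \<forall>n\<ge>M. hnorm K (F m - F n) < \<epsilon> / 3"
      using k.cauchyD[OF c, of "\<epsilon> / 3"] eps nk by auto
    obtain M' where M': "\<forall>n\<ge>M'. hnorm K (F n - emb (f n)) < \<epsilon> / 3"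
      using near[of "\<epsilon> / 3"] eps by auto
    have "nrm (f m - f n) < \<epsilon>" if "m \<ge> max M M'" "n \<ge> max M M'" for m n
    proof -
      note mem = FK[of m] FK[of n] emb_mem[OF f(1)[of m]] emb_mem[OF f(1)[of n]]
      have "nrm (f m - f n) = hnorm K (emb (f m) - emb (f n))"
        using emb_norm[OF S_diff[OF f(1) f(1)]] emb_diff[OF f(1) f(1)] by simp
      also have "\<dots> \<le> hnorm K (emb (f m) - F m) + hnorm K (F m - emb (f n))"
        using k.nrm_triangle3[of "emb (f m)" "F m" "emb (f n)"] mem nk by simp
      also have "hnorm K (F m - emb (f n)) \<le> hnorm K (F m - F n) + hnorm K (F n - emb (f n))"
        using k.nrm_triangle3[of "F m" "F n" "emb (f n)"] mem nk by simp
      also have "hnorm K (emb (f m) - F m) = hnorm K (F m - emb (f m))"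
        using k.nrm_commute[OF mem(3,1)] nk by simp
      finally have "nrm (f m - f n) \<le> hnorm K (F m - emb (f m)) +
          (hnorm K (F m - F n) + hnorm K (F n - emb (f n)))" by linarith
      moreover have "hnorm K (F m - emb (f m)) < \<epsilon> / 3" "hnorm K (F n - emb (f n)) < \<epsilon> / 3"
        "hnorm K (F m - F n) < \<epsilon> / 3" using M M' that by auto
      ultimately show ?thesis by linarith
    qed
    then show "\<exists>M. \<forall>m\<ge>M. \<forall>n\<ge>M. nrm (f m - f n) < \<epsilon>" by blast
  qed (use f(1) in auto)
  then obtain L where L: "approx L f" using approx_exists by blast
  have LK: "L \<in> hcarrier K" using L K_memI by blast
  have "(\<lambda>n. hnorm K (F n - L)) \<longlonglongrightarrow> 0"
  proof (rule LIMSEQ_I)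
    fix \<epsilon> :: real assume eps: "\<epsilon> > 0"
    obtain M where M: "\<forall>m\<ge>M. \<forall>n\<ge>M. nrm (f m - f n) < \<epsilon> / 2"
      using cauchyD[OF \<open>cauchy f\<close>, of "\<epsilon> / 2"] eps by auto
    obtain M' where M': "\<forall>n\<ge>M'. hnorm K (F n - emb (f n)) < \<epsilon> / 2"
      using near[of "\<epsilon> / 2"] eps by auto
    have "norm (hnorm K (F n - L) - 0) < \<epsilon>" if n: "n \<ge> max M M'" for n
    proof -
      have "(\<lambda>m. nrm (f n - f m)) \<longlonglongrightarrow> hnorm K (emb (f n) - L)"
        using K_norm_lim[OF approx_diff[OF emb_approx[OF f(1)] L]] by blast
      then have "hnorm K (emb (f n) - L) \<le> \<epsilon> / 2"
        using M n by (intro LIMSEQ_le_const2[of _ _ "\<epsilon> / 2"]) (auto intro!: exI[of _ M] less_imp_le)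
      moreover have "hnorm K (F n - L) \<le> hnorm K (F n - emb (f n)) + hnorm K (emb (f n) - L)"
        using k.nrm_triangle3[OF FK emb_mem[OF f(1)] LK] nk by simp
      moreover have "hnorm K (F n - emb (f n)) < \<epsilon> / 2" using M' n by simp
      moreover have "0 \<le> hnorm K (F n - L)" using k.nrm_nonneg[OF k.S_diff[OF FK LK]] nk by simp
      ultimately show ?thesis by simp
    qed
    then show "\<exists>N. \<forall>n\<ge>N. norm (hnorm K (F n - L) - 0) < \<epsilon>" by blast
  qed
  then show "\<exists>L \<in> hcarrier K. (\<lambda>n. hnorm K (F n - L)) \<longlonglongrightarrow> 0" using LK by blast
qed

section \<open>Extension of bounded maps to the completion\<close>

definition bounded_on :: "('e \<Rightarrow> 'e) \<Rightarrow> bool" where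
  "bounded_on A \<longleftrightarrow> A ` S \<subseteq> S \<and> (\<forall>x\<in>S. \<forall>y\<in>S. A (x + y) = A x + A y) \<and>
     (\<forall>c. \<forall>x\<in>S. A (scale c x) = scale c (A x)) \<and> (\<exists>C. \<forall>x\<in>S. nrm (A x) \<le> C * nrm x)"

definition ext :: "('e \<Rightarrow> 'e) \<Rightarrow> ('g \<Rightarrow> 'h) \<Rightarrow> 'g \<Rightarrow> 'h" where
  "ext A F = (SOME G. approx G (\<lambda>n. A (rep F n)))"

lemma bounded_onD:
  assumes "bounded_on A"
  shows "x \<in> S \<Longrightarrow> A x \<in> S"
    and "\<lbrakk>x \<in> S; y \<in> S\<rbrakk> \<Longrightarrow> A (x + y) = A x + A y"
    and "x \<in> S \<Longrightarrow> A (scale c x) = scale c (A x)"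
    and "\<exists>C. \<forall>x\<in>S. nrm (A x) \<le> C * nrm x"
  using assms by (auto simp: bounded_on_def)

lemma bounded_on_diff:
  assumes A: "bounded_on A" and "x \<in> S" "y \<in> S"
  shows "A (x - y) = A x - A y"
proof -
  have "A (x - y + y) = A (x - y) + A y"
    using A assms(2,3) S_diff unfolding bounded_on_def by blast
  then show ?thesis by simp
qed

lemma bounded_on_cauchy:
  assumes A: "bounded_on A" and x: "cauchy x"
  shows "cauchy (\<lambda>n. A (x n))"
proof -
  obtain C where "\<And>v. v \<in> S \<Longrightarrow> nrm (A v) \<le> C * nrm v" using bounded_onD(4)[OF A] by blast
  then show ?thesis
    using cauchy_bounded_map[of x A C] x bounded_on_diff[OF A] bounded_onD(1)[OF A] by blast
qed

lemma ext_approx: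
  assumes A: "bounded_on A" and x: "approx F x"
  shows "approx (ext A F) (\<lambda>n. A (x n))"
proof -
  have F: "approx F (rep F)" using x K_memI rep_approx by blast
  obtain C where C: "\<And>v. v \<in> S \<Longrightarrow> nrm (A v) \<le> C * nrm v" using bounded_onD(4)[OF A] by blast
  have AS: "A v \<in> S" if "v \<in> S" for v using A that by (auto simp: bounded_on_def)
  have "approx (ext A F) (\<lambda>n. A (rep F n))"
    unfolding ext_def
    by (rule someI_ex[of "\<lambda>G. approx G (\<lambda>n. A (rep F n))"])
      (rule approx_exists[OF bounded_on_cauchy[OF A approx_cauchy[OF F]]])
  moreover have "(\<lambda>n. nrm (A (rep F n) - A (x n))) \<longlonglongrightarrow> 0"
  proof (rule tendsto_sandwich[of "\<lambda>_. 0" _ _ "\<lambda>n. C * nrm (rep F n - x n)"])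
    show "\<forall>\<^sub>F n in sequentially. nrm (A (rep F n) - A (x n)) \<le> C * nrm (rep F n - x n)"
      using C[OF S_diff[OF approx_mem[OF F] approx_mem[OF x]]]
        bounded_on_diff[OF A approx_mem[OF F] approx_mem[OF x]] by simp
    show "(\<lambda>n. C * nrm (rep F n - x n)) \<longlonglongrightarrow> 0"
      using tendsto_mult_right_zero[OF approx_same[OF F x]] by blast
    show "\<forall>\<^sub>F n in sequentially. 0 \<le> nrm (A (rep F n) - A (x n))"
      using nrm_nonneg[OF S_diff[OF AS[OF approx_mem[OF F]] AS[OF approx_mem[OF x]]]] by simp
  qed auto
  ultimately show ?thesis
    using approx_perturb bounded_on_cauchy[OF A approx_cauchy[OF x]] by blast
qed

lemma ext_emb: "\<lbrakk>bounded_on A; f \<in> S\<rbrakk> \<Longrightarrow> ext A (emb f) = emb (A f)"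
  using approx_unique[OF ext_approx[OF _ emb_approx] emb_approx] by (auto simp: bounded_on_def)

lemma ext_mem: "\<lbrakk>bounded_on A; F \<in> hcarrier K\<rbrakk> \<Longrightarrow> ext A F \<in> hcarrier K"
  using ext_approx rep_approx K_memI by blast

lemma ext_bounded:
  assumes A: "bounded_on A"
  shows "bounded_operator K (ext A)"
  unfolding bounded_operator_def linear_map_def
proof (intro conjI ballI allI Pi_I)
  fix F assume F: "F \<in> hcarrier K"
  show "ext A F \<in> hcarrier K" using ext_mem[OF A F] .
  note f = rep_approx[OF F] and af = ext_approx[OF A rep_approx[OF F]]
  show "ext A (hscale K c F) = hscale K c (ext A F)" for c
    using ext_approx[OF A approx_scale[OF f, of c]] approx_scale[OF af, of c] A approx_mem[OF f]
    by (intro approx_unique[of _ "\<lambda>n. A (scale c (rep F n))"]) (auto simp: bounded_on_def)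
  fix G assume G: "G \<in> hcarrier K"
  note g = rep_approx[OF G] and ag = ext_approx[OF A rep_approx[OF G]]
  show "ext A (F + G) = ext A F + ext A G"
    using ext_approx[OF A approx_add[OF f g]] approx_add[OF af ag] A approx_mem[OF f] approx_mem[OF g]
    by (intro approx_unique[of _ "\<lambda>n. A (rep F n + rep G n)"]) (auto simp: bounded_on_def)
next
  obtain C where C: "\<And>v. v \<in> S \<Longrightarrow> nrm (A v) \<le> C * nrm v" using bounded_onD(4)[OF A] by blast
  have "hnorm K (ext A F) \<le> C * hnorm K F" if F: "F \<in> hcarrier K" for F
  proof (rule LIMSEQ_le[OF K_norm_lim[OF ext_approx[OF A rep_approx[OF F]]]
        tendsto_mult_left[OF K_norm_lim[OF rep_approx[OF F]]]])
    show "\<exists>N. \<forall>n\<ge>N. nrm (A (rep F n)) \<le> C * nrm (rep F n)"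
      using C approx_mem[OF rep_approx[OF F]] by blast
  qed
  then show "\<exists>C. \<forall>F\<in>hcarrier K. hnorm K (ext A F) \<le> C * hnorm K F" by blast
qed

lemma ext_adj:
  assumes A: "bounded_on A" and B: "bounded_on B"
    and AB: "\<And>f g. \<lbrakk>f \<in> S; g \<in> S\<rbrakk> \<Longrightarrow> q (A f) g = q f (B g)" and F: "F \<in> hcarrier K"
  shows "adj K (ext A) F = ext B F"
proof -
  interpret k: hilbert_space K by (rule K_hilbert)
  show ?thesis
  proof (rule k.adj_eqI[OF _ _ _ F])
    fix F G assume "F \<in> hcarrier K" "G \<in> hcarrier K"
    then have f: "approx F (rep F)" and g: "approx G (rep G)" by (auto intro: rep_approx)
    show "hinner K (ext A F) G = hinner K F (ext B G)"
      using K_inner_lim[OF ext_approx[OF A f] g] K_inner_lim[OF f ext_approx[OF B g]]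
      by (intro LIMSEQ_unique) (auto simp: AB approx_mem[OF f] approx_mem[OF g])
  qed (auto intro: ext_mem A B)
qed

text \<open>Carries relations between products of two maps to the completion. Besides the
  commutation relations it covers the row isometry relation, with identities for \<open>C\<close>
  and \<open>D\<close> and \<open>c\<close> equal to 1 or 0.\<close>

lemma ext_comp_eq:
  assumes A: "bounded_on A" and B: "bounded_on B" and C: "bounded_on C" and D: "bounded_on D"
    and eq: "\<And>f. f \<in> S \<Longrightarrow> A (B f) = scale c (C (D f))" and F: "F \<in> hcarrier K"
  shows "ext A (ext B F) = hscale K c (ext C (ext D F))"
proof -
  note f = rep_approx[OF F]
  show ?thesis
    using ext_approx[OF A ext_approx[OF B f]] approx_scale[OF ext_approx[OF C ext_approx[OF D f]], of c]
      eq approx_mem[OF f]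
    by (intro approx_unique[of _ "\<lambda>n. A (B (rep F n))"]) auto
qed

lemma K_span_dense:
  "hcarrier K = hclosed_span K (\<Union>a. (\<lambda>h. emb (e a h)) ` hcarrier H)" (is "_ = hclosed_span K ?A")
proof -
  interpret k: hilbert_space K by (rule K_hilbert)
  have A: "?A \<subseteq> hcarrier K" using emb_mem e_mem by auto
  have sp: "f \<in> S \<and> emb f \<in> k.span ?A" if "f \<in> span (\<Union>a. e a ` hcarrier H)" for f
    using that
  proof (induction rule: span_induct_alt)
    case base
    show ?case unfolding emb_zero using S_zero k.span_zero by (intro conjI)
  next
    case (step c v y)
    then obtain a h where v: "v = e a h" "h \<in> hcarrier H" by blast
    then have vS: "v \<in> S" "emb v \<in> k.span ?A" using e_mem by (auto intro!: k.span_base)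
    have "emb (scale c v + y) = hscale K c (emb v) + emb y"
      using vS(1) step.IH S_scale by (simp only: emb_add emb_scale)
    then show ?case using step.IH vS S_add S_scale k.span_add k.span_scale by metis
  qed
  show ?thesis
  proof (intro set_eqI iffI)
    fix F assume F: "F \<in> hcarrier K"
    have "\<exists>y \<in> k.span ?A. hnorm K (F - y) < \<epsilon>" if "\<epsilon> > 0" for \<epsilon>
      using emb_dense[OF F that] sp S_span by blast
    then show "F \<in> hclosed_span K ?A" unfolding k.hclosed_span_iff[OF A] using F by blast
  next
    fix F assume "F \<in> hclosed_span K ?A"
    then show "F \<in> hcarrier K" unfolding k.hclosed_span_iff[OF A] by blast
  qed
qed

end

section \<open>Moving generators through words\<close>

definition multi_words :: "nat \<Rightarrow> (nat \<Rightarrow> nat) \<Rightarrow> (nat \<Rightarrow> nat list) set" where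
  "multi_words k n = {\<alpha>. \<forall>i\<in>{1..k}. \<alpha> i \<in> lists {1..n i}}"

lemma multi_wordsD: "\<lbrakk>\<alpha> \<in> multi_words k n; i \<in> {1..k}\<rbrakk> \<Longrightarrow> \<alpha> i \<in> lists {1..n i}"
  unfolding multi_words_def by blast

text \<open>The scalar collected by an operator that crosses all blocks listed in \<open>js\<close>
  and picks up \<mu> j t at each letter t of block j.\<close>

definition word_prod ::
  "(nat \<Rightarrow> nat \<Rightarrow> complex) \<Rightarrow> (nat \<Rightarrow> nat list) \<Rightarrow> nat list \<Rightarrow> complex" where
  "word_prod \<mu> \<alpha> js = (\<Prod>j\<leftarrow>js. \<Prod>t\<leftarrow>\<alpha> j. \<mu> j t)"

lemma word_prod_simps [simp]:
  "word_prod \<mu> \<alpha> [] = 1"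
  "word_prod \<mu> \<alpha> (j # js) = (\<Prod>t\<leftarrow>\<alpha> j. \<mu> j t) * word_prod \<mu> \<alpha> js"
  "word_prod \<mu> \<alpha> (js @ js') = word_prod \<mu> \<alpha> js * word_prod \<mu> \<alpha> js'"
  by (simp_all add: word_prod_def)

lemma word_prod_upd_out [simp]: "i \<notin> set js \<Longrightarrow> word_prod \<mu> (\<alpha>(i := w)) js = word_prod \<mu> \<alpha> js"
  by (induction js) auto

lemma word_prod_append:
  "\<lbrakk>distinct js; i \<in> set js\<rbrakk> \<Longrightarrow>
     word_prod \<mu> (\<alpha>(i := u @ v)) js = (\<Prod>t\<leftarrow>u. \<mu> i t) * word_prod \<mu> (\<alpha>(i := v)) js"
  by (induction js) (auto simp: mult_ac)

lemma norm_prod_list_1: "(\<And>t. t \<in> set w \<Longrightarrow> cmod (f t) = 1) \<Longrightarrow> cmod (\<Prod>t\<leftarrow>w. f t) = 1"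
  by (induction w) (auto simp: norm_mult)

lemma norm_word_prod:
  "(\<And>j t. \<lbrakk>j \<in> set js; t \<in> set (\<alpha> j)\<rbrakk> \<Longrightarrow> cmod (\<mu> j t) = 1) \<Longrightarrow> cmod (word_prod \<mu> \<alpha> js) = 1"
  by (induction js) (auto simp: norm_mult norm_prod_list_1)

lemma cnj_word_prod: "cnj (word_prod \<mu> \<alpha> js) = word_prod (\<lambda>j t. cnj (\<mu> j t)) \<alpha> js"
proof -
  have "cnj (\<Prod>t\<leftarrow>w. f t) = (\<Prod>t\<leftarrow>w. cnj (f t))" for w :: "nat list" and f
    by (induction w) auto
  then show ?thesis by (induction js) auto
qed

lemma upt_split: "1 \<le> i \<Longrightarrow> i \<le> k \<Longrightarrow> [1..<Suc k] = [1..<i] @ i # [Suc i..<Suc k]"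
proof -
  assume "1 \<le> i" "i \<le> k"
  then have "[1..<Suc k] = [1..<i] @ [i..<Suc k]"
    by (metis le_SucI upt_add_eq_append le_add_diff_inverse)
  then show ?thesis using \<open>i \<le> k\<close> by (simp add: upt_conv_Cons del: upt_Suc)
qed

lemma word_rel:
  assumes "\<And>t x y. \<lbrakk>t \<in> set w; R x y\<rbrakk> \<Longrightarrow> R (A t x) (A' t y)" and "R x y"
  shows "R (word_op A w x) (word_op A' w y)"
  using assms by (induction w) (auto simp: word_op_def)

text \<open>A single induction over words for an arbitrary relation \<open>R\<close>. Suitable
  choices of \<open>R\<close> give membership, homogeneity, preservation of the norm and transport
  along the embedding into the completion.\<close>

lemma words_rel:
  assumes step: "\<And>j t x y. \<lbrakk>j \<in> {1..k}; t \<in> {1..n j}; R x y\<rbrakk> \<Longrightarrow> R (V j t x) (V' j t y)"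
    and js: "set js \<subseteq> {1..k}" and \<alpha>: "\<alpha> \<in> multi_words k n" and xy: "R x y"
  shows "R (foldr (\<lambda>i. word_op (V i) (\<alpha> i)) js x) (foldr (\<lambda>i. word_op (V' i) (\<alpha> i)) js y)"
  using js
proof (induction js)
  case (Cons j js)
  then have j: "j \<in> {1..k}" by simp
  have "t \<in> {1..n j}" if "t \<in> set (\<alpha> j)" for t using multi_wordsD[OF \<alpha> j] that by auto
  with Cons step[OF j] show ?case by (simp add: word_rel[where R = R])
qed (simp add: xy)

lemma multiword_rel:
  assumes "\<And>j t x y. \<lbrakk>j \<in> {1..k}; t \<in> {1..n j}; R x y\<rbrakk> \<Longrightarrow> R (V j t x) (V' j t y)"
    and "\<alpha> \<in> multi_words k n" and "R x y"
  shows "R (multiword_op k V \<alpha> x) (multiword_op k V' \<alpha> y)"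
  unfolding multiword_op_def by (rule words_rel[where R = R, OF assms(1) _ assms(2,3)]) auto

text \<open>Common to the shifts of the model and to any dilation, so that the word calculus is done
  once. \<open>W\<close> plays the adjoint of \<open>V\<close>, but only through algebraic
  relations, since the model functions do not yet form a Hilbert space.\<close>

locale lambda_system = vector_space scale
  for scale :: "complex \<Rightarrow> 'a::ab_group_add \<Rightarrow> 'a" +
  fixes C :: "'a set" and k :: nat and n :: "nat \<Rightarrow> nat"
    and lam :: "nat \<Rightarrow> nat \<Rightarrow> nat \<Rightarrow> nat \<Rightarrow> complex"
    and V W :: "nat \<Rightarrow> nat \<Rightarrow> 'a \<Rightarrow> 'a"
  assumes C_scale: "x \<in> C \<Longrightarrow> scale c x \<in> C"
    and V_mem: "\<lbrakk>i \<in> {1..k}; s \<in> {1..n i}; x \<in> C\<rbrakk> \<Longrightarrow> V i s x \<in> C"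
    and W_mem: "\<lbrakk>i \<in> {1..k}; s \<in> {1..n i}; x \<in> C\<rbrakk> \<Longrightarrow> W i s x \<in> C"
    and V_scale: "\<lbrakk>i \<in> {1..k}; s \<in> {1..n i}; x \<in> C\<rbrakk> \<Longrightarrow> V i s (scale c x) = scale c (V i s x)"
    and VV: "\<lbrakk>i \<in> {1..k}; s \<in> {1..n i}; j \<in> {1..k}; t \<in> {1..n j}; i \<noteq> j; x \<in> C\<rbrakk>
          \<Longrightarrow> V i s (V j t x) = scale (lam i j s t) (V j t (V i s x))"
    and WV: "\<lbrakk>i \<in> {1..k}; s \<in> {1..n i}; j \<in> {1..k}; t \<in> {1..n j}; i \<noteq> j; x \<in> C\<rbrakk>
          \<Longrightarrow> W i s (V j t x) = scale (cnj (lam i j s t)) (V j t (W i s x))"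
    and WV_same: "\<lbrakk>i \<in> {1..k}; s \<in> {1..n i}; t \<in> {1..n i}; x \<in> C\<rbrakk>
          \<Longrightarrow> W i s (V i t x) = (if s = t then x else 0)"
begin

abbreviation words_op :: "nat list \<Rightarrow> (nat \<Rightarrow> nat list) \<Rightarrow> 'a \<Rightarrow> 'a" where
  "words_op js \<alpha> \<equiv> foldr (\<lambda>i. word_op (V i) (\<alpha> i)) js"

lemma word_mem:
  assumes "j \<in> {1..k}" "w \<in> lists {1..n j}" "x \<in> C"
  shows "word_op (V j) w x \<in> C"
  by (rule word_rel[where R = "\<lambda>x _. x \<in> C"]) (use assms V_mem in auto)

lemma words_mem: "\<lbrakk>set js \<subseteq> {1..k}; \<alpha> \<in> multi_words k n; x \<in> C\<rbrakk> \<Longrightarrow> words_op js \<alpha> x \<in> C"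
  by (rule words_rel[where R = "\<lambda>x _. x \<in> C"]) (auto intro: V_mem)

lemma word_scale:
  assumes "j \<in> {1..k}" "w \<in> lists {1..n j}" "x \<in> C"
  shows "word_op (V j) w (scale c x) = scale c (word_op (V j) w x)"
  using word_rel[where R = "\<lambda>x y. y \<in> C \<and> x = scale c y" and A = "V j" and A' = "V j" and w = w
      and x = "scale c x" and y = x] assms V_mem V_scale by auto

lemma words_scale:
  assumes "set js \<subseteq> {1..k}" "\<alpha> \<in> multi_words k n" "x \<in> C"
  shows "words_op js \<alpha> (scale c x) = scale c (words_op js \<alpha> x)"
  using words_rel[where R = "\<lambda>x y. y \<in> C \<and> x = scale c y" and V = V and V' = V
      and x = "scale c x" and y = x, OF _ assms(1,2)] V_mem V_scale assms(3) by auto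

lemma words_zero:
  assumes "set js \<subseteq> {1..k}" "\<alpha> \<in> multi_words k n" "x \<in> C"
  shows "words_op js \<alpha> 0 = 0"
  using words_scale[OF assms, of 0] by simp

lemma pass_word:
  assumes A: "\<And>t y. \<lbrakk>t \<in> {1..n j}; y \<in> C\<rbrakk> \<Longrightarrow> A (V j t y) = scale (\<mu> t) (V j t (A y))"
    and Am: "\<And>y. y \<in> C \<Longrightarrow> A y \<in> C"
    and j: "j \<in> {1..k}" and w: "w \<in> lists {1..n j}" and x: "x \<in> C"
  shows "A (word_op (V j) w x) = scale (\<Prod>t\<leftarrow>w. \<mu> t) (word_op (V j) w (A x))"
  using w
proof (induction w)
  case (Cons t w)
  then have t: "t \<in> {1..n j}" and w: "w \<in> lists {1..n j}" by auto
  have "A (word_op (V j) (t # w) x) = scale (\<mu> t) (V j t (A (word_op (V j) w x)))"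
    using A[OF t word_mem[OF j w x]] by (simp add: word_op_def)
  also have "A (word_op (V j) w x) = scale (\<Prod>t\<leftarrow>w. \<mu> t) (word_op (V j) w (A x))"
    using Cons.IH w by blast
  also have "V j t \<dots> = scale (\<Prod>t\<leftarrow>w. \<mu> t) (word_op (V j) (t # w) (A x))"
    using V_scale[OF j t word_mem[OF j w Am[OF x]]] by (simp add: word_op_def)
  finally show ?case by simp
qed (simp add: word_op_def)

text \<open>Stated for an arbitrary \<open>A\<close> so that it serves both for a generator and for
  an adjoint, which differ only in the scalars \<mu>.\<close>

lemma pass_words:
  assumes A: "\<And>j t y. \<lbrakk>j \<in> set js; t \<in> {1..n j}; y \<in> C\<rbrakk> \<Longrightarrow> A (V j t y) = scale (\<mu> j t) (V j t (A y))"
    and Am: "\<And>y. y \<in> C \<Longrightarrow> A y \<in> C"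
    and js: "set js \<subseteq> {1..k}" and \<alpha>: "\<alpha> \<in> multi_words k n" and x: "x \<in> C"
  shows "A (words_op js \<alpha> x) = scale (word_prod \<mu> \<alpha> js) (words_op js \<alpha> (A x))"
  using A js
proof (induction js)
  case (Cons j js)
  have j: "j \<in> {1..k}" and js: "set js \<subseteq> {1..k}" and w: "\<alpha> j \<in> lists {1..n j}"
    using Cons.prems(2) \<alpha> by (auto simp: multi_words_def)
  have IH: "A (words_op js \<alpha> x) = scale (word_prod \<mu> \<alpha> js) (words_op js \<alpha> (A x))"
    using Cons.IH Cons.prems(1) js by simp
  have "A (words_op (j # js) \<alpha> x) =
      scale (\<Prod>t\<leftarrow>\<alpha> j. \<mu> j t) (word_op (V j) (\<alpha> j) (A (words_op js \<alpha> x)))"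
    using pass_word[of j A "\<mu> j", OF _ Am j w words_mem[OF js \<alpha> x]] Cons.prems(1) by simp
  also have "word_op (V j) (\<alpha> j) (A (words_op js \<alpha> x)) =
      scale (word_prod \<mu> \<alpha> js) (words_op (j # js) \<alpha> (A x))"
    using IH word_scale[OF j w words_mem[OF js \<alpha> Am[OF x]]] by simp
  finally show ?case by simp
qed simp

lemma words_op_upd: "i \<notin> set js \<Longrightarrow> words_op js (\<alpha>(i := w)) x = words_op js \<alpha> x"
  by (induction js) auto

lemma multiword_split:
  assumes "i \<in> {1..k}"
  shows "multiword_op k V \<alpha> x = words_op [1..<i] \<alpha> (word_op (V i) (\<alpha> i) (words_op [Suc i..<Suc k] \<alpha> x))"
  using assms upt_split[of i k] by (simp add: multiword_op_def del: upt_Suc)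

lemma multi_words_upd: "\<lbrakk>\<alpha> \<in> multi_words k n; w \<in> lists {1..n i}\<rbrakk> \<Longrightarrow> \<alpha>(i := w) \<in> multi_words k n"
  by (auto simp: multi_words_def)

lemma multiword_mem: "\<lbrakk>\<alpha> \<in> multi_words k n; x \<in> C\<rbrakk> \<Longrightarrow> multiword_op k V \<alpha> x \<in> C"
  unfolding multiword_op_def by (rule words_mem) auto

text \<open>The new letter crosses the blocks before \<open>i\<close> and then stands at the front
  of block \<open>i\<close>; the later blocks are not touched.\<close>

lemma V_multiword:
  assumes i: "i \<in> {1..k}" and s: "s \<in> {1..n i}" and \<alpha>: "\<alpha> \<in> multi_words k n" and x: "x \<in> C"
  shows "V i s (multiword_op k V \<alpha> x) =
    scale (word_prod (\<lambda>j. lam i j s) \<alpha> [1..<i]) (multiword_op k V (\<alpha>(i := s # \<alpha> i)) x)"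
proof -
  have w: "\<alpha> i \<in> lists {1..n i}" using \<alpha> i by (auto simp: multi_words_def)
  define z where "z = word_op (V i) (\<alpha> i) (words_op [Suc i..<Suc k] \<alpha> x)"
  have z: "z \<in> C" unfolding z_def using i w \<alpha> x by (intro word_mem words_mem) auto
  have "V i s (words_op [1..<i] \<alpha> z) =
      scale (word_prod (\<lambda>j. lam i j s) \<alpha> [1..<i]) (words_op [1..<i] \<alpha> (V i s z))"
    using i s \<alpha> z by (intro pass_words) (auto intro!: VV V_mem)
  moreover have "multiword_op k V (\<alpha>(i := s # \<alpha> i)) x = words_op [1..<i] \<alpha> (V i s z)"
    unfolding multiword_split[OF i] z_def
    by (simp add: words_op_upd del: upt_Suc fun_upd_apply) (simp add: word_op_def)
  ultimately show ?thesis unfolding multiword_split[OF i, of \<alpha>] z_def by simp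
qed

text \<open>The adjoint crosses the blocks before \<open>i\<close> with conjugate scalars and meets
  the first letter \<open>t\<close> of block \<open>i\<close>, where orthogonality of the ranges
  decides.\<close>

lemma W_multiword_Cons:
  assumes i: "i \<in> {1..k}" and s: "s \<in> {1..n i}" and \<alpha>: "\<alpha> \<in> multi_words k n" and x: "x \<in> C"
    and ai: "\<alpha> i = t # w"
  shows "W i s (multiword_op k V \<alpha> x) = (if s = t then
    scale (word_prod (\<lambda>j t. cnj (lam i j s t)) \<alpha> [1..<i]) (multiword_op k V (\<alpha>(i := w)) x) else 0)"
proof -
  have tw: "t \<in> {1..n i}" "w \<in> lists {1..n i}" using multi_wordsD[OF \<alpha> i] ai by auto
  define z where "z = word_op (V i) w (words_op [Suc i..<Suc k] \<alpha> x)"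
  have z: "z \<in> C" unfolding z_def using i tw \<alpha> x by (intro word_mem words_mem) auto
  have "multiword_op k V \<alpha> x = words_op [1..<i] \<alpha> (V i t z)"
    unfolding multiword_split[OF i] z_def ai by (simp add: word_op_def)
  also have "W i s \<dots> = scale (word_prod (\<lambda>j t. cnj (lam i j s t)) \<alpha> [1..<i])
      (words_op [1..<i] \<alpha> (W i s (V i t z)))"
    using i s tw \<alpha> z by (intro pass_words) (auto intro!: WV W_mem V_mem)
  also have "W i s (V i t z) = (if s = t then z else 0)" by (rule WV_same[OF i s tw(1) z])
  finally have "W i s (multiword_op k V \<alpha> x) = scale (word_prod (\<lambda>j t. cnj (lam i j s t)) \<alpha> [1..<i])
      (words_op [1..<i] \<alpha> (if s = t then z else 0))" .
  moreover have "words_op [1..<i] \<alpha> z = multiword_op k V (\<alpha>(i := w)) x"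
    unfolding multiword_split[OF i] z_def by (simp add: words_op_upd del: upt_Suc fun_upd_apply) simp
  moreover have "words_op [1..<i] \<alpha> 0 = 0" using i \<alpha> x by (intro words_zero) auto
  ultimately show ?thesis by simp
qed

text \<open>With block \<open>i\<close> empty nothing stops the adjoint: it crosses the blocks on
  both sides of \<open>i\<close> and reaches the vector.\<close>

lemma W_multiword_Nil:
  assumes i: "i \<in> {1..k}" and s: "s \<in> {1..n i}" and \<alpha>: "\<alpha> \<in> multi_words k n" and x: "x \<in> C"
    and ai: "\<alpha> i = []"
  shows "W i s (multiword_op k V \<alpha> x) =
    scale (word_prod (\<lambda>j t. cnj (lam i j s t)) \<alpha> ([1..<i] @ [Suc i..<Suc k]))
      (multiword_op k V \<alpha> (W i s x))"
proof -
  have eq: "multiword_op k V \<alpha> y = words_op ([1..<i] @ [Suc i..<Suc k]) \<alpha> y" for y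
    unfolding multiword_split[OF i] ai by (simp add: word_op_def)
  show ?thesis unfolding eq
    using i s \<alpha> x by (intro pass_words) (auto intro!: WV W_mem)
qed

end

section \<open>Sesquilinear forms and positivity of partial defects\<close>

text \<open>\<open>B i s\<close> plays the role of \<open>T\<^sub>i\<^sub>,\<^sub>s\<^sup>*\<close>, extended by zero off the carrier. An operator \<open>X\<close> is
  represented by its form \<open>(h, h') \<mapsto> \<langle>X h, h'\<rangle>\<close>.\<close>

locale lambda_adjoints = hilbert_space H for H :: "'h::ab_group_add hspace" +
  fixes n :: "nat \<Rightarrow> nat" and lam :: "nat \<Rightarrow> nat \<Rightarrow> nat \<Rightarrow> nat \<Rightarrow> complex"
    and B :: "nat \<Rightarrow> nat \<Rightarrow> 'h \<Rightarrow> 'h"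
  assumes lam_unit: "i \<noteq> j \<Longrightarrow> cmod (lam i j s t) = 1"
    and lam_sym: "i \<noteq> j \<Longrightarrow> lam j i t s = cnj (lam i j s t)"
    and B_mem: "B i s x \<in> hcarrier H"
    and B_add: "\<lbrakk>x \<in> hcarrier H; y \<in> hcarrier H\<rbrakk> \<Longrightarrow> B i s (x + y) = B i s x + B i s y"
    and B_scale: "x \<in> hcarrier H \<Longrightarrow> B i s (hscale H c x) = hscale H c (B i s x)"
    and B_comm: "i \<noteq> j \<Longrightarrow> B i s (B j t x) = hscale H (lam i j s t) (B j t (B i s x))"
begin

definition sesq :: "('h \<Rightarrow> 'h \<Rightarrow> complex) \<Rightarrow> bool" where
  "sesq X \<longleftrightarrow> (\<forall>x\<in>hcarrier H. \<forall>y\<in>hcarrier H. X y x = cnj (X x y) \<and>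
     (\<forall>c. X (hscale H c x) y = c * X x y) \<and> (\<forall>z\<in>hcarrier H. X (x + z) y = X x y + X z y))"

definition form_pos :: "('h \<Rightarrow> 'h \<Rightarrow> complex) \<Rightarrow> bool" where
  "form_pos X \<longleftrightarrow> (\<forall>x\<in>hcarrier H. 0 \<le> Re (X x x))"

definition form_bounded :: "('h \<Rightarrow> 'h \<Rightarrow> complex) \<Rightarrow> bool" where
  "form_bounded X \<longleftrightarrow> (\<exists>C\<ge>0. \<forall>x\<in>hcarrier H. \<bar>Re (X x x)\<bar> \<le> C * (hnorm H x)\<^sup>2)"

text \<open>Comes from <T X T^* h, h'> = <X T^* h, T^* h'>. Only the adjoints enter, and the
  dependence of the iterated defects on the radius becomes a pointwise statement about
  numbers.\<close>

definition Phi_form :: "nat \<Rightarrow> ('h \<Rightarrow> 'h \<Rightarrow> complex) \<Rightarrow> 'h \<Rightarrow> 'h \<Rightarrow> complex" where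
  "Phi_form i X h h' = (\<Sum>s\<in>{1..n i}. X (B i s h) (B i s h'))"

definition D_form :: "real \<Rightarrow> nat \<Rightarrow> ('h \<Rightarrow> 'h \<Rightarrow> complex) \<Rightarrow> 'h \<Rightarrow> 'h \<Rightarrow> complex" where
  "D_form r i X h h' = X h h' - of_real (r\<^sup>2) * Phi_form i X h h'"

lemma sesq_inner: "sesq (hinner H)"
  unfolding sesq_def using hinner_commute hinner_scale hinner_add by blast

lemma sesqD:
  assumes "sesq X" "x \<in> hcarrier H" "y \<in> hcarrier H"
  shows sesq_commute: "X y x = cnj (X x y)"
    and sesq_scale: "X (hscale H c x) y = c * X x y"
    and sesq_add: "z \<in> hcarrier H \<Longrightarrow> X (x + z) y = X x y + X z y"
  using assms unfolding sesq_def by blast+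

lemma sesq_scale_right:
  assumes X: "sesq X" "x \<in> hcarrier H" "y \<in> hcarrier H"
  shows "X x (hscale H c y) = cnj c * X x y"
  using sesq_commute[OF X(1) ip.S_scale[OF X(3)] X(2)] sesq_scale[OF X(1,3,2)]
    sesq_commute[OF X(1,3,2)] by simp

lemma sesq_unit:
  assumes X: "sesq X" "x \<in> hcarrier H" "y \<in> hcarrier H" and c: "cmod c = 1"
  shows "X (hscale H c x) (hscale H c y) = X x y"
proof -
  have "X (hscale H c x) (hscale H c y) = (c * cnj c) * X x y"
    using X ip.S_scale by (simp add: sesq_scale sesq_scale_right mult_ac)
  also have "c * cnj c = 1" using c complex_norm_square[of c] by simp
  finally show ?thesis by simp
qed

lemma sesq_Phi:
  assumes X: "sesq X"
  shows "sesq (Phi_form i X)"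
  unfolding sesq_def
proof (intro ballI conjI allI)
  fix x y assume x: "x \<in> hcarrier H" and y: "y \<in> hcarrier H"
  show "Phi_form i X y x = cnj (Phi_form i X x y)"
    unfolding Phi_form_def cnj_sum by (intro sum.cong refl sesq_commute[OF X B_mem B_mem])
  show "Phi_form i X (hscale H c x) y = c * Phi_form i X x y" for c
    unfolding Phi_form_def by (simp add: B_scale[OF x] sesq_scale[OF X B_mem B_mem] sum_distrib_left)
  show "Phi_form i X (x + z) y = Phi_form i X x y + Phi_form i X z y" if "z \<in> hcarrier H" for z
    unfolding Phi_form_def by (simp add: B_add[OF x that] sesq_add[OF X B_mem B_mem B_mem] sum.distrib)
qed

lemma sesq_D:
  assumes X: "sesq X"
  shows "sesq (D_form r i X)"
  unfolding sesq_def
proof (intro ballI conjI allI)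
  note P = sesq_Phi[OF X, of i]
  fix x y assume x: "x \<in> hcarrier H" and y: "y \<in> hcarrier H"
  show "D_form r i X y x = cnj (D_form r i X x y)"
    using sesq_commute[OF X x y] sesq_commute[OF P x y] by (simp add: D_form_def)
  show "D_form r i X (hscale H c x) y = c * D_form r i X x y" for c
    by (simp add: D_form_def sesq_scale[OF X x y] sesq_scale[OF P x y] algebra_simps)
  show "D_form r i X (x + z) y = D_form r i X x y + D_form r i X z y" if "z \<in> hcarrier H" for z
    by (simp add: D_form_def sesq_add[OF X x y that] sesq_add[OF P x y that] algebra_simps)
qed

text \<open>Exchanging two adjoints costs the same unimodular scalar in both arguments, and a
  sesquilinear form does not see it.\<close>

lemma Phi_form_comm:
  assumes X: "sesq X" and ij: "i \<noteq> j"
  shows "Phi_form i (Phi_form j X) = Phi_form j (Phi_form i X)"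
proof (intro ext)
  fix h h'
  have "X (B j t (B i s h)) (B j t (B i s h')) = X (B i s (B j t h)) (B i s (B j t h'))" for s t
    using B_comm[OF ij, of s t] sesq_unit[OF X B_mem B_mem lam_unit[OF ij]] by simp
  then show "Phi_form i (Phi_form j X) h h' = Phi_form j (Phi_form i X) h h'"
    unfolding Phi_form_def by (subst sum.swap) simp
qed

lemma Phi_form_D: "Phi_form i (D_form r j X) h h' =
    Phi_form i X h h' - of_real (r\<^sup>2) * Phi_form i (Phi_form j X) h h'"
  unfolding D_form_def Phi_form_def[of i] by (simp add: sum_subtractf sum_distrib_left)

lemma Phi_D_comm:
  assumes "sesq X" "i \<noteq> j"
  shows "Phi_form i (D_form r j X) = D_form r j (Phi_form i X)"
  using Phi_form_comm[OF assms] by (simp add: fun_eq_iff Phi_form_D D_form_def)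

lemma D_form_comm:
  assumes "sesq X"
  shows "D_form r i (D_form r j X) = D_form r j (D_form r i X)"
proof (cases "i = j")
  case False
  then show ?thesis
    using Phi_form_comm[OF assms False]
    by (intro ext) (simp add: D_form_def[of r i] D_form_def[of r j] Phi_form_D algebra_simps flip: D_form_def)
qed simp

section \<open>Positivity of partial defects\<close>

lemma form_bounded_inner: "form_bounded (hinner H)"
  unfolding form_bounded_def by (rule exI[of _ 1]) (simp add: ip.nrm_sq ip.q_nonneg)

definition row_contraction :: "nat \<Rightarrow> bool" where
  "row_contraction i \<longleftrightarrow> (\<forall>x\<in>hcarrier H. (\<Sum>s\<in>{1..n i}. (hnorm H (B i s x))\<^sup>2) \<le> (hnorm H x)\<^sup>2)"

lemma form_bounded_D:
  assumes X: "form_bounded X" and i: "row_contraction i"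
  shows "form_bounded (D_form r i X)"
proof -
  obtain C where C: "C \<ge> 0" "\<And>x. x \<in> hcarrier H \<Longrightarrow> \<bar>Re (X x x)\<bar> \<le> C * (hnorm H x)\<^sup>2"
    using X form_bounded_def by blast
  have "\<bar>Re (D_form r i X x x)\<bar> \<le> (C + r\<^sup>2 * C) * (hnorm H x)\<^sup>2" if x: "x \<in> hcarrier H" for x
  proof -
    have "\<bar>Re (Phi_form i X x x)\<bar> \<le> (\<Sum>s\<in>{1..n i}. C * (hnorm H (B i s x))\<^sup>2)"
      unfolding Phi_form_def Re_sum by (rule order_trans[OF sum_abs sum_mono]) (rule C(2)[OF B_mem])
    also have "\<dots> \<le> C * (hnorm H x)\<^sup>2"
      unfolding sum_distrib_left[symmetric] using i x C(1)
      by (intro mult_left_mono) (auto simp: row_contraction_def)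
    finally have "r\<^sup>2 * \<bar>Re (Phi_form i X x x)\<bar> \<le> r\<^sup>2 * (C * (hnorm H x)\<^sup>2)"
      by (rule mult_left_mono) simp
    moreover have "Re (D_form r i X x x) = Re (X x x) - r\<^sup>2 * Re (Phi_form i X x x)"
      unfolding D_form_def by (simp del: of_real_power)
    then have "\<bar>Re (D_form r i X x x)\<bar> \<le> \<bar>Re (X x x)\<bar> + r\<^sup>2 * \<bar>Re (Phi_form i X x x)\<bar>"
      using abs_triangle_ineq4[of "Re (X x x)" "r\<^sup>2 * Re (Phi_form i X x x)"] by (simp add: abs_mult)
    ultimately show ?thesis using C(2)[OF x] by (simp add: algebra_simps)
  qed
  moreover have "C + r\<^sup>2 * C \<ge> 0" using C(1) by simp
  ultimately show ?thesis unfolding form_bounded_def by blast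
qed

text \<open>Iterating \<open>X \<ge> r\<^sup>2 \<Phi>\<^sub>i(X)\<close> gives \<open>X \<ge> - C r\<^sup>2\<^sup>m\<close> for every \<open>m\<close>.\<close>

lemma form_pos_of_D:
  assumes X: "form_bounded X" and i: "row_contraction i" and r: "0 \<le> r" "r < 1"
    and pos: "form_pos (D_form r i X)"
  shows "form_pos X"
proof -
  obtain C where C: "C \<ge> 0" and CX: "\<And>x. x \<in> hcarrier H \<Longrightarrow> \<bar>Re (X x x)\<bar> \<le> C * (hnorm H x)\<^sup>2"
    using X form_bounded_def by blast
  have low: "- (C * (r\<^sup>2) ^ m * (hnorm H x)\<^sup>2) \<le> Re (X x x)" if "x \<in> hcarrier H" for m x
    using that
  proof (induction m arbitrary: x)
    case 0
    show ?case using CX[OF 0] by (simp add: abs_le_iff)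
  next
    case (Suc m)
    have "- (C * (r\<^sup>2) ^ Suc m * (hnorm H x)\<^sup>2) = r\<^sup>2 * - (C * (r\<^sup>2) ^ m * (hnorm H x)\<^sup>2)" by simp
    also have "\<dots> \<le> r\<^sup>2 * - (C * (r\<^sup>2) ^ m * (\<Sum>s\<in>{1..n i}. (hnorm H (B i s x))\<^sup>2))"
      using i Suc.prems C r unfolding row_contraction_def
      by (intro mult_left_mono le_imp_neg_le) auto
    also have "\<dots> = r\<^sup>2 * (\<Sum>s\<in>{1..n i}. - (C * (r\<^sup>2) ^ m * (hnorm H (B i s x))\<^sup>2))"
      by (simp add: sum_distrib_left sum_negf)
    also have "\<dots> \<le> r\<^sup>2 * (\<Sum>s\<in>{1..n i}. Re (X (B i s x) (B i s x)))"
      using Suc.IH[OF B_mem] by (intro mult_left_mono sum_mono) auto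
    also have "\<dots> = Re (X x x) - Re (D_form r i X x x)"
      unfolding D_form_def Phi_form_def by (simp del: of_real_power)
    also have "\<dots> \<le> Re (X x x)" using pos Suc.prems unfolding form_pos_def by simp
    finally show ?case .
  qed
  have "0 \<le> Re (X x x)" if x: "x \<in> hcarrier H" for x
  proof -
    have "r\<^sup>2 < 1" using r by (simp add: abs_square_less_1)
    then have "norm (r\<^sup>2) < 1" by (simp only: real_norm_def abs_power2)
    then have "(\<lambda>m. (r\<^sup>2) ^ m) \<longlonglongrightarrow> 0" by (rule LIMSEQ_power_zero)
    then have "(\<lambda>m. - (C * (r\<^sup>2) ^ m * (hnorm H x)\<^sup>2)) \<longlonglongrightarrow> - (C * 0 * (hnorm H x)\<^sup>2)"
      by (intro tendsto_minus tendsto_mult tendsto_const)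
    then show ?thesis using low[OF x] LIMSEQ_le_const2[of _ 0 "Re (X x x)"] by simp
  qed
  then show ?thesis by (simp add: form_pos_def)
qed

text \<open>The factors commute, so those to be dropped, \<open>zs\<close>, can be applied last.
  They are then outermost and are peeled off one at a time with \<open>form_pos_of_D\<close>;
  boundedness of the remaining form is what each peeling consumes.\<close>

lemma form_pos_sub:
  assumes rc: "\<And>i. i \<in> set L \<Longrightarrow> row_contraction i" and L: "distinct L" and r: "0 \<le> r" "r < 1"
    and pos: "form_pos (fold (D_form r) (rev L) (hinner H))"
    and ys: "ys \<in> set (subseqs L)"
  shows "form_pos (fold (D_form r) ys (hinner H))"
proof -
  define zs where "zs = filter (\<lambda>x. x \<notin> set ys) L"
  have ysL: "set ys \<subseteq> set L" using ys subseqs_powset[of L] by (metis PowD image_eqI)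
  have dy: "distinct ys" using subseqs_distinctD[OF ys L] .
  have "distinct (ys @ zs)" "set (ys @ zs) = set L"
    using dy L ysL by (auto simp: zs_def)
  then have ms: "mset (rev L) = mset (ys @ zs)"
    using L set_eq_iff_mset_eq_distinct[of L "ys @ zs"] by simp
  have "fold (D_form r) (rev L) (hinner H) = fold (D_form r) (ys @ zs) (hinner H)"
    by (rule fold_permuted_eq[where P = sesq and f = "D_form r", OF ms sesq_inner])
      (erule sesq_D D_form_comm)+
  with pos have "form_pos (fold (D_form r) (ys @ zs) (hinner H))" by simp
  moreover have "set (ys @ zs) \<subseteq> set L" using ysL by (auto simp: zs_def)
  ultimately show ?thesis
  proof (induction zs rule: rev_induct)
    case (snoc z zs)
    have bd: "form_bounded (fold (D_form r) us X)" if "form_bounded X" "set us \<subseteq> set L" for us X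
      using that
    proof (induction us arbitrary: X)
      case (Cons u us)
      then have "form_bounded (D_form r u X)" by (intro form_bounded_D rc) simp_all
      then show ?case using Cons.IH Cons.prems(2) by simp
    qed simp
    have "form_pos (D_form r z (fold (D_form r) (ys @ zs) (hinner H)))"
      using snoc.prems(1) by simp
    moreover have "form_bounded (fold (D_form r) (ys @ zs) (hinner H))"
      using snoc.prems(2) by (intro bd[OF form_bounded_inner]) simp
    moreover have "row_contraction z" using snoc.prems(2) by (intro rc) simp
    ultimately have "form_pos (fold (D_form r) (ys @ zs) (hinner H))"
      using form_pos_of_D r by blast
    then show ?case using snoc.prems(2) by (intro snoc.IH) simp_all
  qed simp
qed

lemma isCont_fold_D:
  assumes "\<And>h h'. isCont (\<lambda>r. X r h h') a"
  shows "isCont (\<lambda>r. fold (D_form r) ys (X r) h h') a"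
  using assms
proof (induction ys arbitrary: X)
  case (Cons y ys)
  have "isCont (\<lambda>r. D_form r y (X r) h h') a" for h h'
    unfolding D_form_def Phi_form_def by (intro continuous_intros Cons.prems)
  then show ?case using Cons.IH by simp
qed simp

text \<open>The passage to radius 1 comes after the dropping of factors, because the geometric decay
  used there requires a radius below 1. For fixed vectors the form is continuous in the
  radius.\<close>

lemma form_pos_limit:
  assumes "\<And>r. \<lbrakk>0 \<le> r; r < 1\<rbrakk> \<Longrightarrow> form_pos (fold (D_form r) ys (hinner H))"
  shows "form_pos (fold (D_form 1) ys (hinner H))"
  unfolding form_pos_def
proof
  fix x assume x: "x \<in> hcarrier H"
  have "isCont (\<lambda>r. fold (D_form r) ys (hinner H) x x) 1"
    by (rule isCont_fold_D) simp
  then have "((\<lambda>r. Re (fold (D_form r) ys (hinner H) x x)) \<longlongrightarrow> Re (fold (D_form 1) ys (hinner H) x x)) (at_left 1)"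
    by (intro tendsto_Re) (auto simp: isCont_def intro: tendsto_mono at_le)
  moreover have "\<forall>\<^sub>F r in at_left (1::real). r \<in> {0<..<1}"
    unfolding eventually_at_left_field by (rule exI[of _ 0]) simp
  then have "\<forall>\<^sub>F r in at_left (1::real). 0 \<le> Re (fold (D_form r) ys (hinner H) x x)"
    by eventually_elim (use assms x in \<open>auto simp: form_pos_def\<close>)
  ultimately show "0 \<le> Re (fold (D_form 1) ys (hinner H) x x)"
    by (intro tendsto_lowerbound) auto
qed

section \<open>The form on functions with adjoint tails\<close>

definition words_less :: "nat \<Rightarrow> nat \<Rightarrow> nat list set" where
  "words_less i m = {w. set w \<subseteq> {1..n i} \<and> length w < m}"

definition words_eq :: "nat \<Rightarrow> nat \<Rightarrow> nat list set" where
  "words_eq i m = {w. set w \<subseteq> {1..n i} \<and> length w = m}"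

lemma finite_words_eq [simp]: "finite (words_eq i m)"
  unfolding words_eq_def by (rule finite_lists_length_eq) simp

lemma words_less_Suc: "words_less i (Suc m) = words_less i m \<union> words_eq i m"
  by (auto simp: words_less_def words_eq_def)

lemma words_less_0 [simp]: "words_less i 0 = {}"
  by (auto simp: words_less_def)

lemma words_eq_0 [simp]: "words_eq i 0 = {[]}"
  by (auto simp: words_eq_def)

lemma finite_words_less [simp]: "finite (words_less i m)"
  by (induction m) (auto simp: words_less_Suc)

lemma sum_words_less_Suc:
  fixes f :: "nat list \<Rightarrow> 'c::comm_monoid_add"
  shows "sum f (words_less i (Suc m)) = sum f (words_less i m) + sum f (words_eq i m)"
proof -
  have "words_less i m \<inter> words_eq i m = {}" by (auto simp: words_less_def words_eq_def)
  then show ?thesis unfolding words_less_Suc by (intro sum.union_disjoint) simp_all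
qed

text \<open>Split at the last letter, because the functions considered below continue at the end of
  a block.\<close>

lemma sum_words_eq_snoc:
  fixes f :: "nat list \<Rightarrow> 'c::comm_monoid_add"
  shows "sum f (words_eq i (Suc m)) = (\<Sum>w\<in>words_eq i m. \<Sum>s\<in>{1..n i}. f (w @ [s]))"
proof -
  have "(\<Sum>w\<in>words_eq i m. \<Sum>s\<in>{1..n i}. f (w @ [s])) = (\<Sum>(w, s)\<in>words_eq i m \<times> {1..n i}. f (w @ [s]))"
    by (rule sum.cartesian_product)
  also have "\<dots> = sum f (words_eq i (Suc m))"
  proof (rule sum.reindex_bij_witness[of _ "\<lambda>w. (butlast w, last w)" "\<lambda>(w, s). w @ [s]"])
    fix w assume w: "w \<in> words_eq i (Suc m)"
    then have "w \<noteq> []" by (auto simp: words_eq_def)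
    then show "(case (butlast w, last w) of (w, s) \<Rightarrow> w @ [s]) = w" by simp
    show "(butlast w, last w) \<in> words_eq i m \<times> {1..n i}"
      using w \<open>w \<noteq> []\<close> last_in_set[of w] by (force simp: words_eq_def dest: in_set_butlastD)
  qed (auto simp: words_eq_def)
  finally show ?thesis by simp
qed

text \<open>While the coordinates are processed, \<open>X\<close> accumulates the defects and
  \<open>b\<close> the words. Words beyond the box are absent: a word of maximal length, carrying no
  defect in its coordinate, stands for itself and all its continuations.\<close>

primrec qf :: "(nat \<Rightarrow> nat) \<Rightarrow> nat list \<Rightarrow> ('h \<Rightarrow> 'h \<Rightarrow> complex) \<Rightarrow> (nat \<Rightarrow> nat list) \<Rightarrow>
    'h dilation_vec \<Rightarrow> 'h dilation_vec \<Rightarrow> complex" where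
  "qf N [] X b f g = X (f b) (g b)"
| "qf N (i # is) X b f g =
     (\<Sum>w\<in>words_less i (N i). qf N is (D_form 1 i X) (b(i := w)) f g) +
     (\<Sum>w\<in>words_eq i (N i). qf N is X (b(i := w)) f g)"

definition Fun :: "'h dilation_vec set" where
  "Fun = {f. \<forall>b. f b \<in> hcarrier H}"

definition fscale :: "complex \<Rightarrow> 'h dilation_vec \<Rightarrow> (nat \<Rightarrow> nat list) \<Rightarrow> 'h" where
  "fscale c f = (\<lambda>b. hscale H c (f b))"

lemma FunD: "f \<in> Fun \<Longrightarrow> f b \<in> hcarrier H"
  by (simp add: Fun_def)

lemma qf_add: "\<lbrakk>sesq X; f \<in> Fun; f' \<in> Fun; g \<in> Fun\<rbrakk> \<Longrightarrow>
    qf N is X b (f + f') g = qf N is X b f g + qf N is X b f' g"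
  by (induction "is" arbitrary: X b) (simp_all add: sesq_add FunD sesq_D sum.distrib)

lemma qf_scale: "\<lbrakk>sesq X; f \<in> Fun; g \<in> Fun\<rbrakk> \<Longrightarrow> qf N is X b (fscale c f) g = c * qf N is X b f g"
  by (induction "is" arbitrary: X b)
    (simp_all add: fscale_def sesq_scale FunD sesq_D sum_distrib_left distrib_left)

lemma qf_commute: "\<lbrakk>sesq X; f \<in> Fun; g \<in> Fun\<rbrakk> \<Longrightarrow> qf N is X b g f = cnj (qf N is X b f g)"
proof (induction "is" arbitrary: X b)
  case Nil
  then show ?case using sesq_commute[of X "f b" "g b"] FunD by simp
qed (simp add: sesq_D)

text \<open>At each coordinate a defect is either applied or skipped, so the forms at the leaves are
  exactly those of the sublists of \<open>is\<close>.\<close>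

lemma qf_nonneg:
  assumes "sesq X" "f \<in> Fun" "\<And>ys. ys \<in> set (subseqs is) \<Longrightarrow> form_pos (fold (D_form 1) ys X)"
  shows "0 \<le> Re (qf N is X b f f)"
  using assms
proof (induction "is" arbitrary: X b)
  case Nil
  then show ?case using FunD by (auto simp: form_pos_def)
next
  case (Cons i "is")
  have "form_pos (fold (D_form 1) ys X)" "form_pos (fold (D_form 1) ys (D_form 1 i X))"
    if "ys \<in> set (subseqs is)" for ys
    using Cons.prems(3)[of ys] Cons.prems(3)[of "i # ys"] that by (auto simp: Let_def)
  then have "0 \<le> Re (qf N is X b f f)" "0 \<le> Re (qf N is (D_form 1 i X) b f f)" for b
    using Cons.IH Cons.prems sesq_D by blast+
  then show ?case by (simp add: sum_nonneg)
qed

lemma qf_diff_form: "qf N is (\<lambda>h h'. X h h' - Y h h') b f g = qf N is X b f g - qf N is Y b f g"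
proof (induction "is" arbitrary: X Y b)
  case (Cons i "is")
  have "D_form 1 i (\<lambda>h h'. X h h' - Y h h') = (\<lambda>h h'. D_form 1 i X h h' - D_form 1 i Y h h')"
    by (simp add: fun_eq_iff D_form_def Phi_form_def sum_subtractf)
  then show ?case by (simp add: Cons.IH sum_subtractf del: fun_upd_apply)
qed simp

lemma qf_upd_N: "i \<notin> set is \<Longrightarrow> qf (N(i := m)) is X b f g = qf N is X b f g"
  by (induction "is" arbitrary: X b) auto

text \<open>Summing over one letter appended to block \<open>i\<close> amounts to applying
  \<open>Phi_form i\<close> to the form. The scalars \<open>d\<close> are unimodular and common to
  \<open>f\<close> and \<open>g\<close>, so they cancel.\<close>

lemma qf_Phi:
  assumes "sesq X" "f \<in> Fun" "g \<in> Fun" "i \<notin> set is"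
    and unit: "\<And>s b. s \<in> {1..n i} \<Longrightarrow> cmod (d s b) = 1"
    and f: "\<And>s b. \<lbrakk>s \<in> {1..n i}; b i = w\<rbrakk> \<Longrightarrow> f (b(i := w @ [s])) = hscale H (d s b) (B i s (f b))"
    and g: "\<And>s b. \<lbrakk>s \<in> {1..n i}; b i = w\<rbrakk> \<Longrightarrow> g (b(i := w @ [s])) = hscale H (d s b) (B i s (g b))"
  shows "(\<Sum>s\<in>{1..n i}. qf N is X (b(i := w @ [s])) f g) = qf N is (Phi_form i X) (b(i := w)) f g"
  using assms(1,4)
proof (induction "is" arbitrary: X b)
  case Nil
  have "f (b(i := w @ [s])) = hscale H (d s (b(i := w))) (B i s (f (b(i := w))))"
    "g (b(i := w @ [s])) = hscale H (d s (b(i := w))) (B i s (g (b(i := w))))" if "s \<in> {1..n i}" for s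
    using f[OF that, of "b(i := w)"] g[OF that, of "b(i := w)"] by simp_all
  then have "X (f (b(i := w @ [s]))) (g (b(i := w @ [s]))) =
      X (B i s (f (b(i := w)))) (B i s (g (b(i := w))))" if "s \<in> {1..n i}" for s
    using that sesq_unit[OF Nil.prems(1) B_mem B_mem unit[OF that]] by metis
  then show ?case by (simp only: Phi_form_def qf.simps cong: sum.cong)
next
  case (Cons j js)
  then have ij: "i \<noteq> j" and X: "sesq X" by auto
  have IH: "(\<Sum>s\<in>{1..n i}. qf N js Y (b(i := w @ [s], j := v)) f g) =
      qf N js (Phi_form i Y) (b(i := w, j := v)) f g" if "sesq Y" for Y v
  proof -
    have tw: "b(i := u, j := v) = b(j := v, i := u)" for u by (rule fun_upd_twist[OF ij])
    show ?thesis unfolding tw using Cons.prems(2) by (intro Cons.IH[OF that]) simp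
  qed
  have swap: "(\<Sum>s\<in>{1..n i}. \<Sum>v\<in>A. qf N js Y (b(i := w @ [s], j := v)) f g) =
      (\<Sum>v\<in>A. qf N js (Phi_form i Y) (b(i := w, j := v)) f g)" if "sesq Y" for Y A
    by (subst sum.swap) (simp only: IH[OF that])
  have "(\<Sum>s\<in>{1..n i}. qf N (j # js) X (b(i := w @ [s])) f g) =
      (\<Sum>s\<in>{1..n i}. \<Sum>v\<in>words_less j (N j). qf N js (D_form 1 j X) (b(i := w @ [s], j := v)) f g) +
      (\<Sum>s\<in>{1..n i}. \<Sum>v\<in>words_eq j (N j). qf N js X (b(i := w @ [s], j := v)) f g)"
    by (simp only: qf.simps sum.distrib)
  also have "\<dots> = qf N (j # js) (Phi_form i X) (b(i := w)) f g"
    by (simp only: swap[OF X] swap[OF sesq_D[OF X]] Phi_D_comm[OF X ij] qf.simps)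
  finally show ?case .
qed

end

locale lambda_model = lambda_adjoints +
  fixes k :: nat
  assumes defect_pos: "ys \<in> set (subseqs [1..<Suc k]) \<Longrightarrow> form_pos (fold (D_form 1) ys (hinner H))"
begin

text \<open>Appending \<open>s\<close> to block \<open>i\<close> of T_\<beta>^* inserts an adjoint
  inside the adjoints of the later blocks; this is the scalar for pulling it outside all of
  them.\<close>

definition tail_coeff :: "nat \<Rightarrow> nat \<Rightarrow> (nat \<Rightarrow> nat list) \<Rightarrow> complex" where
  "tail_coeff i s b = word_prod (\<lambda>j t. cnj (lam i j s t)) b [Suc i..<Suc k]"

text \<open>Continuation takes place at the end of a block, whereas the shifts act at its front; the
  two interact only through scalars and through the length at which the rule starts.\<close>

definition tail :: "(nat \<Rightarrow> nat) \<Rightarrow> 'a dilation_vec \<Rightarrow> bool" where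
  "tail N f \<longleftrightarrow> (\<forall>i\<in>{1..k}. \<forall>s\<in>{1..n i}. \<forall>b. N i \<le> length (b i) \<longrightarrow>
     f (b(i := b i @ [s])) = hscale H (tail_coeff i s b) (B i s (f b)))"

lemma tailD: "\<lbrakk>tail N f; i \<in> {1..k}; s \<in> {1..n i}; N i \<le> length (b i)\<rbrakk> \<Longrightarrow>
    f (b(i := b i @ [s])) = hscale H (tail_coeff i s b) (B i s (f b))"
  unfolding tail_def by blast

lemma tail_mono: "\<lbrakk>tail N f; N \<le> N'\<rbrakk> \<Longrightarrow> tail N' f"
  unfolding tail_def le_fun_def by (meson order_trans)

lemma tail_coeff_unit: "cmod (tail_coeff i s b) = 1"
  unfolding tail_coeff_def by (intro norm_word_prod) (auto simp: lam_unit)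

lemma qf_mono:
  assumes f: "f \<in> Fun" "tail N f" and g: "g \<in> Fun" "tail N g" and N: "N \<le> N'"
    and X: "sesq X" and "is": "set is \<subseteq> {1..k}" "distinct is"
  shows "qf N' is X b f g = qf N is X b f g"
  using X "is"
proof (induction "is" arbitrary: X b)
  case (Cons i "is")
  then have i: "i \<in> {1..k}" "i \<notin> set is" and X: "sesq X" by auto
  define G where "G m = (\<Sum>w\<in>words_less i m. qf N' is (D_form 1 i X) (b(i := w)) f g) +
     (\<Sum>w\<in>words_eq i m. qf N' is X (b(i := w)) f g)" for m
  \<comment> \<open>Words of length m pass from the form X to X - Phi_i X. What is lost, Phi_i X on
    these words, is returned by their one-letter extensions, on which both functions follow the tail
    rule.\<close>
  have step: "G (Suc m) = G m" if m: "m \<ge> N i" for m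
  proof -
    have "(\<Sum>w\<in>words_eq i (Suc m). qf N' is X (b(i := w)) f g) =
        (\<Sum>w\<in>words_eq i m. qf N' is (Phi_form i X) (b(i := w)) f g)"
      unfolding sum_words_eq_snoc
    proof (rule sum.cong[OF refl])
      fix w assume "w \<in> words_eq i m"
      then have w: "length w = m" by (simp add: words_eq_def)
      show "(\<Sum>s\<in>{1..n i}. qf N' is X (b(i := w @ [s])) f g) = qf N' is (Phi_form i X) (b(i := w)) f g"
        using tailD[OF f(2) i(1)] tailD[OF g(2) i(1)] w m
        by (intro qf_Phi[where d = "tail_coeff i", OF X f(1) g(1) i(2) tail_coeff_unit]) metis+
    qed
    moreover have "qf N' is (D_form 1 i X) c f g = qf N' is X c f g - qf N' is (Phi_form i X) c f g" for c
      using qf_diff_form[of N' "is" X "Phi_form i X"] by (simp add: D_form_def[abs_def])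
    ultimately show ?thesis unfolding G_def by (simp add: sum_words_less_Suc sum_subtractf)
  qed
  have "G (N' i) = G (N i)"
    using le_funD[OF N, of i] by (induction rule: dec_induct) (auto simp: step)
  moreover have "qf N (i # is) X b f g = G (N i)"
    unfolding G_def using Cons.IH[of "D_form 1 i X"] Cons.IH[of X] Cons.prems sesq_D by simp
  ultimately show ?case by (simp add: G_def)
qed simp

definition E :: "'a dilation_vec set" where
  "E = {f \<in> Fun. \<exists>N. tail N f}"

definition qE :: "'a dilation_vec \<Rightarrow> 'a dilation_vec \<Rightarrow> complex" where
  "qE f g = qf (SOME N. tail N f \<and> tail N g) [1..<Suc k] (hinner H) (\<lambda>_. []) f g"

lemma tail_common:
  assumes "tail N f" "tail M g"
  shows "tail (sup N M) f" "tail (sup N M) g"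
  using tail_mono[OF assms(1), of "sup N M"] tail_mono[OF assms(2), of "sup N M"] by simp_all

text \<open>Any two admissible boxes lie in their supremum, and \<open>qf_mono\<close> compares each
  of them with it; so the box chosen in \<open>qE\<close> is immaterial.\<close>

lemma qE_eq:
  assumes "f \<in> Fun" "g \<in> Fun" "tail N f" "tail N g"
  shows "qE f g = qf N [1..<Suc k] (hinner H) (\<lambda>_. []) f g"
proof -
  define M where "M = (SOME N. tail N f \<and> tail N g)"
  have M: "tail M f" "tail M g"
    unfolding M_def using someI[of "\<lambda>N. tail N f \<and> tail N g" N] assms by blast+
  have L: "set [1..<Suc k] \<subseteq> {1..k}" "distinct [1..<Suc k]" by auto
  show ?thesis unfolding qE_def M_def[symmetric]
    using qf_mono[OF assms(1) M(1) assms(2) M(2) sup_ge1[of M N] sesq_inner L]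
      qf_mono[OF assms(1,3) assms(2,4) sup_ge2[of N M] sesq_inner L] by (rule trans[OF sym])
qed

lemma tail_add:
  assumes "tail N f" "tail N g" and F: "f \<in> Fun" "g \<in> Fun"
  shows "tail N (f + g)"
  unfolding tail_def plus_fun_apply
proof (intro ballI allI impI)
  fix i s and b :: "nat \<Rightarrow> nat list"
  assume i: "i \<in> {1..k}" "s \<in> {1..n i}" and N: "N i \<le> length (b i)"
  from tailD[OF assms(1) i, of b, OF N] tailD[OF assms(2) i, of b, OF N]
  show "f (b(i := b i @ [s])) + g (b(i := b i @ [s])) =
      hscale H (tail_coeff i s b) (B i s (f b + g b))"
    by (simp only: B_add[OF FunD[OF F(1)] FunD[OF F(2)]] scale_right_distrib)
qed

lemma tail_scale:
  assumes "tail N f" and F: "f \<in> Fun"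
  shows "tail N (fscale c f)"
  unfolding tail_def fscale_def
proof (intro ballI allI impI)
  fix i s and b :: "nat \<Rightarrow> nat list"
  assume i: "i \<in> {1..k}" "s \<in> {1..n i}" and N: "N i \<le> length (b i)"
  from tailD[OF assms(1) i, of b, OF N]
  show "hscale H c (f (b(i := b i @ [s]))) = hscale H (tail_coeff i s b) (B i s (hscale H c (f b)))"
    by (simp only: B_scale[OF FunD[OF F]] scale_scale mult.commute)
qed

lemma fscale_vector_space: "vector_space fscale"
  by unfold_locales (auto simp: fscale_def fun_eq_iff scale_right_distrib scale_left_distrib)

lemma Fun_add: "\<lbrakk>f \<in> Fun; g \<in> Fun\<rbrakk> \<Longrightarrow> f + g \<in> Fun"
  by (simp add: Fun_def ip.S_add)

lemma Fun_scale: "f \<in> Fun \<Longrightarrow> fscale c f \<in> Fun"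
  by (simp add: Fun_def fscale_def ip.S_scale)

lemma B_zero: "B i s 0 = 0"
  using B_scale[OF ip.S_zero, of i s 0] by simp

lemma E_semi_inner: "semi_inner fscale E qE"
proof -
  interpret f: vector_space fscale by (rule fscale_vector_space)
  show ?thesis
  proof
    show "f.subspace E"
    proof (rule f.subspaceI)
      have "tail (\<lambda>_. 0) 0" unfolding tail_def zero_fun_apply by (simp add: B_zero)
      then show "0 \<in> E" unfolding E_def Fun_def using ip.S_zero by auto
      fix f g assume "f \<in> E" "g \<in> E"
      then obtain N M where NM: "tail N f" "tail M g" and F: "f \<in> Fun" "g \<in> Fun" by (auto simp: E_def)
      from tail_add[OF tail_common[OF NM] F] Fun_add[OF F] show "f + g \<in> E" unfolding E_def by blast
    next
      fix c f assume "f \<in> E"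
      then show "fscale c f \<in> E" using tail_scale[of _ f c] Fun_scale[of f c] by (auto simp: E_def)
    qed
    fix f g assume "f \<in> E" "g \<in> E"
    then obtain N M where NM: "tail N f" "tail M g" and F: "f \<in> Fun" "g \<in> Fun" by (auto simp: E_def)
    note t = tail_common[OF NM]
    show "qE (fscale c f) g = c * qE f g" for c
      using qE_eq[OF F t] qE_eq[OF Fun_scale[OF F(1)] F(2) tail_scale[OF t(1) F(1)] t(2)]
      by (simp add: qf_scale[OF sesq_inner F])
    show "qE g f = cnj (qE f g)"
      using qE_eq[OF F t] qE_eq[OF F(2,1) t(2,1)] qf_commute[OF sesq_inner F] by simp
    show "0 \<le> Re (qE f f)"
      using qE_eq[OF F(1,1) NM(1,1)] qf_nonneg[OF sesq_inner F(1) defect_pos] by simp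
    fix h assume "h \<in> E"
    then obtain L where L: "tail L h" "h \<in> Fun" by (auto simp: E_def)
    note tf = tail_common(1)[OF t(1) L(1)] tail_common[OF t(2) L(1)]
    show "qE (f + g) h = qE f h + qE g h"
      using qE_eq[OF Fun_add[OF F] L(2) tail_add[OF tf(1,2) F] tf(3)] qE_eq[OF F(1) L(2) tf(1,3)]
        qE_eq[OF F(2) L(2) tf(2,3)] qf_add[OF sesq_inner F L(2)] by simp
  qed
qed

end

section \<open>Weighted shifts\<close>

context lambda_model
begin

text \<open>Computing V_\<beta>^* V_(i,s) moves the adjoints of the blocks before \<open>i\<close>
  past V_(i,s). Each letter t of block j contributes the conjugate of \<open>lam j i t s\<close>,
  which is \<open>lam i j s t\<close>.\<close>

definition shift_coeff :: "nat \<Rightarrow> nat \<Rightarrow> (nat \<Rightarrow> nat list) \<Rightarrow> complex" where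
  "shift_coeff i s b = word_prod (\<lambda>j. lam i j s) b [1..<i]"

definition Sh :: "nat \<Rightarrow> nat \<Rightarrow> 'a dilation_vec \<Rightarrow> (nat \<Rightarrow> nat list) \<Rightarrow> 'a" where
  "Sh i s f b = (if b i \<noteq> [] \<and> hd (b i) = s
     then hscale H (shift_coeff i s b) (f (b(i := tl (b i)))) else 0)"

text \<open>The backward shift, adjoint to \<open>Sh i s\<close> for the form \<open>qE\<close>;
  hence the conjugate of the same scalar.\<close>

definition Bs :: "nat \<Rightarrow> nat \<Rightarrow> 'a dilation_vec \<Rightarrow> (nat \<Rightarrow> nat list) \<Rightarrow> 'a" where
  "Bs i s f b = hscale H (cnj (shift_coeff i s b)) (f (b(i := s # b i)))"

lemma word_prod_at:
  assumes "distinct js"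
  shows "word_prod \<mu> (b(j := u @ v)) js = (if j \<in> set js then \<Prod>t\<leftarrow>u. \<mu> j t else 1) * word_prod \<mu> (b(j := v)) js"
  using word_prod_append[OF assms] by simp

lemma shift_coeff_append:
  "j \<ge> 1 \<Longrightarrow> shift_coeff i s (b(j := t # v)) =
     (if j < i then lam i j s t else 1) * shift_coeff i s (b(j := v))"
  using word_prod_at[of "[1..<i]" "\<lambda>j. lam i j s" b j "[t]" v]
  by (simp add: shift_coeff_def del: fun_upd_apply)

lemma shift_coeff_snoc:
  assumes "j \<ge> 1"
  shows "shift_coeff i s (b(j := v @ [t])) = (if j < i then lam i j s t else 1) * shift_coeff i s (b(j := v))"
  using assms word_prod_at[of "[1..<i]" "\<lambda>j. lam i j s" b j v "[t]"]
    word_prod_at[of "[1..<i]" "\<lambda>j. lam i j s" b j "[t]" "[]"]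
    word_prod_at[of "[1..<i]" "\<lambda>j. lam i j s" b j v "[]"]
  by (simp add: shift_coeff_def del: fun_upd_apply)

lemma shift_coeff_self: "shift_coeff i s (b(i := v)) = shift_coeff i s b"
  by (simp add: shift_coeff_def del: fun_upd_apply)

lemma shift_coeff_unit: "cmod (shift_coeff i s b) = 1"
  unfolding shift_coeff_def by (intro norm_word_prod) (auto simp: lam_unit)

lemma shift_coeff_cnj: "cnj (shift_coeff i s b) * shift_coeff i s b = 1"
  using shift_coeff_unit[of i s b] complex_norm_square[of "shift_coeff i s b"] by (simp add: mult.commute)

lemma tail_coeff_Cons:
  "j \<in> {1..k} \<Longrightarrow> tail_coeff i s (b(j := t # v)) =
     (if i < j then cnj (lam i j s t) else 1) * tail_coeff i s (b(j := v))"
  using word_prod_at[of "[Suc i..<Suc k]" "\<lambda>j t. cnj (lam i j s t)" b j "[t]" v]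
  by (auto simp: tail_coeff_def simp del: fun_upd_apply upt_Suc)

lemma tail_coeff_self: "tail_coeff i s (b(i := v)) = tail_coeff i s b"
  by (simp add: tail_coeff_def del: fun_upd_apply upt_Suc)

lemma lam_mult_lam: "i \<noteq> j \<Longrightarrow> lam i j s t * lam j i t s = 1"
  using lam_sym[of i j t s] lam_unit[of i j s t] complex_norm_square[of "lam i j s t"] by simp

lemma Sh_Cons: "Sh i s f (b(i := t # w)) =
    (if t = s then hscale H (shift_coeff i s b) (f (b(i := w))) else 0)"
  by (simp add: Sh_def shift_coeff_self)

lemma Sh_Cons': "b i = t # w \<Longrightarrow> Sh i s f b =
    (if t = s then hscale H (shift_coeff i s b) (f (b(i := w))) else 0)"
  by (simp add: Sh_def)

lemma Sh_Fun: "f \<in> Fun \<Longrightarrow> Sh i s f \<in> Fun"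
  by (auto simp: Fun_def Sh_def intro: ip.S_scale ip.S_zero)

lemma Bs_Fun: "f \<in> Fun \<Longrightarrow> Bs i s f \<in> Fun"
  by (auto simp: Fun_def Bs_def intro: ip.S_scale)

lemma Sh_add: "Sh i s (f + g) = Sh i s f + Sh i s g"
  by (rule ext) (simp add: Sh_def scale_right_distrib)

lemma Sh_scale: "Sh i s (fscale c f) = fscale c (Sh i s f)"
  by (rule ext) (simp add: Sh_def fscale_def mult.commute)

lemma Bs_add: "Bs i s (f + g) = Bs i s f + Bs i s g"
  by (rule ext) (simp add: Bs_def scale_right_distrib)

lemma Bs_scale: "Bs i s (fscale c f) = fscale c (Bs i s f)"
  by (rule ext) (simp add: Bs_def fscale_def mult.commute)

lemma Sh_other:
  assumes "i \<noteq> j"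
  shows "Sh i s f (b(j := v)) = (if b i \<noteq> [] \<and> hd (b i) = s
     then hscale H (shift_coeff i s (b(j := v))) (f (b(j := v, i := tl (b i)))) else 0)"
  using assms by (simp add: Sh_def)

lemma upd_idem: "b i = u \<Longrightarrow> b(i := u) = b"
  by auto

text \<open>Only the shift with the larger coordinate sees the letter added by the other one. So
  exactly one factor appears, \<open>lam i j s t\<close> on the left or \<open>lam j i t s\<close>
  on the right, and these two are mutually inverse.\<close>

lemma Sh_Sh:
  assumes ij: "i \<noteq> j" and i: "i \<ge> 1" and j: "j \<ge> 1"
  shows "Sh i s (Sh j t f) = fscale (lam i j s t) (Sh j t (Sh i s f))"
proof
  fix b
  show "Sh i s (Sh j t f) b = fscale (lam i j s t) (Sh j t (Sh i s f)) b"
  proof (cases "b i \<noteq> [] \<and> hd (b i) = s \<and> b j \<noteq> [] \<and> hd (b j) = t")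
    case True
    then obtain w v where w: "b i = s # w" and v: "b j = t # v" by (metis list.collapse)
    have ji: "j \<noteq> i" using ij by simp
    have tw: "b(i := w, j := v) = b(j := v, i := w)" by (rule fun_upd_twist[OF ij])
    have 1: "shift_coeff i s b = (if j < i then lam i j s t else 1) * shift_coeff i s (b(j := v))"
      using shift_coeff_append[OF j, of i s b t v] upd_idem[of b j, OF v] by simp
    have 2: "shift_coeff j t b = (if i < j then lam j i t s else 1) * shift_coeff j t (b(i := w))"
      using shift_coeff_append[OF i, of j t b s w] upd_idem[of b i, OF w] by simp
    have "shift_coeff i s b * shift_coeff j t (b(i := w)) =
        lam i j s t * (shift_coeff j t b * shift_coeff i s (b(j := v)))"
      using 1 2 ij lam_mult_lam[OF ij, of s t] by (cases "j < i") (auto simp: mult_ac)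
    then show ?thesis
      using w v by (simp add: Sh_def fscale_def ij ji tw)
  next
    case False
    then show ?thesis using ij by (auto simp: Sh_def fscale_def)
  qed
qed

lemma Bs_Sh:
  assumes ij: "i \<noteq> j" and i: "i \<ge> 1" and j: "j \<ge> 1"
  shows "Bs i s (Sh j t f) = fscale (cnj (lam i j s t)) (Sh j t (Bs i s f))"
proof
  fix b
  show "Bs i s (Sh j t f) b = fscale (cnj (lam i j s t)) (Sh j t (Bs i s f)) b"
  proof (cases "b j \<noteq> [] \<and> hd (b j) = t")
    case True
    then obtain v where v: "b j = t # v" by (metis list.collapse)
    have ji: "j \<noteq> i" using ij by simp
    have tw: "b(i := s # b i, j := v) = b(j := v, i := s # b i)" by (rule fun_upd_twist[OF ij])
    have 1: "shift_coeff i s b = (if j < i then lam i j s t else 1) * shift_coeff i s (b(j := v))"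
      using shift_coeff_append[OF j, of i s b t v] upd_idem[of b j, OF v] by simp
    have 2: "shift_coeff j t (b(i := s # b i)) = (if i < j then lam j i t s else 1) * shift_coeff j t b"
      using shift_coeff_append[OF i, of j t b s "b i"] by simp
    have "cnj (shift_coeff i s b) * shift_coeff j t (b(i := s # b i)) =
        cnj (lam i j s t) * (shift_coeff j t b * cnj (shift_coeff i s (b(j := v))))"
      unfolding 1 2 using ij lam_sym[OF ij, of t s] by (cases "j < i") (auto simp: mult_ac)
    then show ?thesis
      using v by (simp add: Sh_def Bs_def fscale_def ij ji tw)
  next
    case False
    then show ?thesis using ij by (auto simp: Sh_def Bs_def fscale_def)
  qed
qed

lemma Bs_Sh_same: "Bs i s (Sh i t f) = (if s = t then f else 0)"
proof
  fix b
  have "Bs i s (Sh i t f) b = (if s = t then hscale H (cnj (shift_coeff i s b) * shift_coeff i s b) (f b) else 0)"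
    unfolding Bs_def Sh_Cons by simp
  then show "Bs i s (Sh i t f) b = (if s = t then f else 0) b" by (simp add: shift_coeff_cnj)
qed

text \<open>The bound grows by one in coordinate \<open>i\<close> because the shift strips the first
  letter before \<open>f\<close> is evaluated, and what remains must still have length
  \<open>N i\<close>. In the other coordinates the changes of \<open>shift_coeff\<close> and
  \<open>tail_coeff\<close> balance.\<close>

lemma tail_Sh:
  assumes f: "tail N f" and fF: "f \<in> Fun" and i: "i \<in> {1..k}"
  shows "tail (N(i := Suc (N i))) (Sh i s f)"
  unfolding tail_def
proof (intro ballI allI impI)
  fix j s' and b :: "nat \<Rightarrow> nat list"
  assume j: "j \<in> {1..k}" and s': "s' \<in> {1..n j}" and len: "(N(i := Suc (N i))) j \<le> length (b j)"
  show "Sh i s f (b(j := b j @ [s'])) = hscale H (tail_coeff j s' b) (B j s' (Sh i s f b))"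
  proof (cases "j = i")
    case True
    then have "b i \<noteq> []" "N i \<le> length (tl (b i))" using len by auto
    then obtain t w where w: "b i = t # w" and lw: "N i \<le> length w" by (cases "b i") auto
    have "f (b(i := w @ [s'])) = hscale H (tail_coeff i s' b) (B i s' (f (b(i := w))))"
      using tailD[OF f i, of s' "b(i := w)"] s' True lw by (simp add: tail_coeff_self)
    then show ?thesis unfolding True w append_Cons Sh_Cons Sh_Cons'[of b, OF w]
      by (simp add: B_scale FunD[OF fF] B_zero mult.commute)
  next
    case False
    then have ij: "i \<noteq> j" and j1: "j \<ge> 1" using j by auto
    show ?thesis
    proof (cases "b i \<noteq> [] \<and> hd (b i) = s")
      case True
      then obtain w where w: "b i = s # w" by (metis list.collapse)
      have tw: "b(j := b j @ [s'], i := w) = b(i := w, j := b j @ [s'])"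
        using fun_upd_twist[OF False] .
      have "f (b(i := w, j := b j @ [s'])) = hscale H (tail_coeff j s' (b(i := w))) (B j s' (f (b(i := w))))"
        using tailD[OF f j s', of "b(i := w)"] len False by simp
      moreover have "shift_coeff i s (b(j := b j @ [s'])) =
          (if j < i then lam i j s s' else 1) * shift_coeff i s b"
        using shift_coeff_snoc[OF j1, of i s b "b j" s'] by simp
      moreover have "tail_coeff j s' b = (if j < i then lam i j s s' else 1) * tail_coeff j s' (b(i := w))"
        using tail_coeff_Cons[OF i, of j s' b s w] upd_idem[of b i, OF w] lam_sym[OF False, of s s'] by simp
      ultimately show ?thesis
        unfolding Sh_other[OF ij] Sh_Cons'[of b, OF w]
        using w tw by (simp add: B_scale FunD[OF fF] mult_ac)
    next
      case nil: False
      then have "Sh i s f (b(j := b j @ [s'])) = 0" "Sh i s f b = 0"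
        unfolding Sh_other[OF ij] by (auto simp: Sh_def)
      then show ?thesis by (simp only: B_zero scale_zero_right)
    qed
  qed
qed

text \<open>The bound may stay the same: \<open>f\<close> is evaluated at a block that is one letter
  longer.\<close>

lemma tail_Bs:
  assumes f: "tail N f" and fF: "f \<in> Fun" and i: "i \<in> {1..k}"
  shows "tail N (Bs i s f)"
  unfolding tail_def
proof (intro ballI allI impI)
  fix j s' and b :: "nat \<Rightarrow> nat list"
  assume j: "j \<in> {1..k}" and s': "s' \<in> {1..n j}" and len: "N j \<le> length (b j)"
  show "Bs i s f (b(j := b j @ [s'])) = hscale H (tail_coeff j s' b) (B j s' (Bs i s f b))"
  proof (cases "j = i")
    case True
    have "f (b(i := (s # b i) @ [s'])) = hscale H (tail_coeff i s' b) (B i s' (f (b(i := s # b i))))"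
      using tailD[OF f i, of s' "b(i := s # b i)"] s' True len by (simp add: tail_coeff_self)
    then show ?thesis unfolding True Bs_def shift_coeff_self
      by (simp add: B_scale FunD[OF fF] mult.commute)
  next
    case False
    then have ij: "i \<noteq> j" and j1: "j \<ge> 1" using j by auto
    have tw: "b(j := b j @ [s'], i := s # b i) = b(i := s # b i, j := b j @ [s'])"
      using fun_upd_twist[OF False] .
    have 1: "f (b(i := s # b i, j := b j @ [s'])) =
        hscale H (tail_coeff j s' (b(i := s # b i))) (B j s' (f (b(i := s # b i))))"
      using tailD[OF f j s', of "b(i := s # b i)"] len False by simp
    have 2: "shift_coeff i s (b(j := b j @ [s'])) =
        (if j < i then lam i j s s' else 1) * shift_coeff i s b"
      using shift_coeff_snoc[OF j1, of i s b "b j" s'] by simp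
    have 3: "tail_coeff j s' (b(i := s # b i)) =
        (if j < i then cnj (lam j i s' s) else 1) * tail_coeff j s' b"
      using tail_coeff_Cons[OF i, of j s' b s "b i"] by simp
    have "cnj (lam i j s s') * cnj (lam j i s' s) = 1"
      using lam_mult_lam[OF ij, of s s'] by (metis complex_cnj_mult complex_cnj_one)
    then have "cnj (shift_coeff i s (b(j := b j @ [s']))) * tail_coeff j s' (b(i := s # b i)) =
        tail_coeff j s' b * cnj (shift_coeff i s b)"
      unfolding 2 3 by (cases "j < i") (auto simp: mult_ac)
    then show ?thesis
      unfolding Bs_def using tw 1 False ij by (simp add: B_scale FunD[OF fF])
  qed
qed

lemma Sh_E: "\<lbrakk>f \<in> E; i \<in> {1..k}\<rbrakk> \<Longrightarrow> Sh i s f \<in> E"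
  unfolding E_def using Sh_Fun tail_Sh by blast

lemma Bs_E: "\<lbrakk>f \<in> E; i \<in> {1..k}\<rbrakk> \<Longrightarrow> Bs i s f \<in> E"
  unfolding E_def using Bs_Fun tail_Bs by blast

section \<open>Adjointness of the shifts for the box form\<close>

lemma sum_words_Cons:
  fixes F :: "nat list \<Rightarrow> 'c::comm_monoid_add"
  assumes s: "s \<in> {1..n i}" and F: "\<And>w. \<nexists>v. w = s # v \<Longrightarrow> F w = 0"
  shows "sum F (words_less i (Suc m)) = (\<Sum>w\<in>words_less i m. F (s # w))"
    and "sum F (words_eq i (Suc m)) = (\<Sum>w\<in>words_eq i m. F (s # w))"
proof -
  have "sum F (words_less i (Suc m)) = sum F ((#) s ` words_less i m)"
  proof (rule sum.mono_neutral_right[OF finite_words_less])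
  qed (use s in \<open>auto simp: words_less_def intro!: F\<close>)
  then show "sum F (words_less i (Suc m)) = (\<Sum>w\<in>words_less i m. F (s # w))"
    by (simp add: sum.reindex)
  have "sum F (words_eq i (Suc m)) = sum F ((#) s ` words_eq i m)"
  proof (rule sum.mono_neutral_right[OF finite_words_eq])
  qed (use s in \<open>auto simp: words_eq_def intro!: F\<close>)
  then show "sum F (words_eq i (Suc m)) = (\<Sum>w\<in>words_eq i m. F (s # w))"
    by (simp add: sum.reindex)
qed

lemma sesq_zero:
  assumes "sesq X" "y \<in> hcarrier H"
  shows "X 0 y = 0"
  using sesq_scale[OF assms(1) ip.S_zero assms(2), of 0] by simp

text \<open>At every leaf the scalar of the shift moves to the second argument and becomes its
  conjugate, which is the factor in \<open>Bs\<close>.\<close>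

lemma qf_Sh_Cons:
  assumes "sesq X" "i \<notin> set is" and f: "f \<in> Fun" and g: "g \<in> Fun"
  shows "qf N is X (b(i := s # w)) (Sh i s f) g = qf N is X (b(i := w)) f (Bs i s g)"
  using assms(1,2)
proof (induction "is" arbitrary: X b)
  case Nil
  show ?case
    unfolding qf.simps Sh_Cons Bs_def
    by (simp add: shift_coeff_self sesq_scale[OF Nil(1) FunD[OF f] FunD[OF g]]
      sesq_scale_right[OF Nil(1) FunD[OF f] FunD[OF g]])
next
  case (Cons j js)
  then have ij: "i \<noteq> j" by auto
  have tw: "b(i := u, j := v) = b(j := v, i := u)" for u v by (rule fun_upd_twist[OF ij])
  have "qf N js Y (b(i := s # w, j := v)) (Sh i s f) g = qf N js Y (b(i := w, j := v)) f (Bs i s g)"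
    if "sesq Y" for Y v
    unfolding tw using Cons.prems(2) by (intro Cons.IH[OF that]) simp
  then show ?case using Cons.prems(1) sesq_D by (simp only: qf.simps)
qed

lemma qf_Sh_other:
  assumes "sesq X" "i \<notin> set is" and g: "g \<in> Fun" and w: "\<nexists>v. w = s # v"
  shows "qf N is X (b(i := w)) (Sh i s f) g = 0"
  using assms(1,2)
proof (induction "is" arbitrary: X b)
  case Nil
  have "Sh i s f (b(i := w)) = 0" using w by (cases w) (auto simp: Sh_def)
  then show ?case by (simp only: qf.simps sesq_zero[OF Nil(1) FunD[OF g]])
next
  case (Cons j js)
  then have ij: "i \<noteq> j" by auto
  have tw: "b(i := u, j := v) = b(j := v, i := u)" for u v by (rule fun_upd_twist[OF ij])
  have "qf N js Y (b(i := w, j := v)) (Sh i s f) g = 0" if "sesq Y" for Y v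
    unfolding tw using Cons.prems(2) by (intro Cons.IH[OF that]) simp
  then show ?case using Cons.prems(1) sesq_D by (simp only: qf.simps sum.neutral_const add_0)
qed

text \<open>Prepending \<open>s\<close> maps the words of the box onto those words of the enlarged
  box that begin with \<open>s\<close>, and the shifted function vanishes on the rest. Maximal words
  go to maximal words, so the defects match; this is why the box on the left is one longer in
  coordinate \<open>i\<close>.\<close>

lemma qf_adjoint:
  assumes "sesq X" "i \<in> set is" "distinct is" and f: "f \<in> Fun" and g: "g \<in> Fun" and s: "s \<in> {1..n i}"
  shows "qf (N(i := Suc (N i))) is X b (Sh i s f) g = qf N is X b f (Bs i s g)"
  using assms(1-3)
proof (induction "is" arbitrary: X b)
  case (Cons j js)
  show ?case
  proof (cases "i = j")
    case True
    then have i: "i \<notin> set js" using Cons.prems by auto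
    have z: "qf N js Y (b(i := w)) (Sh i s f) g = 0" if "sesq Y" "\<nexists>v. w = s # v" for Y w
      using qf_Sh_other[OF that(1) i g that(2)] .
    have "(\<Sum>w\<in>words_less i (Suc m). qf N js Y (b(i := w)) (Sh i s f) g) =
        (\<Sum>w\<in>words_less i m. qf N js Y (b(i := w)) f (Bs i s g))"
      "(\<Sum>w\<in>words_eq i (Suc m). qf N js Y (b(i := w)) (Sh i s f) g) =
        (\<Sum>w\<in>words_eq i m. qf N js Y (b(i := w)) f (Bs i s g))" if "sesq Y" for Y m
      using sum_words_Cons[of s i "\<lambda>w. qf N js Y (b(i := w)) (Sh i s f) g" m, OF s z[OF that]]
        qf_Sh_Cons[OF that i f g] by simp_all
    then show ?thesis
      using Cons.prems(1) sesq_D by (simp only: True[symmetric] qf.simps qf_upd_N[OF i] fun_upd_same)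
  next
    case False
    then have IH: "qf (N(i := Suc (N i))) js Y c (Sh i s f) g = qf N js Y c f (Bs i s g)" if "sesq Y" for Y c
      using False Cons.prems by (intro Cons.IH[OF that]) simp_all
    have Nj: "(N(i := Suc (N i))) j = N j" using False by simp
    show ?thesis
      unfolding qf.simps Nj IH[OF Cons.prems(1)] IH[OF sesq_D[OF Cons.prems(1)]] ..
  qed
qed simp

lemma qE_adjoint:
  assumes f: "f \<in> E" and g: "g \<in> E" and i: "i \<in> {1..k}" and s: "s \<in> {1..n i}"
  shows "qE (Sh i s f) g = qE f (Bs i s g)"
proof -
  obtain N M where NM: "tail N f" "tail M g" and F: "f \<in> Fun" "g \<in> Fun" using f g by (auto simp: E_def)
  define L where "L = sup N M"
  have L: "tail L f" "tail L g" unfolding L_def by (rule tail_common[OF NM])+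
  have L': "L \<le> L(i := Suc (L i))" by (simp add: le_fun_def)
  have "i \<in> set [1..<Suc k]" "distinct [1..<Suc k]" using i by auto
  from qf_adjoint[OF sesq_inner this F s]
  have "qf (L(i := Suc (L i))) [1..<Suc k] (hinner H) (\<lambda>_. []) (Sh i s f) g =
      qf L [1..<Suc k] (hinner H) (\<lambda>_. []) f (Bs i s g)" .
  then show ?thesis
    unfolding qE_eq[OF Sh_Fun[OF F(1)] F(2) tail_Sh[OF L(1) F(1) i] tail_mono[OF L(2) L']]
      qE_eq[OF F(1) Bs_Fun[OF F(2)] L(1) tail_Bs[OF L(2) F(2) i]] .
qed

section \<open>The embedding of the given space into the model\<close>

definition J0 :: "'a \<Rightarrow> (nat \<Rightarrow> nat list) \<Rightarrow> 'a" where
  "J0 h b = fold (\<lambda>i. fold (B i) (b i)) [1..<Suc k] h"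

abbreviation Bw :: "nat list \<Rightarrow> (nat \<Rightarrow> nat list) \<Rightarrow> 'a \<Rightarrow> 'a" where
  "Bw js b \<equiv> fold (\<lambda>i. fold (B i) (b i)) js"

lemma fold_B_mem: "x \<in> hcarrier H \<Longrightarrow> fold (B i) w x \<in> hcarrier H"
  by (induction w arbitrary: x) (auto simp: B_mem)

lemma Bw_mem: "x \<in> hcarrier H \<Longrightarrow> Bw js b x \<in> hcarrier H"
  by (induction js arbitrary: x) (auto simp: fold_B_mem)

lemma fold_B_add: "\<lbrakk>x \<in> hcarrier H; y \<in> hcarrier H\<rbrakk> \<Longrightarrow> fold (B i) w (x + y) = fold (B i) w x + fold (B i) w y"
  by (induction w arbitrary: x y) (auto simp: B_add B_mem)

lemma fold_B_scale: "x \<in> hcarrier H \<Longrightarrow> fold (B i) w (hscale H c x) = hscale H c (fold (B i) w x)"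
  by (induction w arbitrary: x) (auto simp: B_scale B_mem)

lemma Bw_add: "\<lbrakk>x \<in> hcarrier H; y \<in> hcarrier H\<rbrakk> \<Longrightarrow> Bw js b (x + y) = Bw js b x + Bw js b y"
  by (induction js arbitrary: x y) (auto simp: fold_B_add fold_B_mem)

lemma Bw_scale: "x \<in> hcarrier H \<Longrightarrow> Bw js b (hscale H c x) = hscale H c (Bw js b x)"
  by (induction js arbitrary: x) (auto simp: fold_B_scale fold_B_mem)

lemma B_fold_B:
  assumes "i \<noteq> j" "x \<in> hcarrier H"
  shows "B i s (fold (B j) w x) = hscale H (\<Prod>t\<leftarrow>w. lam i j s t) (fold (B j) w (B i s x))"
  using assms(2)
proof (induction w arbitrary: x)
  case (Cons t w)
  have "B i s (fold (B j) (t # w) x) = hscale H (\<Prod>t\<leftarrow>w. lam i j s t) (fold (B j) w (B i s (B j t x)))"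
    using Cons.IH[OF B_mem[of j t x]] by simp
  then show ?case by (simp add: B_comm[OF assms(1)] fold_B_scale B_mem mult.commute)
qed simp

lemma B_Bw:
  assumes "i \<notin> set js" "x \<in> hcarrier H"
  shows "B i s (Bw js b x) = hscale H (word_prod (\<lambda>j. lam i j s) b js) (Bw js b (B i s x))"
  using assms
proof (induction js arbitrary: x)
  case (Cons j js)
  have "B i s (Bw (j # js) b x) = hscale H (word_prod (\<lambda>j. lam i j s) b js) (Bw js b (B i s (fold (B j) (b j) x)))"
    using Cons.IH[OF _ fold_B_mem[OF Cons.prems(2)]] Cons.prems by simp
  then show ?case using Cons.prems by (simp add: B_fold_B Bw_scale fold_B_mem B_mem mult.commute)
qed simp

lemma Bw_upd: "i \<notin> set js \<Longrightarrow> Bw js (b(i := w)) = Bw js b"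
  by (induction js) (auto simp: fun_eq_iff)

lemma J0_split:
  "i \<in> {1..k} \<Longrightarrow> J0 h b = Bw [Suc i..<Suc k] b (fold (B i) (b i) (Bw [1..<i] b h))"
  using upt_split[of i k] by (simp add: J0_def del: upt_Suc)

lemma J0_split_upd:
  assumes "i \<in> {1..k}"
  shows "J0 h (b(i := w)) = Bw [Suc i..<Suc k] b (fold (B i) w (Bw [1..<i] b h))"
  unfolding J0_split[OF assms] fun_upd_same using Bw_upd[of i _ b w] by simp

lemma J0_Fun: "h \<in> hcarrier H \<Longrightarrow> J0 h \<in> Fun"
  by (simp add: Fun_def J0_def Bw_mem del: upt_Suc)

lemma J0_add: "\<lbrakk>h \<in> hcarrier H; h' \<in> hcarrier H\<rbrakk> \<Longrightarrow> J0 (h + h') = J0 h + J0 h'"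
  by (rule ext) (simp add: J0_def Bw_add del: upt_Suc)

lemma J0_scale: "h \<in> hcarrier H \<Longrightarrow> J0 (hscale H c h) = fscale c (J0 h)"
  by (rule ext) (simp add: J0_def Bw_scale fscale_def del: upt_Suc)

text \<open>This is the dilation identity V^* h = T^* h at the level of functions. Bringing the
  adjoint of \<open>s\<close> in front of the blocks before \<open>i\<close> produces
  \<open>shift_coeff\<close>, which its conjugate in \<open>Bs\<close> cancels.\<close>

lemma Bs_J0:
  assumes h: "h \<in> hcarrier H" and i: "i \<in> {1..k}"
  shows "Bs i s (J0 h) = J0 (B i s h)"
proof
  fix b
  have "J0 h (b(i := s # b i)) = hscale H (shift_coeff i s b) (J0 (B i s h) b)"
    unfolding J0_split_upd[OF i] J0_split[OF i, of "B i s h" b] fold_simps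
    by (simp add: B_Bw[OF _ h] shift_coeff_def fold_B_scale Bw_scale Bw_mem fold_B_mem B_mem del: upt_Suc)
  then show "Bs i s (J0 h) b = J0 (B i s h) b"
    unfolding Bs_def by (simp add: shift_coeff_cnj)
qed

text \<open>The tail rule holds from length zero on, so the box for these functions consists of the
  empty multi-word alone; hence \<open>J0\<close> is isometric.\<close>

lemma tail_J0:
  assumes h: "h \<in> hcarrier H"
  shows "tail (\<lambda>_. 0) (J0 h)"
  unfolding tail_def
proof (intro ballI allI impI)
  fix i s and b :: "nat \<Rightarrow> nat list"
  assume i: "i \<in> {1..k}"
  define z where "z = fold (B i) (b i) (Bw [1..<i] b h)"
  have z: "z \<in> hcarrier H" by (simp add: z_def fold_B_mem Bw_mem h)
  have 1: "J0 h (b(i := b i @ [s])) = Bw [Suc i..<Suc k] b (B i s z)"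
    unfolding J0_split_upd[OF i] z_def by simp
  have 2: "B i s (J0 h b) = hscale H (cnj (tail_coeff i s b)) (Bw [Suc i..<Suc k] b (B i s z))"
    unfolding J0_split[OF i] z_def[symmetric] using B_Bw[OF _ z, of i "[Suc i..<Suc k]" s b]
    by (simp add: tail_coeff_def cnj_word_prod del: upt_Suc)
  have "tail_coeff i s b * cnj (tail_coeff i s b) = 1"
    using tail_coeff_unit[of i s b] complex_norm_square[of "tail_coeff i s b"] by simp
  then show "J0 h (b(i := b i @ [s])) = hscale H (tail_coeff i s b) (B i s (J0 h b))"
    unfolding 1 2 by simp
qed

lemma J0_E: "h \<in> hcarrier H \<Longrightarrow> J0 h \<in> E"
  unfolding E_def using J0_Fun tail_J0 by blast

lemma qf_0: "qf (\<lambda>_. 0) is X (\<lambda>_. []) f g = X (f (\<lambda>_. [])) (g (\<lambda>_. []))"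
proof (induction "is" arbitrary: X)
  case (Cons i "is")
  have "(\<lambda>_. [])(i := []) = (\<lambda>_. [] :: nat list)" by auto
  then show ?case using Cons.IH by (simp del: fun_upd_apply)
qed simp

lemma Bw_Nil: "Bw js (\<lambda>_. []) h = h"
  by (induction js) auto

lemma qE_J0: "\<lbrakk>h \<in> hcarrier H; h' \<in> hcarrier H\<rbrakk> \<Longrightarrow> qE (J0 h) (J0 h') = hinner H h h'"
  using Bw_Nil[of "[1..<Suc k]" h] Bw_Nil[of "[1..<Suc k]" h']
  by (simp only: qE_eq[OF J0_Fun J0_Fun tail_J0 tail_J0] qf_0 J0_def)

section \<open>The minimal dilation\<close>

sublocale fs: vector_space fscale
  by (rule fscale_vector_space)

lemma system: "lambda_system fscale E k n lam Sh Bs"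
proof -
  interpret semi_inner fscale E qE by (rule E_semi_inner)
  show ?thesis
  proof
    fix i s j t f assume "i \<in> {1..k}" "j \<in> {1..k}" "i \<noteq> j"
    then show "Sh i s (Sh j t f) = fscale (lam i j s t) (Sh j t (Sh i s f))"
      "Bs i s (Sh j t f) = fscale (cnj (lam i j s t)) (Sh j t (Bs i s f))"
      by (intro Sh_Sh Bs_Sh; simp)+
  qed (use S_scale Sh_E Bs_E Sh_scale Bs_Sh_same in auto)
qed

sublocale ls: lambda_system fscale E k n lam Sh Bs
  by (rule system)

text \<open>\<open>completion\<close> indexes its generators by a whole type; the value 0 off the
  valid multi-words adds nothing to their span.\<close>

definition gen :: "(nat \<Rightarrow> nat list) \<Rightarrow> 'a \<Rightarrow> (nat \<Rightarrow> nat list) \<Rightarrow> 'a" where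
  "gen \<alpha> h = (if \<alpha> \<in> multi_words k n then multiword_op k Sh \<alpha> (J0 h) else 0)"

text \<open>Restricting to this span builds in the spanning hypothesis of \<open>completion\<close>,
  which later becomes minimality of the dilation.\<close>

definition E0 :: "'a dilation_vec set" where
  "E0 = fs.span (\<Union>\<alpha>. gen \<alpha> ` hcarrier H)"

lemma word_Sh_add: "word_op (Sh i) w (f + g) = word_op (Sh i) w f + word_op (Sh i) w g"
  unfolding word_op_def by (induction w) (simp_all only: foldr.simps o_apply id_apply Sh_add)

lemma words_Sh_add: "ls.words_op js \<alpha> (f + g) = ls.words_op js \<alpha> f + ls.words_op js \<alpha> g"
  by (induction js) (simp_all only: foldr.simps o_apply id_apply word_Sh_add)

lemma gen_add: "\<lbrakk>h \<in> hcarrier H; h' \<in> hcarrier H\<rbrakk> \<Longrightarrow> gen \<alpha> (h + h') = gen \<alpha> h + gen \<alpha> h'"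
  unfolding gen_def multiword_op_def by (simp only: J0_add words_Sh_add if_distrib add_0 split: if_split) simp

lemma gen_scale: "h \<in> hcarrier H \<Longrightarrow> gen \<alpha> (hscale H c h) = fscale c (gen \<alpha> h)"
proof (cases "\<alpha> \<in> multi_words k n")
  case True
  moreover assume h: "h \<in> hcarrier H"
  have "set [1..<Suc k] \<subseteq> {1..k}" by auto
  from ls.words_scale[OF this True J0_E[OF h]]
  show ?thesis using True unfolding gen_def multiword_op_def by (simp only: J0_scale[OF h] if_True)
qed (simp only: gen_def if_False fs.scale_zero_right)

lemma gen_E: "h \<in> hcarrier H \<Longrightarrow> gen \<alpha> h \<in> E"
  using ls.multiword_mem[OF _ J0_E] semi_inner.S_zero[OF E_semi_inner] by (simp only: gen_def split: if_split) blast

lemma E0_sub: "E0 \<subseteq> E"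
  unfolding E0_def
  by (rule fs.span_minimal) (use gen_E semi_inner.subspace_S[OF E_semi_inner] in auto)

lemma E0_semi_inner: "semi_inner fscale E0 qE"
proof -
  interpret semi_inner fscale E qE by (rule E_semi_inner)
  note sub = subsetD[OF E0_sub]
  show ?thesis
    by unfold_locales (simp_all only: E0_def[symmetric] fs.subspace_span[of "\<Union>\<alpha>. gen \<alpha> ` hcarrier H", folded E0_def]
      q_add[OF sub sub sub] q_scale[OF sub sub] q_nonneg[OF sub] q_commute[OF sub sub, symmetric])
qed

lemma gen_E0: "h \<in> hcarrier H \<Longrightarrow> gen \<alpha> h \<in> E0"
  unfolding E0_def by (rule fs.span_base) blast

lemma E0_preserved:
  assumes add: "\<And>f g. A (f + g) = A f + A g" and scale: "\<And>c f. A (fscale c f) = fscale c (A f)"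
    and gen: "\<And>\<alpha> h. \<lbrakk>\<alpha> \<in> multi_words k n; h \<in> hcarrier H\<rbrakk> \<Longrightarrow> A (gen \<alpha> h) \<in> E0" and f: "f \<in> E0"
  shows "A f \<in> E0"
proof -
  have A0: "A 0 = 0" using scale[of 0 0] by (simp only: fs.scale_zero_left)
  have gen': "A (gen \<alpha> h) \<in> E0" if h: "h \<in> hcarrier H" for \<alpha> h
  proof (cases "\<alpha> \<in> multi_words k n")
    case False
    then have "gen \<alpha> h = 0" by (simp only: gen_def if_False)
    then show ?thesis using A0 fs.span_zero by (simp only: E0_def)
  qed (use gen h in blast)
  show ?thesis using f unfolding E0_def
  proof (induction rule: fs.span_induct_alt)
    case base
    show ?case unfolding A0 by (rule fs.span_zero)
  next
    case (step c v y)
    then obtain \<alpha> h where "v = gen \<alpha> h" "h \<in> hcarrier H" by blast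
    then have "A v \<in> fs.span (\<Union>\<alpha>. gen \<alpha> ` hcarrier H)" using gen' by (simp only: E0_def)
    then show ?case unfolding add scale using step.IH by (intro fs.span_add fs.span_scale)
  qed
qed

lemma Sh_E0:
  assumes i: "i \<in> {1..k}" and s: "s \<in> {1..n i}" and f: "f \<in> E0"
  shows "Sh i s f \<in> E0"
proof (rule E0_preserved[of "Sh i s", OF Sh_add Sh_scale _ f])
  fix \<alpha> h assume \<alpha>: "\<alpha> \<in> multi_words k n" and h: "h \<in> hcarrier H"
  have "\<alpha>(i := s # \<alpha> i) \<in> multi_words k n"
    using s multi_wordsD[OF \<alpha> i] by (intro ls.multi_words_upd[OF \<alpha>]) simp
  then show "Sh i s (gen \<alpha> h) \<in> E0"
    using ls.V_multiword[OF i s \<alpha> J0_E[OF h]] gen_E0[OF h, of "\<alpha>(i := s # \<alpha> i)"] \<alpha> fs.span_scale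
    unfolding E0_def gen_def by (simp only: if_True)
qed

text \<open>Together with \<open>Sh_E0\<close> this lets both the shift and its adjoint be extended
  to the completion. When \<open>Bs\<close> finds no letter to remove it reaches
  \<open>J0 h\<close>, and \<open>Bs_J0\<close> keeps the result among the generators.\<close>

lemma Bs_E0:
  assumes i: "i \<in> {1..k}" and s: "s \<in> {1..n i}" and f: "f \<in> E0"
  shows "Bs i s f \<in> E0"
proof (rule E0_preserved[of "Bs i s", OF Bs_add Bs_scale _ f])
  fix \<alpha> h assume \<alpha>: "\<alpha> \<in> multi_words k n" and h: "h \<in> hcarrier H"
  have g: "gen \<alpha> h = multiword_op k Sh \<alpha> (J0 h)" using \<alpha> by (simp only: gen_def if_True)
  show "Bs i s (gen \<alpha> h) \<in> E0"
  proof (cases "\<alpha> i")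
    case Nil
    have "gen \<alpha> (B i s h) = multiword_op k Sh \<alpha> (J0 (B i s h))" using \<alpha> by (simp only: gen_def if_True)
    then show ?thesis
      using gen_E0[OF B_mem, of \<alpha> i s h] fs.span_scale
      unfolding g ls.W_multiword_Nil[OF i s \<alpha> J0_E[OF h] Nil] Bs_J0[OF h i] E0_def by (simp only:)
  next
    case (Cons t w)
    have w: "\<alpha>(i := w) \<in> multi_words k n"
      using multi_wordsD[OF \<alpha> i] Cons by (intro ls.multi_words_upd[OF \<alpha>]) simp
    then have "gen (\<alpha>(i := w)) h = multiword_op k Sh (\<alpha>(i := w)) (J0 h)" by (simp only: gen_def if_True)
    then show ?thesis
      using gen_E0[OF h, of "\<alpha>(i := w)"] fs.span_scale fs.span_zero
      unfolding g ls.W_multiword_Cons[OF i s \<alpha> J0_E[OF h] Cons] E0_def by (simp only: split: if_split) simp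
  qed
qed

lemma Sh_norm:
  assumes i: "i \<in> {1..k}" and s: "s \<in> {1..n i}" and f: "f \<in> E"
  shows "qnorm qE (Sh i s f) = qnorm qE f"
  unfolding qnorm_def using qE_adjoint[OF f Sh_E[OF f i] i s] Bs_Sh_same[of i s s f] by simp

lemma Bs_norm:
  assumes i: "i \<in> {1..k}" and s: "s \<in> {1..n i}" and f: "f \<in> E"
  shows "qnorm qE (Bs i s f) \<le> 1 * qnorm qE f"
proof -
  interpret semi_inner fscale E qE by (rule E_semi_inner)
  have Bf: "Bs i s f \<in> E" "Sh i s (Bs i s f) \<in> E" using Sh_E Bs_E i f by blast+
  have "(nrm (Bs i s f))\<^sup>2 = Re (qE (Sh i s (Bs i s f)) f)"
    using qE_adjoint[OF Bf(1) f i s] nrm_sq[OF Bf(1)] by simp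
  also have "\<dots> \<le> nrm (Sh i s (Bs i s f)) * nrm f"
    using cauchy_schwarz[OF Bf(2) f] complex_Re_le_cmod order_trans by blast
  also have "\<dots> = nrm (Bs i s f) * nrm f" using Sh_norm[OF i s Bf(1)] by simp
  finally have "nrm (Bs i s f) * nrm (Bs i s f) \<le> nrm (Bs i s f) * nrm f" by (simp add: power2_eq_square)
  then show ?thesis using nrm_nonneg[OF Bf(1)] nrm_nonneg[OF f]
    by (cases "nrm (Bs i s f) = 0") (auto simp: mult_le_cancel_left)
qed

lemma gen_norm:
  assumes h: "h \<in> hcarrier H"
  shows "qnorm qE (gen \<alpha> h) \<le> 1 * hnorm H h"
proof (cases "\<alpha> \<in> multi_words k n")
  case True
  have "gen \<alpha> h \<in> E \<and> qnorm qE (gen \<alpha> h) = qnorm qE (J0 h)"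
    unfolding gen_def if_P[OF True]
    by (rule multiword_rel[where R = "\<lambda>f _. f \<in> E \<and> qnorm qE f = qnorm qE (J0 h)", OF _ True])
      (use Sh_E Sh_norm J0_E[OF h] in auto)
  then show ?thesis by (simp add: qnorm_def hnorm_def qE_J0[OF h h])
next
  case False
  then have "qnorm qE (gen \<alpha> h) = 0"
    using semi_inner.nrm_zero[OF E_semi_inner] by (simp only: gen_def if_False)
  then show ?thesis using ip.nrm_nonneg[OF h] by simp
qed

sublocale cp: completion fscale E0 qE H gen
proof (intro completion.intro E0_semi_inner completion_axioms.intro)
  show "hilbert_space H" by unfold_locales
  show "\<exists>C. \<forall>h\<in>hcarrier H. qnorm qE (gen a h) \<le> C * hnorm H h" for a using gen_norm by blast
  show "E0 \<subseteq> fs.span (\<Union>a. gen a ` hcarrier H)" by (simp only: E0_def)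
qed (erule gen_E0 gen_add gen_scale; assumption?)+

end

context lambda_model
begin

lemma gen_empty: "gen (\<lambda>_. []) h = J0 h"
proof -
  have "ls.words_op js (\<lambda>_. []) f = f" for js f
    by (induction js) (simp_all add: word_op_def)
  moreover have "(\<lambda>_. []) \<in> multi_words k n" by (simp add: multi_words_def)
  ultimately show ?thesis by (simp only: gen_def multiword_op_def if_True)
qed

lemma bounded_on_Sh:
  assumes "i \<in> {1..k}" "s \<in> {1..n i}"
  shows "cp.bounded_on (Sh i s)"
  unfolding cp.bounded_on_def
proof (intro conjI)
  show "\<exists>C. \<forall>x\<in>E0. qnorm qE (Sh i s x) \<le> C * qnorm qE x"
    using Sh_norm[OF assms] E0_sub by (intro exI[of _ 1]) auto
qed (use Sh_E0[OF assms] Sh_add Sh_scale in blast)+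

lemma bounded_on_Bs:
  assumes "i \<in> {1..k}" "s \<in> {1..n i}"
  shows "cp.bounded_on (Bs i s)"
  unfolding cp.bounded_on_def
proof (intro conjI)
  show "\<exists>C. \<forall>x\<in>E0. qnorm qE (Bs i s x) \<le> C * qnorm qE x"
    using Bs_norm[OF assms] E0_sub by (intro exI[of _ 1]) auto
qed (use Bs_E0[OF assms] Bs_add Bs_scale in blast)+

lemma bounded_on_id: "cp.bounded_on (\<lambda>f. f)"
  unfolding cp.bounded_on_def by (auto intro: exI[of _ 1])

lemma ext_id: "F \<in> hcarrier cp.K \<Longrightarrow> cp.ext (\<lambda>f. f) F = F"
  using cp.approx_unique[OF cp.ext_approx[OF bounded_on_id cp.rep_approx] cp.rep_approx] .

lemma multiword_emb:
  assumes \<alpha>: "\<alpha> \<in> multi_words k n" and f: "f \<in> E0"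
  shows "multiword_op k (\<lambda>i s. cp.ext (Sh i s)) \<alpha> (cp.emb f) = cp.emb (multiword_op k Sh \<alpha> f)"
proof -
  have "multiword_op k Sh \<alpha> f \<in> E0 \<and>
      multiword_op k (\<lambda>i s. cp.ext (Sh i s)) \<alpha> (cp.emb f) = cp.emb (multiword_op k Sh \<alpha> f)"
    by (rule multiword_rel[where R = "\<lambda>F f. f \<in> E0 \<and> F = cp.emb f", OF _ \<alpha>])
      (use Sh_E0 cp.ext_emb[OF bounded_on_Sh] f in auto)
  then show ?thesis by blast
qed

lemma model_dilation:
  assumes TB: "\<And>i s h. \<lbrakk>i \<in> {1..k}; s \<in> {1..n i}; h \<in> hcarrier H\<rbrakk> \<Longrightarrow> adj H (T i s) h = B i s h"
  shows "minimal_dilation k n lam H T cp.K (\<lambda>h. cp.emb (J0 h)) (\<lambda>i s. cp.ext (Sh i s))"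
proof -
  define J where "J h = cp.emb (J0 h)" for h
  define V where "V i s = cp.ext (Sh i s)" for i s
  interpret k: hilbert_space cp.K by (rule cp.K_hilbert)
  have J0E: "J0 h \<in> E0" if "h \<in> hcarrier H" for h
    using gen_E0[OF that, of "\<lambda>_. []"] by (simp only: gen_empty)
  have adjV: "adj cp.K (V i s) x = cp.ext (Bs i s) x"
    if "i \<in> {1..k}" "s \<in> {1..n i}" "x \<in> hcarrier cp.K" for i s x
    unfolding V_def using that E0_sub
    by (intro cp.ext_adj bounded_on_Sh bounded_on_Bs qE_adjoint) auto
  have Jmem: "J h \<in> hcarrier cp.K" if "h \<in> hcarrier H" for h
    unfolding J_def using cp.emb_mem[OF J0E[OF that]] .
  have "isometric_map H cp.K J"
    unfolding isometric_map_def linear_map_def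
  proof (intro conjI ballI allI)
    show "J \<in> hcarrier H \<rightarrow> hcarrier cp.K" using Jmem by blast
    fix x assume x: "x \<in> hcarrier H"
    show "J (hscale H c x) = hscale cp.K c (J x)" for c
      unfolding J_def J0_scale[OF x] using cp.emb_scale[OF J0E[OF x]] .
    fix y assume y: "y \<in> hcarrier H"
    show "J (x + y) = J x + J y"
      unfolding J_def J0_add[OF x y] using cp.emb_add[OF J0E[OF x] J0E[OF y]] .
    show "hinner cp.K (J x) (J y) = hinner H x y"
      unfolding J_def using cp.emb_inner[OF J0E[OF x] J0E[OF y]] qE_J0[OF x y] by simp
  qed
  moreover have "row_isometry cp.K (n i) (V i)" if i: "i \<in> {1..k}" for i
    unfolding row_isometry_def
  proof (intro conjI ballI)
    show "bounded_operator cp.K (V i s)" if "s \<in> {1..n i}" for s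
      unfolding V_def using cp.ext_bounded[OF bounded_on_Sh[OF i that]] .
    fix s t x assume s: "s \<in> {1..n i}" and t: "t \<in> {1..n i}" and x: "x \<in> hcarrier cp.K"
    have Vx: "V i t x \<in> hcarrier cp.K" unfolding V_def using cp.ext_mem[OF bounded_on_Sh[OF i t] x] .
    \<comment> \<open>Both cases are written as a scalar multiple of the identity, the shape that
      \<open>ext_comp_eq\<close> transports.\<close>
    have "Bs i s (Sh i t f) = fscale (if s = t then 1 else 0) f" for f
      unfolding Bs_Sh_same by simp
    from cp.ext_comp_eq[OF bounded_on_Bs[OF i s] bounded_on_Sh[OF i t] bounded_on_id bounded_on_id this x]
    have "cp.ext (Bs i s) (V i t x) = hscale cp.K (if s = t then 1 else 0) x"
      unfolding V_def ext_id[OF x] .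
    then show "adj cp.K (V i s) (V i t x) = (if s = t then x else 0)"
      unfolding adjV[OF i s Vx] by simp
  qed
  moreover have "doubly_commuting k n lam cp.K V"
    unfolding doubly_commuting_def
  proof (intro ballI impI)
    fix i j s t x assume i: "i \<in> {1..k}" and j: "j \<in> {1..k}" and ij: "i \<noteq> j"
      and s: "s \<in> {1..n i}" and t: "t \<in> {1..n j}" and x: "x \<in> hcarrier cp.K"
    have Vx: "V j t x \<in> hcarrier cp.K" unfolding V_def using cp.ext_mem[OF bounded_on_Sh[OF j t] x] .
    have "Bs i s (Sh j t f) = fscale (cnj (lam i j s t)) (Sh j t (Bs i s f))" for f
      using i j by (intro Bs_Sh[OF ij]) auto
    from cp.ext_comp_eq[OF bounded_on_Bs[OF i s] bounded_on_Sh[OF j t]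
        bounded_on_Sh[OF j t] bounded_on_Bs[OF i s] this x]
    show "adj cp.K (V i s) (V j t x) = hscale cp.K (cnj (lam i j s t)) (V j t (adj cp.K (V i s) x))"
      unfolding adjV[OF i s Vx] adjV[OF i s x] unfolding V_def .
  qed
  moreover have "adj cp.K (V i s) (J h) = J (adj H (T i s) h)"
    if i: "i \<in> {1..k}" and s: "s \<in> {1..n i}" and h: "h \<in> hcarrier H" for i s h
    unfolding adjV[OF i s Jmem[OF h]] TB[OF i s h] unfolding J_def
      cp.ext_emb[OF bounded_on_Bs[OF i s] J0E[OF h]] Bs_J0[OF h i] ..
  moreover have "hcarrier cp.K = hclosed_span cp.K
      (\<Union>\<alpha>\<in>{\<alpha>. \<forall>i\<in>{1..k}. \<alpha> i \<in> lists {1..n i}}. multiword_op k V \<alpha> ` J ` hcarrier H)"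
  proof -
    have gen: "multiword_op k V \<alpha> (J h) = cp.emb (gen \<alpha> h)"
      if "\<alpha> \<in> multi_words k n" "h \<in> hcarrier H" for \<alpha> h
      unfolding V_def J_def using multiword_emb[OF that(1) J0E[OF that(2)]] that(1)
      by (simp only: gen_def if_True)
    have e: "(\<lambda>_. []) \<in> multi_words k n" by (simp add: multi_words_def)
    \<comment> \<open>Indices that are not multi-words contribute only the vector zero; it already
      occurs as the image of 0 under the empty multi-word.\<close>
    have zero: "cp.emb 0 = multiword_op k V (\<lambda>_. []) (J 0)"
    proof -
      have "J0 0 = 0" using J0_scale[OF ip.S_zero, of 0] by (simp only: scale_zero_left fs.scale_zero_left)
      then show ?thesis using gen[OF e ip.S_zero] by (simp only: gen_empty)
    qed
    have "(\<Union>\<alpha>\<in>multi_words k n. multiword_op k V \<alpha> ` J ` hcarrier H) =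
        (\<Union>\<alpha>. (\<lambda>h. cp.emb (gen \<alpha> h)) ` hcarrier H)" (is "?L = ?R")
    proof (intro equalityI subsetI)
      fix x assume "x \<in> ?L"
      then obtain \<alpha> h where "\<alpha> \<in> multi_words k n" "h \<in> hcarrier H" "x = multiword_op k V \<alpha> (J h)" by blast
      then show "x \<in> ?R" by (intro UN_I[OF UNIV_I] image_eqI[of _ _ h]) (simp_all only: gen)
    next
      fix x assume "x \<in> ?R"
      then obtain \<alpha> h where h: "h \<in> hcarrier H" and x: "x = cp.emb (gen \<alpha> h)" by blast
      show "x \<in> ?L"
      proof (cases "\<alpha> \<in> multi_words k n")
        case True
        show ?thesis unfolding x gen[OF True h, symmetric]
          by (rule UN_I[OF True]) (rule imageI[OF imageI[OF h]])
      next
        case False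
        then have x0: "x = multiword_op k V (\<lambda>_. []) (J 0)" using x zero by (simp only: gen_def if_False)
        show ?thesis unfolding x0 by (rule UN_I[OF e]) (rule imageI[OF imageI[OF ip.S_zero]])
      qed
    qed
    then show ?thesis using cp.K_span_dense unfolding multi_words_def by simp
  qed
  ultimately have "minimal_dilation k n lam H T cp.K J V"
    unfolding minimal_dilation_def using cp.K_hilbert by blast
  moreover have "J = (\<lambda>h. cp.emb (J0 h))" "V = (\<lambda>i s. cp.ext (Sh i s))"
    by (simp_all add: fun_eq_iff J_def V_def)
  ultimately show ?thesis by simp
qed

end

section \<open>Uniqueness\<close>

text \<open>A relation rather than a map, since a vector may be a combination of the
  \<open>v a\<close> in many ways; that the corresponding combinations of the \<open>v' a\<close>
  coincide is a consequence of the equal Gram matrices.\<close>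

inductive comb_rel ::
  "'a::ab_group_add hspace \<Rightarrow> 'b::ab_group_add hspace \<Rightarrow> 'i set \<Rightarrow> ('i \<Rightarrow> 'a) \<Rightarrow> ('i \<Rightarrow> 'b) \<Rightarrow> 'a \<Rightarrow> 'b \<Rightarrow> bool"
  for K K' I v v' where
  zero: "comb_rel K K' I v v' 0 0"
| step: "\<lbrakk>a \<in> I; comb_rel K K' I v v' x x'\<rbrakk> \<Longrightarrow>
    comb_rel K K' I v v' (hscale K c (v a) + x) (hscale K' c (v' a) + x')"

locale same_gram = hK: hilbert_space K + hK': hilbert_space K'
  for K :: "'a::ab_group_add hspace" and K' :: "'b::ab_group_add hspace" +
  fixes I :: "'i set" and v :: "'i \<Rightarrow> 'a" and v' :: "'i \<Rightarrow> 'b"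
  assumes v_mem: "a \<in> I \<Longrightarrow> v a \<in> hcarrier K" and v'_mem: "a \<in> I \<Longrightarrow> v' a \<in> hcarrier K'"
    and gram: "\<lbrakk>a \<in> I; b \<in> I\<rbrakk> \<Longrightarrow> hinner K (v a) (v b) = hinner K' (v' a) (v' b)"
    and dense: "hcarrier K = hclosed_span K (v ` I)" "hcarrier K' = hclosed_span K' (v' ` I)"
begin

abbreviation R :: "'a \<Rightarrow> 'b \<Rightarrow> bool" where "R \<equiv> comb_rel K K' I v v'"

text \<open>The graph of the unitary, described weakly; \<^term>\<open>R\<close> is its restriction to linear combinations.\<close>

definition G :: "'a \<Rightarrow> 'b \<Rightarrow> bool" where
  "G x x' \<longleftrightarrow> x \<in> hcarrier K \<and> x' \<in> hcarrier K' \<and>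
     (\<forall>a\<in>I. hinner K x (v a) = hinner K' x' (v' a))"

lemma G_mem: "G x x' \<Longrightarrow> x \<in> hcarrier K \<and> x' \<in> hcarrier K'"
  by (simp add: G_def)

lemma G_gen: "a \<in> I \<Longrightarrow> G (v a) (v' a)"
  by (simp add: G_def v_mem v'_mem gram)

lemma G_add: "\<lbrakk>G x x'; G y y'\<rbrakk> \<Longrightarrow> G (x + y) (x' + y')"
  by (simp add: G_def v_mem v'_mem hK.hinner_add hK'.hinner_add hK.ip.S_add hK'.ip.S_add)

lemma G_scale: "G x x' \<Longrightarrow> G (hscale K c x) (hscale K' c x')"
  by (simp add: G_def v_mem v'_mem hK.hinner_scale hK'.hinner_scale hK.ip.S_scale hK'.ip.S_scale)

lemma G_diff: "\<lbrakk>G x x'; G y y'\<rbrakk> \<Longrightarrow> G (x - y) (x' - y')"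
  using G_add[OF _ G_scale[of y y' "-1"]] by force

text \<open>A pair in \<open>G\<close> is compatible with all generators, and linearity in the first
  argument extends this from generators to their combinations.\<close>

lemma R_inner: "R y y' \<Longrightarrow> G p p' \<Longrightarrow>
    y \<in> hcarrier K \<and> y' \<in> hcarrier K' \<and> hinner K y p = hinner K' y' p'"
proof (induction rule: comb_rel.induct)
  case zero
  then show ?case using G_mem[of p p']
    by (simp add: hK.ip.S_zero hK'.ip.S_zero hK.ip.q_zero_left hK'.ip.q_zero_left)
next
  case (step a x x' c)
  note p = G_mem[OF step.prems] and a = v_mem[OF step.hyps(1)] v'_mem[OF step.hyps(1)]
  have "hinner K (v a) p = hinner K' (v' a) p'"
    using step.prems step.hyps(1) hK.hinner_commute[of p "v a"] hK'.hinner_commute[of p' "v' a"] p a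
    by (simp add: G_def)
  then show ?case using step p a hK.ip.S_scale hK'.ip.S_scale hK.ip.S_add hK'.ip.S_add
    by (simp add: hK.hinner_add hK'.hinner_add hK.hinner_scale hK'.hinner_scale)
qed

lemma G_zero: "G 0 0"
  by (simp add: G_def hK.ip.S_zero hK'.ip.S_zero hK.ip.q_zero_left hK'.ip.q_zero_left v_mem v'_mem)

lemma R_G: "R y y' \<Longrightarrow> G y y'"
  using R_inner[OF _ G_zero] R_inner[OF _ G_gen] unfolding G_def by blast

lemma R_dist:
  assumes "R y y'" "R z z'"
  shows "hnorm K' (y' - z') = hnorm K (y - z)"
proof -
  note d = G_diff[OF R_G[OF assms(1)] R_G[OF assms(2)]]
  have "hinner K (y - z) (y - z) = hinner K' (y' - z') (y' - z')"
    using R_inner[OF assms(1) d] R_inner[OF assms(2) d] G_mem[OF d]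
    by (simp add: hK.ip.q_diff[of y z] hK'.ip.q_diff[of y' z'])
  then show ?thesis by (simp add: hnorm_def)
qed

lemma R_total: "x \<in> hK.span (v ` I) \<Longrightarrow> \<exists>x'. R x x'"
proof (induction rule: hK.span_induct_alt)
  case base
  show ?case by (rule exI[of _ 0]) (rule comb_rel.zero)
next
  case (step c w y)
  then obtain a y' where "a \<in> I" "w = v a" "R y y'" by blast
  then have "R (hscale K c w + y) (hscale K' c (v' a) + y')"
    using comb_rel.step[of a I K K' v v' y y' c] by simp
  then show ?case by blast
qed

text \<open>Combinations \<open>y m\<close> tend to \<open>x\<close>; by \<open>R_dist\<close> their
  counterparts \<open>y' m\<close> form a Cauchy sequence, and its limit is the partner. The
  identity of \<open>R_inner\<close> survives both limits.\<close>

lemma G_partner: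
  assumes x: "x \<in> hcarrier K"
  shows "\<exists>x' \<in> hcarrier K'. \<forall>p p'. G p p' \<longrightarrow> hinner K x p = hinner K' x' p'"
proof -
  have vI: "v ` I \<subseteq> hcarrier K" using v_mem by blast
  have cl: "\<forall>e>0. \<exists>y \<in> hK.span (v ` I). hnorm K (x - y) < e"
    using subst[OF dense(1), of "\<lambda>A. x \<in> A", OF x] hK.hclosed_span_iff[OF vI, of x] by blast
  have "\<exists>y y'. R y y' \<and> hnorm K (x - y) < inverse (real (Suc m))" for m
  proof -
    have "inverse (real (Suc m)) > 0" by simp
    then show ?thesis using cl R_total by blast
  qed
  then obtain y y' where y: "\<And>m. R (y m) (y' m)" "\<And>m. hnorm K (x - y m) < inverse (real (Suc m))"
    by metis
  note small = eventually_less_inverse[of "\<lambda>m. hnorm K (x - y m)", OF y(2)]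
  note mem = conjunct1[OF G_mem[OF R_G[OF y(1)]]] conjunct2[OF G_mem[OF R_G[OF y(1)]]]
  have "hK'.ip.cauchy y'"
    unfolding hK'.ip.cauchy_def
  proof (intro conjI allI impI)
    show "range y' \<subseteq> hcarrier K'" using mem(2) by blast
    fix e :: real assume e: "e > 0"
    obtain M where M: "\<forall>m\<ge>M. hnorm K (x - y m) < e / 2" using small[of "e / 2"] e by auto
    have "hnorm K' (y' m - y' n) < e" if "m \<ge> M" "n \<ge> M" for m n
    proof -
      have "hnorm K' (y' m - y' n) \<le> hnorm K (y m - x) + hnorm K (x - y n)"
        unfolding R_dist[OF y(1) y(1)] by (rule hK.ip.nrm_triangle3[OF mem(1) x mem(1)])
      also have "hnorm K (y m - x) = hnorm K (x - y m)" using hK.ip.nrm_commute[OF mem(1) x] .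
      finally show ?thesis using M[rule_format, OF that(1)] M[rule_format, OF that(2)] by linarith
    qed
    then show "\<exists>M. \<forall>m\<ge>M. \<forall>n\<ge>M. hnorm K' (y' m - y' n) < e" by blast
  qed
  then obtain x' where x': "x' \<in> hcarrier K'" "(\<lambda>m. hnorm K' (y' m - x')) \<longlonglongrightarrow> 0"
    using hK'.cauchy_limit by blast
  have yx: "(\<lambda>m. hnorm K (y m - x)) \<longlonglongrightarrow> 0"
  proof (rule LIMSEQ_I)
    fix e :: real assume "e > 0"
    from small[OF this] show "\<exists>M. \<forall>m\<ge>M. norm (hnorm K (y m - x) - 0) < e"
      using hK.ip.nrm_commute[OF mem(1) x] hK.ip.nrm_nonneg[OF hK.ip.S_diff[OF x mem(1)]] by simp
  qed
  have "hinner K x p = hinner K' x' p'" if p: "G p p'" for p p'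
    using hK.ip.q_tendsto[OF mem(1) x yx, of p] hK'.ip.q_tendsto[OF mem(2) x', of p'] G_mem[OF p]
      conjunct2[OF conjunct2[OF R_inner[OF y(1) p]]] by (intro LIMSEQ_unique) simp_all
  then show ?thesis using x'(1) by blast
qed

text \<open>The hypotheses are symmetric in the two spaces. The exchanged version yields both
  single-valuedness of \<open>G\<close> and surjectivity of the unitary.\<close>

lemma swapped: "same_gram K' K I v' v"
  using v_mem v'_mem gram dense by unfold_locales auto

lemma G_swap: "same_gram.G K' K I v' v x' x \<longleftrightarrow> G x x'"
  unfolding G_def same_gram.G_def[OF swapped] by (auto simp: eq_commute)

text \<open>The difference d of two images is related to 0. Let z be the partner of d in the
  exchanged situation; testing with the pair (0, d) gives <d, d> = <z, 0> = 0.\<close>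

lemma G_unique:
  assumes "G x x'" "G x x''"
  shows "x' = x''"
proof -
  have d: "G 0 (x' - x'')" using G_diff[OF assms] by simp
  obtain z where z: "z \<in> hcarrier K" "\<And>p p'. G p p' \<Longrightarrow> hinner K' (x' - x'') p' = hinner K z p"
    using same_gram.G_partner[OF swapped, of "x' - x''"] G_mem[OF d] unfolding G_swap by blast
  have "hinner K' (x' - x'') (x' - x'') = 0" using z(2)[OF d] hK.ip.q_zero_right[OF z(1)] by simp
  then show ?thesis using hK'.hnorm_eq_0[of "x' - x''"] G_mem[OF d] by (simp add: hnorm_def)
qed

lemma G_total: "x \<in> hcarrier K \<Longrightarrow> \<exists>x'. G x x' \<and> (\<forall>p p'. G p p' \<longrightarrow> hinner K x p = hinner K' x' p')"
  using G_partner[of x] G_gen unfolding G_def[of x] by blast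

lemma unitary_exists: "\<exists>U. unitary_map K K' U \<and> (\<forall>a\<in>I. U (v a) = v' a)"
proof -
  obtain U where U: "\<And>x. x \<in> hcarrier K \<Longrightarrow> G x (U x)"
    and iso: "\<And>x p p'. \<lbrakk>x \<in> hcarrier K; G p p'\<rbrakk> \<Longrightarrow> hinner K x p = hinner K' (U x) p'"
    using G_total by metis
  have "U ` hcarrier K = hcarrier K'"
  proof (intro equalityI subsetI)
    fix x' assume "x' \<in> hcarrier K'"
    then obtain x where x: "G x x'" using same_gram.G_total[OF swapped] unfolding G_swap by blast
    then have "x \<in> hcarrier K" using G_mem by blast
    then show "x' \<in> U ` hcarrier K" using G_unique[OF U x] by blast
  qed (use U G_mem in blast)
  moreover have "isometric_map K K' U"
    unfolding isometric_map_def linear_map_def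
  proof (intro conjI ballI allI)
    show "U \<in> hcarrier K \<rightarrow> hcarrier K'" using U G_mem by blast
    fix x assume x: "x \<in> hcarrier K"
    show "U (hscale K c x) = hscale K' c (U x)" for c
      using G_unique[OF U G_scale[OF U[OF x]]] hK.ip.S_scale[OF x] by blast
    fix y assume y: "y \<in> hcarrier K"
    show "U (x + y) = U x + U y"
      using G_unique[OF U G_add[OF U[OF x] U[OF y]]] hK.ip.S_add[OF x y] by blast
    show "hinner K' (U x) (U y) = hinner K x y" using iso[OF x U[OF y]] by simp
  qed
  moreover have "U (v a) = v' a" if "a \<in> I" for a
    using G_unique[OF U[OF v_mem[OF that]] G_gen[OF that]] .
  ultimately show ?thesis unfolding unitary_map_def by blast
qed

end

text \<open>Two norm-preserving linear maps that agree at y in the span differ at x by at most 2 ||x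
  - y||. It is applied with U V_(i,s) and V'_(i,s) U, so that intertwining needs checking only on
  generators.\<close>

lemma maps_agree:
  assumes K: "hilbert_space K" and K': "hilbert_space K'" and S: "S \<subseteq> hcarrier K"
    and dense: "hcarrier K = hclosed_span K S"
    and A: "linear_map K K' A" "\<And>x. x \<in> hcarrier K \<Longrightarrow> hnorm K' (A x) = hnorm K x"
    and B: "linear_map K K' B" "\<And>x. x \<in> hcarrier K \<Longrightarrow> hnorm K' (B x) = hnorm K x"
    and eq: "\<And>x. x \<in> S \<Longrightarrow> A x = B x" and x: "x \<in> hcarrier K"
  shows "A x = B x"
proof -
  interpret K: hilbert_space K by fact
  interpret K': hilbert_space K' by fact
  have lin: "L (x + y) = L x + L y" "L (hscale K c x) = hscale K' c (L x)" "L x \<in> hcarrier K'"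
    if "linear_map K K' L" "x \<in> hcarrier K" "y \<in> hcarrier K" for L x y c
    using that unfolding linear_map_def by auto
  have diff: "L (x - y) = L x - L y" if "linear_map K K' L" "x \<in> hcarrier K" "y \<in> hcarrier K" for L x y
  proof -
    have "L (x - y + y) = L (x - y) + L y" using lin(1)[OF that(1) K.ip.S_diff[OF that(2,3)] that(3)] .
    then show ?thesis by simp
  qed
  have sp: "y \<in> hcarrier K \<and> A y = B y" if "y \<in> K.span S" for y
    using that
  proof (induction rule: K.span_induct_alt)
    case base
    have "A 0 = 0" "B 0 = 0"
      using lin(2)[OF A(1) K.ip.S_zero K.ip.S_zero, of 0] lin(2)[OF B(1) K.ip.S_zero K.ip.S_zero, of 0]
      by simp_all
    then show ?case using K.ip.S_zero by simp
  next
    case (step c s y)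
    then have s: "s \<in> hcarrier K" "hscale K c s \<in> hcarrier K" using S K.ip.S_scale by blast+
    show ?case
      using step s lin(1)[OF A(1) s(2)] lin(2)[OF A(1) s(1,1)] lin(1)[OF B(1) s(2)] lin(2)[OF B(1) s(1,1)]
        eq[OF step.hyps(1)] K.ip.S_add[OF s(2)] by simp
  qed
  have "hnorm K' (A x - B x) \<le> e" if e: "e > 0" for e
  proof -
    obtain y where y: "y \<in> K.span S" "hnorm K (x - y) < e / 2"
    proof -
      have "x \<in> hclosed_span K S" using x by (rule subst[OF dense])
      then have "\<forall>e>0. \<exists>y \<in> K.span S. hnorm K (x - y) < e" unfolding K.hclosed_span_iff[OF S] by blast
      then show ?thesis using that half_gt_zero[OF e] by blast
    qed
    have yK: "y \<in> hcarrier K" and AB: "A y = B y" using sp[OF y(1)] by auto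
    have xy: "x - y \<in> hcarrier K" using K.ip.S_diff[OF x yK] .
    have "A x - B x = A (x - y) - B (x - y)"
      unfolding diff[OF A(1) x yK] diff[OF B(1) x yK] using AB by simp
    also have "hnorm K' \<dots> \<le> hnorm K' (A (x - y)) + hnorm K' (B (x - y))"
      using K'.ip.nrm_triangle3[OF lin(3)[OF A(1) xy xy] K'.ip.S_zero lin(3)[OF B(1) xy xy]]
        K'.ip.nrm_minus[OF lin(3)[OF B(1) xy xy]] by simp
    also have "\<dots> = 2 * hnorm K (x - y)" using A(2)[OF xy] B(2)[OF xy] by simp
    finally show ?thesis using y(2) by simp
  qed
  then have "hnorm K' (A x - B x) \<le> 0" by (rule field_le_epsilon[of _ 0, simplified])
  moreover have m: "A x - B x \<in> hcarrier K'"
    using lin(3)[OF A(1) x x] lin(3)[OF B(1) x x] K'.ip.S_diff by blast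
  ultimately have "hnorm K' (A x - B x) = 0" using K'.ip.nrm_nonneg[OF m] by simp
  then show ?thesis using K'.hnorm_eq_0[OF m] by simp
qed

section \<open>The Gram matrix of the generators of a minimal dilation\<close>

locale lambda_dilation =
  fixes k :: nat and n :: "nat \<Rightarrow> nat" and lam :: "nat \<Rightarrow> nat \<Rightarrow> nat \<Rightarrow> nat \<Rightarrow> complex"
    and H :: "'h::ab_group_add hspace" and T :: "nat \<Rightarrow> nat \<Rightarrow> 'h \<Rightarrow> 'h"
    and K :: "'a::ab_group_add hspace" and J :: "'h \<Rightarrow> 'a" and V :: "nat \<Rightarrow> nat \<Rightarrow> 'a \<Rightarrow> 'a"
  assumes lam_norm: "\<lbrakk>i \<in> {1..k}; j \<in> {1..k}; i \<noteq> j; s \<in> {1..n i}; t \<in> {1..n j}\<rbrakk>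
      \<Longrightarrow> cmod (lam i j s t) = 1"
    and lam_cnj: "\<lbrakk>i \<in> {1..k}; j \<in> {1..k}; i \<noteq> j; s \<in> {1..n i}; t \<in> {1..n j}\<rbrakk>
      \<Longrightarrow> lam j i t s = cnj (lam i j s t)"
    and T_adj: "\<lbrakk>i \<in> {1..k}; s \<in> {1..n i}; h \<in> hcarrier H\<rbrakk> \<Longrightarrow> adj H (T i s) h \<in> hcarrier H"
    and H: "hilbert_space H"
    and dilation: "minimal_dilation k n lam H T K J V"

sublocale lambda_dilation \<subseteq> hilbert_space K
  using dilation by (simp add: minimal_dilation_def)

context lambda_dilation
begin

abbreviation W :: "nat \<Rightarrow> nat \<Rightarrow> 'a \<Rightarrow> 'a" where "W i s \<equiv> adj K (V i s)"

lemma V_bounded: "\<lbrakk>i \<in> {1..k}; s \<in> {1..n i}\<rbrakk> \<Longrightarrow> bounded_operator K (V i s)"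
  using dilation by (simp add: minimal_dilation_def row_isometry_def)

lemma V_linear: "\<lbrakk>i \<in> {1..k}; s \<in> {1..n i}\<rbrakk> \<Longrightarrow> linear_map K K (V i s)"
  using V_bounded by (simp add: bounded_operator_def)

lemma V_mem: "\<lbrakk>i \<in> {1..k}; s \<in> {1..n i}; x \<in> hcarrier K\<rbrakk> \<Longrightarrow> V i s x \<in> hcarrier K"
  using V_linear linear_map_mem by blast

lemma W_V: "\<lbrakk>i \<in> {1..k}; s \<in> {1..n i}; t \<in> {1..n i}; x \<in> hcarrier K\<rbrakk>
    \<Longrightarrow> W i s (V i t x) = (if s = t then x else 0)"
  using dilation by (simp add: minimal_dilation_def row_isometry_def)

lemma W_V_other: "\<lbrakk>i \<in> {1..k}; s \<in> {1..n i}; j \<in> {1..k}; t \<in> {1..n j}; i \<noteq> j; x \<in> hcarrier K\<rbrakk>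
    \<Longrightarrow> W i s (V j t x) = hscale K (cnj (lam i j s t)) (V j t (W i s x))"
  using dilation by (simp add: minimal_dilation_def doubly_commuting_def)

lemma V_isometry:
  assumes "i \<in> {1..k}" "s \<in> {1..n i}" "x \<in> hcarrier K" "y \<in> hcarrier K"
  shows "hinner K (V i s x) (V i s y) = hinner K x y"
  using adj_inner[OF V_bounded, of i s x "V i s y"] assms V_mem[of i s y] W_V[of i s s y] by simp

text \<open>The equality case of Cauchy-Schwarz: \<open>V\<^sub>i\<^sub>,\<^sub>s V\<^sub>j\<^sub>,\<^sub>t x\<close> and \<open>\<lambda> V\<^sub>j\<^sub>,\<^sub>t V\<^sub>i\<^sub>,\<^sub>s x\<close> have the norm of \<open>x\<close>, and
  double commutation gives them the inner product \<open>\<langle>x, x\<rangle>\<close>.\<close>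

lemma V_V:
  assumes i: "i \<in> {1..k}" and s: "s \<in> {1..n i}" and j: "j \<in> {1..k}" and t: "t \<in> {1..n j}"
    and ij: "i \<noteq> j" and x: "x \<in> hcarrier K"
  shows "V i s (V j t x) = hscale K (lam i j s t) (V j t (V i s x))"
proof -
  define \<mu> where "\<mu> = lam i j s t"
  have \<mu>: "cmod \<mu> = 1" "\<mu> * cnj \<mu> = 1"
    using lam_norm[OF i j ij s t] complex_norm_square[of \<mu>] by (auto simp: \<mu>_def)
  define u where "u = V i s (V j t x)"
  define w where "w = V j t (V i s x)"
  have mem: "V j t x \<in> hcarrier K" "V i s x \<in> hcarrier K" "u \<in> hcarrier K" "w \<in> hcarrier K"
    using V_mem i s j t x by (auto simp: u_def w_def)
  have "hinner K u w = hinner K (V j t x) (W i s w)"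
    unfolding u_def using adj_inner[OF V_bounded[OF i s] mem(1,4)] .
  also have "W i s w = hscale K (cnj \<mu>) (V j t x)"
    unfolding w_def W_V_other[OF i s j t ij mem(2)] W_V[OF i s s x] \<mu>_def by simp
  also have "hinner K (V j t x) \<dots> = \<mu> * hinner K x x"
    using mem(1) V_isometry[OF j t x x] by (simp add: ip.q_scale_right)
  finally have "hinner K u (hscale K \<mu> w) = hinner K x x"
    using mem \<mu>(2) by (simp add: ip.q_scale_right mult.assoc[symmetric] mult.commute[of "cnj \<mu>"])
  moreover have "(hnorm K u)\<^sup>2 = Re (hinner K x x)"
    using ip.nrm_sq[OF mem(3)] V_isometry[OF i s mem(1,1)] V_isometry[OF j t x x] by (simp add: u_def)
  moreover have "(hnorm K (hscale K \<mu> w))\<^sup>2 = Re (hinner K x x)"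
    using ip.nrm_sq[OF mem(4)] V_isometry[OF j t mem(2,2)] V_isometry[OF i s x x] \<mu>(1) mem(4)
    by (simp add: w_def ip.nrm_scale)
  ultimately have "(hnorm K (u - hscale K \<mu> w))\<^sup>2 = 0"
    using mem ip.S_scale by (simp add: ip.nrm_sq_diff)
  then have "u - hscale K \<mu> w = 0"
    using hnorm_eq_0[of "u - hscale K \<mu> w"] mem ip.S_scale ip.S_diff by simp
  then show ?thesis by (simp add: u_def w_def \<mu>_def)
qed

lemma K_system: "lambda_system (hscale K) (hcarrier K) k n lam V W"
proof
  show "V i s (hscale K c x) = hscale K c (V i s x)"
    if "i \<in> {1..k}" "s \<in> {1..n i}" "x \<in> hcarrier K" for i s c x
    using V_linear[OF that(1,2)] that(3) by (simp add: linear_map_def)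
  show "W i s x \<in> hcarrier K" if "i \<in> {1..k}" "s \<in> {1..n i}" "x \<in> hcarrier K" for i s x
    using adj_mem[OF V_bounded] that by blast
qed (rule ip.S_scale V_mem V_V W_V_other W_V; assumption)+

sublocale ls: lambda_system "hscale K" "hcarrier K" k n lam V W
  by (rule K_system)

lemma J_mem: "h \<in> hcarrier H \<Longrightarrow> J h \<in> hcarrier K"
  using dilation by (auto simp: minimal_dilation_def isometric_map_def linear_map_def)

lemma J_inner: "\<lbrakk>h \<in> hcarrier H; h' \<in> hcarrier H\<rbrakk> \<Longrightarrow> hinner K (J h) (J h') = hinner H h h'"
  using dilation by (simp add: minimal_dilation_def isometric_map_def)

lemma W_J: "\<lbrakk>i \<in> {1..k}; s \<in> {1..n i}; h \<in> hcarrier H\<rbrakk> \<Longrightarrow> W i s (J h) = J (adj H (T i s) h)"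
  using dilation by (simp add: minimal_dilation_def)

definition vec :: "(nat \<Rightarrow> nat list) \<times> 'h \<Rightarrow> 'a" where
  "vec a = multiword_op k V (fst a) (J (snd a))"

abbreviation Idx :: "((nat \<Rightarrow> nat list) \<times> 'h) set" where
  "Idx \<equiv> multi_words k n \<times> hcarrier H"

lemma vec_mem: "a \<in> Idx \<Longrightarrow> vec a \<in> hcarrier K"
  unfolding vec_def by (rule ls.multiword_mem) (auto intro: J_mem)

lemma vec_dense: "hcarrier K = hclosed_span K (vec ` Idx)"
proof -
  have "vec ` Idx = (\<Union>\<alpha>\<in>{\<alpha>. \<forall>i\<in>{1..k}. \<alpha> i \<in> lists {1..n i}}. multiword_op k V \<alpha> ` J ` hcarrier H)"
    unfolding multi_words_def[symmetric] vec_def by force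
  then show ?thesis using dilation by (simp only: minimal_dilation_def)
qed

lemma V_vec:
  assumes i: "i \<in> {1..k}" and s: "s \<in> {1..n i}" and \<alpha>: "\<alpha> \<in> multi_words k n" and h: "h \<in> hcarrier H"
  shows "V i s (vec (\<alpha>, h)) = hscale K (word_prod (\<lambda>j. lam i j s) \<alpha> [1..<i]) (vec (\<alpha>(i := s # \<alpha> i), h))"
  unfolding vec_def fst_conv snd_conv by (rule ls.V_multiword[OF i s \<alpha> J_mem[OF h]])

lemma W_vec_Cons:
  assumes i: "i \<in> {1..k}" and s: "s \<in> {1..n i}" and \<alpha>: "\<alpha> \<in> multi_words k n" and h: "h \<in> hcarrier H"
    and ai: "\<alpha> i = t # w"
  shows "W i s (vec (\<alpha>, h)) = (if s = t then
    hscale K (word_prod (\<lambda>j t. cnj (lam i j s t)) \<alpha> [1..<i]) (vec (\<alpha>(i := w), h)) else 0)"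
  unfolding vec_def fst_conv snd_conv by (rule ls.W_multiword_Cons[OF i s \<alpha> J_mem[OF h] ai])

lemma W_vec_Nil:
  assumes i: "i \<in> {1..k}" and s: "s \<in> {1..n i}" and \<alpha>: "\<alpha> \<in> multi_words k n" and h: "h \<in> hcarrier H"
    and ai: "\<alpha> i = []"
  shows "W i s (vec (\<alpha>, h)) = hscale K (word_prod (\<lambda>j t. cnj (lam i j s t)) \<alpha> ([1..<i] @ [Suc i..<Suc k]))
    (vec (\<alpha>, adj H (T i s) h))"
  unfolding vec_def fst_conv snd_conv W_J[OF i s h, symmetric]
  by (rule ls.W_multiword_Nil[OF i s \<alpha> J_mem[OF h] ai])

lemma vec_empty:
  assumes "\<forall>i\<in>{1..k}. \<alpha> i = []"
  shows "vec (\<alpha>, h) = J h"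
proof -
  have "ls.words_op js \<alpha> x = x" if "set js \<subseteq> {1..k}" for js x
    using that assms by (induction js) (simp_all add: word_op_def)
  moreover have "set [1..<Suc k] \<subseteq> {1..k}" by auto
  ultimately show ?thesis unfolding vec_def fst_conv snd_conv multiword_op_def by blast
qed

text \<open>Up to a scalar the vector is V_(i,s) applied to the vector of the shorter multi-word, so
  the letter crosses the inner product as an adjoint. The scalar stays on the left; it is unimodular
  and is cancelled in \<open>gram_step\<close>.\<close>

lemma inner_vec_Cons:
  assumes i: "i \<in> {1..k}" and \<alpha>: "\<alpha> \<in> multi_words k n" and h: "h \<in> hcarrier H"
    and ai: "\<alpha> i = s # w" and y: "y \<in> hcarrier K"
  shows "word_prod (\<lambda>j. lam i j s) (\<alpha>(i := w)) [1..<i] * hinner K (vec (\<alpha>, h)) y =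
    hinner K (vec (\<alpha>(i := w), h)) (W i s y)"
proof -
  have sw: "s \<in> {1..n i}" "w \<in> lists {1..n i}" using multi_wordsD[OF \<alpha> i] ai by auto
  have \<alpha>0: "\<alpha>(i := w) \<in> multi_words k n" using ls.multi_words_upd[OF \<alpha> sw(2)] .
  have "(\<alpha>(i := w))(i := s # (\<alpha>(i := w)) i) = \<alpha>" using ai by auto
  then have "V i s (vec (\<alpha>(i := w), h)) =
      hscale K (word_prod (\<lambda>j. lam i j s) (\<alpha>(i := w)) [1..<i]) (vec (\<alpha>, h))"
    using V_vec[OF i sw(1) \<alpha>0 h] by (simp only:)
  then show ?thesis
    using adj_inner[OF V_bounded[OF i sw(1)] vec_mem[of "(\<alpha>(i := w), h)"] y] \<alpha>0 h
      hinner_scale[OF vec_mem[of "(\<alpha>, h)"] y] \<alpha> by simp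
qed

end

locale two_dilations = d1: lambda_dilation k n lam H T K J V + d2: lambda_dilation k n lam H T K' J' V'
  for k n lam H T K J V K' J' V'
begin

text \<open>The measure is the total length of both multi-words. A letter leaves \<alpha> and acts
  as an adjoint on the other vector, where it never lengthens \<beta>, so the measure drops. It may
  turn \<open>h'\<close> into T^* \<open>h'\<close>, which is why the hypothesis ranges over all
  vectors of H.\<close>

lemma gram_step:
  assumes IH: "\<And>\<alpha>' \<beta>' h h'. \<lbrakk>(\<Sum>i\<in>{1..k}. length (\<alpha>' i) + length (\<beta>' i)) < (\<Sum>i\<in>{1..k}. length (\<alpha> i) + length (\<beta> i));
      (\<alpha>', h) \<in> d1.Idx; (\<beta>', h') \<in> d1.Idx\<rbrakk>
      \<Longrightarrow> hinner K (d1.vec (\<alpha>', h)) (d1.vec (\<beta>', h')) = hinner K' (d2.vec (\<alpha>', h)) (d2.vec (\<beta>', h'))"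
    and \<alpha>: "(\<alpha>, h) \<in> d1.Idx" and \<beta>: "(\<beta>, h') \<in> d1.Idx" and i: "i \<in> {1..k}" and ai: "\<alpha> i = s # w"
  shows "hinner K (d1.vec (\<alpha>, h)) (d1.vec (\<beta>, h')) = hinner K' (d2.vec (\<alpha>, h)) (d2.vec (\<beta>, h'))"
proof -
  have a: "\<alpha> \<in> multi_words k n" "h \<in> hcarrier H" "\<beta> \<in> multi_words k n" "h' \<in> hcarrier H"
    using \<alpha> \<beta> by auto
  have sw: "s \<in> {1..n i}" "w \<in> lists {1..n i}" using multi_wordsD[OF a(1) i] ai by auto
  define \<alpha>0 where "\<alpha>0 = \<alpha>(i := w)"
  have \<alpha>0: "\<alpha>0 \<in> multi_words k n" unfolding \<alpha>0_def using d1.ls.multi_words_upd[OF a(1) sw(2)] .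
  then have x: "(\<alpha>0, h) \<in> d1.Idx" using a by simp
  define c where "c = word_prod (\<lambda>j. lam i j s) \<alpha>0 [1..<i]"
  have c: "c \<noteq> 0"
  proof -
    have "cmod c = 1"
      unfolding c_def
    proof (rule norm_word_prod)
      fix j t assume "j \<in> set [1..<i]" and t: "t \<in> set (\<alpha>0 j)"
      then have j: "j \<in> {1..k}" "i \<noteq> j" using i by auto
      then show "cmod (lam i j s t) = 1"
        using multi_wordsD[OF \<alpha>0 j(1)] t by (intro d1.lam_norm[OF i j(1,2) sw(1)]) auto
    qed
    then show ?thesis by auto
  qed
  have less: "(\<Sum>l\<in>{1..k}. length (\<alpha>0 l) + length (\<beta>' l)) < (\<Sum>l\<in>{1..k}. length (\<alpha> l) + length (\<beta> l))"
    if "\<And>l. length (\<beta>' l) \<le> length (\<beta> l)" for \<beta>' :: "nat \<Rightarrow> nat list"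
  proof (rule sum_strict_mono_ex1)
    show "\<forall>l\<in>{1..k}. length (\<alpha>0 l) + length (\<beta>' l) \<le> length (\<alpha> l) + length (\<beta> l)"
    proof
      fix l
      show "length (\<alpha>0 l) + length (\<beta>' l) \<le> length (\<alpha> l) + length (\<beta> l)"
        using that[of l] ai by (cases "l = i") (auto simp: \<alpha>0_def)
    qed
    show "\<exists>l\<in>{1..k}. length (\<alpha>0 l) + length (\<beta>' l) < length (\<alpha> l) + length (\<beta> l)"
      using that[of i] ai by (intro bexI[OF _ i]) (simp add: \<alpha>0_def)
  qed simp
  have "hinner K (d1.vec (\<alpha>0, h)) (d1.W i s (d1.vec (\<beta>, h'))) =
      hinner K' (d2.vec (\<alpha>0, h)) (d2.W i s (d2.vec (\<beta>, h')))"
  proof (cases "\<beta> i")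
    case Nil
    have t: "adj H (T i s) h' \<in> hcarrier H" using d1.T_adj[OF i sw(1) a(4)] .
    have y: "(\<beta>, adj H (T i s) h') \<in> d1.Idx" using a t by simp
    show ?thesis
      unfolding d1.W_vec_Nil[OF i sw(1) a(3,4) Nil] d2.W_vec_Nil[OF i sw(1) a(3,4) Nil]
        d1.ip.q_scale_right[OF d1.vec_mem[OF x] d1.vec_mem[OF y]]
        d2.ip.q_scale_right[OF d2.vec_mem[OF x] d2.vec_mem[OF y]]
        IH[OF less x y, OF order_refl] ..
  next
    case (Cons t v)
    have v: "v \<in> lists {1..n i}" using multi_wordsD[OF a(3) i] Cons by auto
    have y: "(\<beta>(i := v), h') \<in> d1.Idx" using d1.ls.multi_words_upd[OF a(3) v] a by simp
    have l: "length ((\<beta>(i := v)) l) \<le> length (\<beta> l)" for l using Cons by simp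
    show ?thesis
    proof (cases "s = t")
      case True
      show ?thesis
        unfolding d1.W_vec_Cons[OF i sw(1) a(3,4) Cons] d2.W_vec_Cons[OF i sw(1) a(3,4) Cons]
          if_P[OF True]
          d1.ip.q_scale_right[OF d1.vec_mem[OF x] d1.vec_mem[OF y]]
          d2.ip.q_scale_right[OF d2.vec_mem[OF x] d2.vec_mem[OF y]]
          IH[OF less x y, OF l] ..
    next
      case False
      show ?thesis
        unfolding d1.W_vec_Cons[OF i sw(1) a(3,4) Cons] d2.W_vec_Cons[OF i sw(1) a(3,4) Cons]
          if_not_P[OF False] d1.ip.q_zero_right[OF d1.vec_mem[OF x]]
          d2.ip.q_zero_right[OF d2.vec_mem[OF x]] ..
    qed
  qed
  then have "c * hinner K (d1.vec (\<alpha>, h)) (d1.vec (\<beta>, h')) = c * hinner K' (d2.vec (\<alpha>, h)) (d2.vec (\<beta>, h'))"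
    using d1.inner_vec_Cons[OF i a(1,2) ai d1.vec_mem[OF \<beta>]]
      d2.inner_vec_Cons[OF i a(1,2) ai d2.vec_mem[OF \<beta>]] by (simp only: c_def \<alpha>0_def)
  then show ?thesis using c by simp
qed

lemma gram:
  assumes "(\<alpha>, h) \<in> d1.Idx" "(\<beta>, h') \<in> d1.Idx"
  shows "hinner K (d1.vec (\<alpha>, h)) (d1.vec (\<beta>, h')) = hinner K' (d2.vec (\<alpha>, h)) (d2.vec (\<beta>, h'))"
  using assms
proof (induction "\<Sum>i\<in>{1..k}. length (\<alpha> i) + length (\<beta> i)" arbitrary: \<alpha> \<beta> h h' rule: less_induct)
  case less
  show ?case
  proof (cases "\<exists>i\<in>{1..k}. \<alpha> i \<noteq> []")
    case True
    then obtain i s w where "i \<in> {1..k}" "\<alpha> i = s # w" by (metis list.exhaust)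
    then show ?thesis using gram_step[OF less.hyps less.prems] by blast
  next
    case \<alpha>: False
    show ?thesis
    proof (cases "\<exists>i\<in>{1..k}. \<beta> i \<noteq> []")
      case True
      then obtain i s w where iw: "i \<in> {1..k}" "\<beta> i = s # w" by (metis list.exhaust)
      \<comment> \<open>All blocks of \<alpha> are empty, so no letter can leave the left side. The
        measure is symmetric, and the roles are exchanged by conjugate symmetry.\<close>
      have "hinner K (d1.vec (\<beta>, h')) (d1.vec (\<alpha>, h)) = hinner K' (d2.vec (\<beta>, h')) (d2.vec (\<alpha>, h))"
      proof (rule gram_step[OF _ less.prems(2,1) iw])
        fix \<alpha>' \<beta>' g g'
        assume lt: "(\<Sum>i\<in>{1..k}. length (\<alpha>' i) + length (\<beta>' i)) < (\<Sum>i\<in>{1..k}. length (\<beta> i) + length (\<alpha> i))"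
          and mem: "(\<alpha>', g) \<in> d1.Idx" "(\<beta>', g') \<in> d1.Idx"
        have "(\<Sum>i\<in>{1..k}. length (\<beta> i) + length (\<alpha> i)) = (\<Sum>i\<in>{1..k}. length (\<alpha> i) + length (\<beta> i))"
          by (simp only: add.commute)
        with lt show "hinner K (d1.vec (\<alpha>', g)) (d1.vec (\<beta>', g')) = hinner K' (d2.vec (\<alpha>', g)) (d2.vec (\<beta>', g'))"
          using less.hyps[OF _ mem] by simp
      qed
      then show ?thesis
        using d1.hinner_commute[OF d1.vec_mem[OF less.prems(2)] d1.vec_mem[OF less.prems(1)]]
          d2.hinner_commute[OF d2.vec_mem[OF less.prems(2)] d2.vec_mem[OF less.prems(1)]] by simp
    next
      case False
      then have e: "\<forall>i\<in>{1..k}. \<alpha> i = []" "\<forall>i\<in>{1..k}. \<beta> i = []" using \<alpha> by auto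
      show ?thesis
        unfolding d1.vec_empty[OF e(1)] d1.vec_empty[OF e(2)] d2.vec_empty[OF e(1)] d2.vec_empty[OF e(2)]
        using less.prems d1.J_inner d2.J_inner by simp
    qed
  qed
qed

lemma isomorphic: "isomorphic_dilations k n H K J V K' J' V'"
proof -
  interpret same_gram K K' d1.Idx d1.vec d2.vec
  proof
    fix a b assume "a \<in> d1.Idx" "b \<in> d1.Idx"
    then show "hinner K (d1.vec a) (d1.vec b) = hinner K' (d2.vec a) (d2.vec b)"
      using gram[of "fst a" "snd a" "fst b" "snd b"] by simp
  qed (rule d1.vec_mem d2.vec_mem d1.vec_dense d2.vec_dense; assumption)+
  obtain U where U: "unitary_map K K' U" and Uv: "\<And>a. a \<in> d1.Idx \<Longrightarrow> U (d1.vec a) = d2.vec a"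
    using unitary_exists by blast
  have lin: "linear_map K K' U" and iso: "\<And>x y. \<lbrakk>x \<in> hcarrier K; y \<in> hcarrier K\<rbrakk> \<Longrightarrow> hinner K' (U x) (U y) = hinner K x y"
    using U by (auto simp: unitary_map_def isometric_map_def)
  have Um: "U x \<in> hcarrier K'" if "x \<in> hcarrier K" for x using lin that by (auto simp: linear_map_def)
  have Us: "U (hscale K c x) = hscale K' c (U x)" if "x \<in> hcarrier K" for c x
    using lin that by (auto simp: linear_map_def)
  have sub: "d1.vec ` d1.Idx \<subseteq> hcarrier K" using d1.vec_mem by blast
  have inter: "U (V i s x) = V' i s (U x)"
    if i: "i \<in> {1..k}" and s: "s \<in> {1..n i}" and x: "x \<in> hcarrier K" for i s x
  proof (rule maps_agree[OF d1.hilbert_space_axioms d2.hilbert_space_axioms sub d1.vec_dense _ _ _ _ _ x])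
    show "linear_map K K' (\<lambda>x. U (V i s x))" "linear_map K K' (\<lambda>x. V' i s (U x))"
      using lin d1.V_linear[OF i s] d2.V_linear[OF i s] unfolding linear_map_def by (auto simp: Pi_iff)
    show "hnorm K' (U (V i s y)) = hnorm K y" "hnorm K' (V' i s (U y)) = hnorm K y" if y: "y \<in> hcarrier K" for y
      using iso[OF d1.V_mem[OF i s y] d1.V_mem[OF i s y]] d1.V_isometry[OF i s y y]
        d2.V_isometry[OF i s Um[OF y] Um[OF y]] iso[OF y y] by (simp_all add: hnorm_def)
    fix y assume "y \<in> d1.vec ` d1.Idx"
    then obtain \<alpha> h where y: "y = d1.vec (\<alpha>, h)" and a: "\<alpha> \<in> multi_words k n" "h \<in> hcarrier H" by auto
    have "\<alpha>(i := s # \<alpha> i) \<in> multi_words k n"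
      using s multi_wordsD[OF a(1) i] by (intro d1.ls.multi_words_upd[OF a(1)]) simp
    then have m: "(\<alpha>(i := s # \<alpha> i), h) \<in> d1.Idx" "(\<alpha>, h) \<in> d1.Idx" using a by auto
    \<comment> \<open>On generators \<open>V_vec\<close> gives both dilations the same scalar and
      the same longer multi-word.\<close>
    show "U (V i s y) = V' i s (U y)"
      unfolding y d1.V_vec[OF i s a] Us[OF d1.vec_mem[OF m(1)]] Uv[OF m(1)] Uv[OF m(2)] d2.V_vec[OF i s a] ..
  qed
  have "U (J h) = J' h" if h: "h \<in> hcarrier H" for h
  proof -
    have "((\<lambda>_. []), h) \<in> d1.Idx" using h by (simp add: multi_words_def)
    from Uv[OF this] show ?thesis by (simp add: d1.vec_empty d2.vec_empty)
  qed
  then show ?thesis unfolding isomorphic_dilations_def using U inter by blast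
qed

end

section \<open>The dilation theorem\<close>

locale polyball_element = hilbert_space H for H :: "'h::ab_group_add hspace" +
  fixes k :: nat and n :: "nat \<Rightarrow> nat" and lam :: "nat \<Rightarrow> nat \<Rightarrow> nat \<Rightarrow> nat \<Rightarrow> complex"
    and T :: "nat \<Rightarrow> nat \<Rightarrow> 'h \<Rightarrow> 'h"
  assumes lam_norm: "\<lbrakk>i \<in> {1..k}; j \<in> {1..k}; i \<noteq> j; s \<in> {1..n i}; t \<in> {1..n j}\<rbrakk>
      \<Longrightarrow> cmod (lam i j s t) = 1"
    and lam_cnj: "\<lbrakk>i \<in> {1..k}; j \<in> {1..k}; i \<noteq> j; s \<in> {1..n i}; t \<in> {1..n j}\<rbrakk>
      \<Longrightarrow> lam j i t s = cnj (lam i j s t)"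
    and T_polyball: "T \<in> polyball k n lam H"
begin

text \<open>Extending \<open>lam\<close> by \<open>1\<close> and \<open>T\<^sub>i\<^sub>,\<^sub>s\<^sup>*\<close> by \<open>0\<close> beyond the valid indices and the carrier makes
  the commutation relations hold without side conditions.\<close>

definition valid :: "nat \<Rightarrow> nat \<Rightarrow> bool" where
  "valid i s \<longleftrightarrow> i \<in> {1..k} \<and> s \<in> {1..n i}"

definition tlam :: "nat \<Rightarrow> nat \<Rightarrow> nat \<Rightarrow> nat \<Rightarrow> complex" where
  "tlam i j s t = (if valid i s \<and> valid j t then lam i j s t else 1)"

definition tB :: "nat \<Rightarrow> nat \<Rightarrow> 'h \<Rightarrow> 'h" where
  "tB i s x = (if valid i s \<and> x \<in> hcarrier H then adj H (T i s) x else 0)"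

lemma T_bounded: "valid i s \<Longrightarrow> bounded_operator H (T i s)"
  using T_polyball unfolding polyball_def valid_def by blast

lemma T_comm: "\<lbrakk>valid i s; valid j t; i \<noteq> j; x \<in> hcarrier H\<rbrakk> \<Longrightarrow>
    T i s (T j t x) = hscale H (lam i j s t) (T j t (T i s x))"
  using T_polyball unfolding polyball_def valid_def by blast

lemma T_mem: "\<lbrakk>valid i s; x \<in> hcarrier H\<rbrakk> \<Longrightarrow> T i s x \<in> hcarrier H"
  using T_bounded[of i s] linear_map_mem by (auto simp: bounded_operator_def)

lemma tB_mem: "tB i s x \<in> hcarrier H"
  using adj_mem[OF T_bounded] ip.S_zero by (simp add: tB_def)

lemma tB_inner: "\<lbrakk>valid i s; x \<in> hcarrier H; y \<in> hcarrier H\<rbrakk> \<Longrightarrow> hinner H (T i s x) y = hinner H x (tB i s y)"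
  using adj_inner[OF T_bounded] by (simp add: tB_def)

lemma tB_scale: "x \<in> hcarrier H \<Longrightarrow> tB i s (hscale H c x) = hscale H c (tB i s x)"
  using adj_scale[OF T_bounded[of i s]] ip.S_scale by (simp add: tB_def)

lemma tB_comm:
  assumes ij: "i \<noteq> j"
  shows "tB i s (tB j t x) = hscale H (tlam i j s t) (tB j t (tB i s x))"
proof (cases "valid i s \<and> valid j t \<and> x \<in> hcarrier H")
  case True
  then have i: "valid i s" and j: "valid j t" and x: "x \<in> hcarrier H" by auto
  have l: "lam j i t s = cnj (lam i j s t)"
    using i j lam_cnj[of i j s t] ij by (simp add: valid_def)
  show ?thesis
  proof (rule hinner_eqI)
    fix z assume z: "z \<in> hcarrier H"
    have "hinner H z (tB i s (tB j t x)) = hinner H (T j t (T i s z)) x"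
      using i j x z tB_mem T_mem by (simp add: tB_inner)
    also have "\<dots> = cnj (lam i j s t) * hinner H (T i s (T j t z)) x"
      using T_comm[OF j i ij[symmetric] z] l i j x z T_mem by (simp add: hinner_scale)
    also have "\<dots> = cnj (lam i j s t) * hinner H z (tB j t (tB i s x))"
      using i j x z tB_mem T_mem by (simp add: tB_inner)
    finally show "hinner H z (tB i s (tB j t x)) = hinner H z (hscale H (tlam i j s t) (tB j t (tB i s x)))"
      using i j z tB_mem by (simp add: tlam_def ip.q_scale_right)
  qed (use tB_mem ip.S_scale in auto)
next
  \<comment> \<open>An invalid index or a vector off the carrier makes both sides vanish, whatever
    the scalar is.\<close>
  case False
  have "tB i s 0 = 0" for i s using tB_scale[OF ip.S_zero, of i s 0] by simp
  then show ?thesis using False by (auto simp: tB_def[of _ _ x]) (auto simp: tB_def)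
qed

lemma tB_adjoints: "lambda_adjoints H tlam tB"
proof
  fix i j s t :: nat assume ij: "i \<noteq> j"
  show "cmod (tlam i j s t) = 1" using lam_norm[of i j s t] ij by (auto simp: tlam_def valid_def)
  show "tlam j i t s = cnj (tlam i j s t)" using lam_cnj[of i j s t] ij by (auto simp: tlam_def valid_def)
  show "tB i s (tB j t x) = hscale H (tlam i j s t) (tB j t (tB i s x))" for x using tB_comm[OF ij] .
next
  fix i s x y c
  show "tB i s x \<in> hcarrier H" by (rule tB_mem)
  show "x \<in> hcarrier H \<Longrightarrow> tB i s (hscale H c x) = hscale H c (tB i s x)" by (rule tB_scale)
  show "x \<in> hcarrier H \<Longrightarrow> y \<in> hcarrier H \<Longrightarrow> tB i s (x + y) = tB i s x + tB i s y"
    using adj_add[OF T_bounded[of i s]] ip.S_add by (simp add: tB_def)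
qed

sublocale la: lambda_adjoints H n tlam tB
  by (rule tB_adjoints)

lemma row_contraction:
  assumes i: "i \<in> {1..k}"
  shows "la.row_contraction i"
  unfolding la.row_contraction_def
proof
  fix x assume x: "x \<in> hcarrier H"
  have v: "valid i s" if "s \<in> {1..n i}" for s using i that by (simp add: valid_def)
  have a: "adj H (T i s) x = tB i s x" if "s \<in> {1..n i}" for s using v[OF that] x by (simp add: tB_def)
  have "op_le H (\<lambda>x. \<Sum>s\<in>{1..n i}. T i s (adj H (T i s) x)) (\<lambda>x. x)"
    using T_polyball i unfolding polyball_def by blast
  then have "0 \<le> hinner H (x - (\<Sum>s\<in>{1..n i}. T i s (adj H (T i s) x))) x"
    unfolding op_le_def using x by blast
  also have "(\<Sum>s\<in>{1..n i}. T i s (adj H (T i s) x)) = (\<Sum>s\<in>{1..n i}. T i s (tB i s x))"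
    by (rule sum.cong[OF refl]) (simp only: a)
  also have "hinner H (x - (\<Sum>s\<in>{1..n i}. T i s (tB i s x))) x = hinner H x x - (\<Sum>s\<in>{1..n i}. hinner H (T i s (tB i s x)) x)"
  proof -
    have m: "T i s (tB i s x) \<in> hcarrier H" if "s \<in> {1..n i}" for s using T_mem[OF v[OF that] tB_mem] .
    have "(\<Sum>s\<in>{1..n i}. T i s (tB i s x)) \<in> hcarrier H" by (rule ip.S_sum) (rule m)
    moreover have "hinner H (\<Sum>s\<in>{1..n i}. T i s (tB i s x)) x = (\<Sum>s\<in>{1..n i}. hinner H (T i s (tB i s x)) x)"
      by (rule ip.q_sum[OF _ x]) (rule m)
    ultimately show ?thesis using ip.q_diff[OF x _ x] by simp
  qed
  also have "\<dots> = hinner H x x - (\<Sum>s\<in>{1..n i}. hinner H (tB i s x) (tB i s x))"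
    by (intro arg_cong2[of _ _ _ _ minus] refl sum.cong tB_inner v tB_mem x)
  finally show "(\<Sum>s\<in>{1..n i}. (hnorm H (tB i s x))\<^sup>2) \<le> (hnorm H x)\<^sup>2"
    using x tB_mem by (simp add: ip.nrm_sq less_eq_complex_def)
qed

text \<open>The innermost factor of \<open>foldr\<close> is the last index and that of
  \<open>fold\<close> the first, hence \<open>rev\<close>. Membership in the carrier is carried
  along in the induction because adjoints can be moved only there.\<close>

lemma defect_form:
  assumes "set is \<subseteq> {1..k}" and x: "x \<in> hcarrier H"
  shows "foldr (\<lambda>i X. (\<lambda>x. X x - Phi H (n i) r (T i) X x)) is (\<lambda>x. x) x \<in> hcarrier H \<and>
    (\<forall>y \<in> hcarrier H. hinner H (foldr (\<lambda>i X. (\<lambda>x. X x - Phi H (n i) r (T i) X x)) is (\<lambda>x. x) x) y =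
      fold (la.D_form r) (rev is) (hinner H) x y)"
  using assms
proof (induction "is" arbitrary: x)
  case (Cons i "is")
  define X where "X = foldr (\<lambda>i X. (\<lambda>x. X x - Phi H (n i) r (T i) X x)) is (\<lambda>x. x)"
  define Y where "Y = fold (la.D_form r) (rev is) (hinner H)"
  have X: "X x \<in> hcarrier H" and XY: "y \<in> hcarrier H \<Longrightarrow> hinner H (X x) y = Y x y"
    if "x \<in> hcarrier H" for x y
    using Cons.IH[OF _ that] Cons.prems(1) unfolding X_def Y_def by auto
  have v: "valid i s" if "s \<in> {1..n i}" for s using Cons.prems(1) that by (simp add: valid_def)
  note x = Cons.prems(2)
  have Phi: "Phi H (n i) r (T i) X x = (\<Sum>s\<in>{1..n i}. hscale H (of_real (r\<^sup>2)) (T i s (X (tB i s x))))"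
    unfolding Phi_def by (rule sum.cong) (use v x in \<open>auto simp: tB_def\<close>)
  have m: "hscale H (of_real (r\<^sup>2)) (T i s (X (tB i s x))) \<in> hcarrier H" if "s \<in> {1..n i}" for s
    using T_mem[OF v[OF that] X[OF tB_mem]] ip.S_scale by blast
  have Pm: "Phi H (n i) r (T i) X x \<in> hcarrier H" unfolding Phi by (rule ip.S_sum) (rule m)
  have "hinner H (X x - Phi H (n i) r (T i) X x) y = la.D_form r i Y x y" if y: "y \<in> hcarrier H" for y
  proof -
    have "hinner H (Phi H (n i) r (T i) X x) y =
        (\<Sum>s\<in>{1..n i}. hinner H (hscale H (of_real (r\<^sup>2)) (T i s (X (tB i s x)))) y)"
      unfolding Phi by (rule ip.q_sum[OF _ y]) (rule m)
    also have "\<dots> = (\<Sum>s\<in>{1..n i}. of_real (r\<^sup>2) * Y (tB i s x) (tB i s y))"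
    proof (rule sum.cong[OF refl])
      fix s assume s: "s \<in> {1..n i}"
      show "hinner H (hscale H (of_real (r\<^sup>2)) (T i s (X (tB i s x)))) y = of_real (r\<^sup>2) * Y (tB i s x) (tB i s y)"
        using hinner_scale[OF T_mem[OF v[OF s] X[OF tB_mem]] y] tB_inner[OF v[OF s] X[OF tB_mem] y]
          XY[OF tB_mem tB_mem] by simp
    qed
    finally show ?thesis
      using ip.q_diff[OF X[OF x] Pm y] XY[OF x y]
      by (simp add: la.D_form_def la.Phi_form_def sum_distrib_left)
  qed
  moreover have "X x - Phi H (n i) r (T i) X x \<in> hcarrier H" using ip.S_diff[OF X[OF x] Pm] .
  ultimately show ?case by (simp add: X_def Y_def)
qed simp

lemma defect_form_pos:
  assumes r: "0 \<le> r" "r < 1"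
  shows "la.form_pos (fold (la.D_form r) (rev [1..<Suc k]) (hinner H))"
  unfolding la.form_pos_def
proof
  fix x assume x: "x \<in> hcarrier H"
  have "op_le H (\<lambda>x. 0) (defect_op H k n r T)"
    using T_polyball r unfolding polyball_def by auto
  then have "0 \<le> hinner H (defect_op H k n r T x) x" using x by (simp add: op_le_def)
  moreover have "set [1..<Suc k] \<subseteq> {1..k}" by auto
  ultimately have "0 \<le> fold (la.D_form r) (rev [1..<Suc k]) (hinner H) x x"
    using defect_form[of "[1..<Suc k]" x r] x unfolding defect_op_def by simp
  then show "0 \<le> Re (fold (la.D_form r) (rev [1..<Suc k]) (hinner H) x x)"
    by (simp add: less_eq_complex_def)
qed

lemma model: "lambda_model H n tlam tB k"
proof
  fix ys assume ys: "ys \<in> set (subseqs [1..<Suc k])"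
  show "la.form_pos (fold (la.D_form 1) ys (hinner H))"
  proof (rule la.form_pos_limit)
    fix r :: real assume r: "0 \<le> r" "r < 1"
    show "la.form_pos (fold (la.D_form r) ys (hinner H))"
      by (rule la.form_pos_sub[OF _ _ r defect_form_pos[OF r] ys]) (auto intro!: row_contraction)
  qed
qed

lemma doubly_commuting_tlam: "doubly_commuting k n tlam K V \<longleftrightarrow> doubly_commuting k n lam K V"
  unfolding doubly_commuting_def by (auto simp: tlam_def valid_def)

lemma dilation_exists: "\<exists>(K :: 'h dilation_vec hspace) J V. minimal_dilation k n lam H T K J V"
proof -
  interpret lm: lambda_model H n tlam tB k by (rule model)
  have "minimal_dilation k n tlam H T lm.cp.K (\<lambda>h. lm.cp.emb (lm.J0 h)) (\<lambda>i s. lm.cp.ext (lm.Sh i s))"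
    by (rule lm.model_dilation) (simp add: tB_def valid_def)
  then have "minimal_dilation k n lam H T lm.cp.K (\<lambda>h. lm.cp.emb (lm.J0 h)) (\<lambda>i s. lm.cp.ext (lm.Sh i s))"
    unfolding minimal_dilation_def doubly_commuting_tlam .
  then show ?thesis by blast
qed

lemma lambda_dilation:
  assumes "minimal_dilation k n lam H T K J V"
  shows "lambda_dilation k n lam H T K J V"
proof
  show "adj H (T i s) h \<in> hcarrier H" if "i \<in> {1..k}" "s \<in> {1..n i}" "h \<in> hcarrier H" for i s h
    using adj_mem[OF T_bounded] that by (simp add: valid_def)
qed (rule lam_norm lam_cnj hilbert_space_axioms assms; assumption)+

lemma dilation_unique:
  assumes "minimal_dilation k n lam H T K J V" "minimal_dilation k n lam H T K' J' V'"
  shows "isomorphic_dilations k n H K J V K' J' V'"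
proof -
  interpret two_dilations k n lam H T K J V K' J' V'
    by (intro two_dilations.intro lambda_dilation assms)
  show ?thesis by (rule isomorphic)
qed

end

theorem theorem6p1:
  fixes k :: nat and n :: "nat \<Rightarrow> nat"
    and lam :: "nat \<Rightarrow> nat \<Rightarrow> nat \<Rightarrow> nat \<Rightarrow> complex"
    and H :: "'h::ab_group_add hspace" and T :: "nat \<Rightarrow> nat \<Rightarrow> 'h \<Rightarrow> 'h"
  assumes "k \<ge> 1"
    and "\<And>i. i \<in> {1..k} \<Longrightarrow> n i \<ge> 1"
    and "\<And>i j s t. \<lbrakk>i \<in> {1..k}; j \<in> {1..k}; i \<noteq> j; s \<in> {1..n i}; t \<in> {1..n j}\<rbrakk>
           \<Longrightarrow> cmod (lam i j s t) = 1"
    and "\<And>i j s t. \<lbrakk>i \<in> {1..k}; j \<in> {1..k}; i \<noteq> j; s \<in> {1..n i}; t \<in> {1..n j}\<rbrakk>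
           \<Longrightarrow> lam j i t s = cnj (lam i j s t)"
    and "hilbert_space H"
    and "T \<in> polyball k n lam H"
  shows "(\<exists>(K :: 'h dilation_vec hspace) J V. minimal_dilation k n lam H T K J V) \<and>
         (\<forall>(K :: 'a::ab_group_add hspace) J V (K' :: 'b::ab_group_add hspace) J' V'.
            minimal_dilation k n lam H T K J V \<longrightarrow> minimal_dilation k n lam H T K' J' V' \<longrightarrow>
            isomorphic_dilations k n H K J V K' J' V')"
proof -
  interpret polyball_element H k n lam T
    using assms by (intro polyball_element.intro polyball_element_axioms.intro)
  show ?thesis using dilation_exists dilation_unique by blast
qed

end
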